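(* Let $p \in (1,\infty)$. Suppose $\left|1-\frac{2}{p}\right| \le \cos\theta$ and $B_a = 0$. Then $S$ extends consistently to a contraction $C_0$-semigroup $S^{(p)}$ on $L_p(\mathbb{R}^d)$.
   Context: Let $d \in \mathbb{N}$, $\theta \in [0,\frac{\pi}{2})$ and $c_{kl} \in W^{2,\infty}(\mathbb{R}^d,\mathbb{C})$ for all $k,l\in\{1,\dots,d\}$. Set $C=(c_{kl})_{1\le k,l\le d}$ and $\Sigma_\theta=\{re^{i\psi}: r\ge 0,\ |\psi|\le\theta\}$. Assume $(C(x)\xi,\xi)\in\Sigma_\theta$ for all $x\in\mathbb{R}^d$ and $\xi\in\mathbb{C}^d$, where $(\cdot,\cdot)$ is the standard inner product on $\mathbb{C}^d$, linear in the first variable. Write $C=R+iB$, where $R$ and $B$ are $d\times d$ matrix-valued functions with real-valued entries, and let $B_a=\frac12(B-B^T)$ be the anti-symmetric part of $B$. Function spaces are complex. Define the sesquilinear form $\mathfrak{a}_0(u,v)=\sum_{k,l=1}^d\int_{\mathbb{R}^d}c_{kl}\,(\partial_k u)\,\partial_l\overline{v}$ with domain $C_c^\infty(\mathbb{R}^d)$. It is closable in $L_2(\mathbb{R}^d)$. Let $A$ be the ($m$-sectorial) operator in $L_2(\mathbb{R}^d)$ associated with the closure of $\mathfrak{a}_0$, and let $S$ be the $C_0$-semigroup on $L_2(\mathbb{R}^d)$ generated by $-A$. "Extends consistently" means that $S^{(p)}_t u = S_t u$ for all $t>0$ and $u\in L_2(\mathbb{R}^d)\cap L_p(\mathbb{R}^d)$.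 *)

theory Defs
  imports "HOL-Analysis.Analysis"
begin

text \<open>
  Elements of \<open>L\<^sub>p(\<real>\<^sup>d)\<close> are represented by Lebesgue measurable functions, and equality in
  \<open>L\<^sub>p\<close> is equality almost everywhere.  An operator on \<open>L\<^sub>p\<close> is a map between representatives
  whose laws are required almost everywhere only; a bounded linear one automatically
  respects equality almost everywhere.  The dimension \<open>d\<close> is \<open>CARD('n)\<close>.
\<close>

definition Lp_space :: "real \<Rightarrow> (real^'n \<Rightarrow> complex) set" where
  "Lp_space p = {f \<in> borel_measurable lebesgue. integrable lebesgue (\<lambda>x. norm (f x) powr p)}"

definition Lp_norm :: "real \<Rightarrow> (real^'n \<Rightarrow> complex) \<Rightarrow> real" where
  "Lp_norm p f = (LINT x|lebesgue. norm (f x) powr p) powr (1 / p)"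

definition Linf_space :: "(real^'n \<Rightarrow> complex) set" where
  "Linf_space = {f \<in> borel_measurable lebesgue. \<exists>K. AE x in lebesgue. norm (f x) \<le> K}"

definition L2_inner :: "(real^'n \<Rightarrow> complex) \<Rightarrow> (real^'n \<Rightarrow> complex) \<Rightarrow> complex" where
  "L2_inner f g = (LINT x|lebesgue. f x * cnj (g x))"


section \<open>Test functions and Sobolev spaces\<close>

definition partial_deriv :: "'n \<Rightarrow> (real^'n \<Rightarrow> complex) \<Rightarrow> real^'n \<Rightarrow> complex" where
  "partial_deriv k f x = frechet_derivative f (at x) (axis k 1)"

text \<open>A list of indices plays the role of a multi-index, its length being the order.\<close>

definition iter_partial_deriv :: "'n list \<Rightarrow> (real^'n \<Rightarrow> complex) \<Rightarrow> real^'n \<Rightarrow> complex" where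
  "iter_partial_deriv ks f = foldr partial_deriv ks f"

text \<open>
  Differentiability of all iterated partial derivatives makes all of them continuous, so
  this is \<open>C\<^sub>c\<^sup>\<infinity>(\<real>\<^sup>d)\<close>.
\<close>

definition test_functions :: "(real^'n \<Rightarrow> complex) set" where
  "test_functions =
     {\<phi>. (\<forall>ks. iter_partial_deriv ks \<phi> differentiable_on UNIV) \<and> compact (closure {x. \<phi> x \<noteq> 0})}"

definition weak_deriv ::
    "'n list \<Rightarrow> (real^'n \<Rightarrow> complex) \<Rightarrow> (real^'n \<Rightarrow> complex) \<Rightarrow> bool" where
  "weak_deriv ks f g \<longleftrightarrow>
     (\<forall>\<phi>\<in>test_functions.
        (LINT x|lebesgue. f x * iter_partial_deriv ks \<phi> x) =
        (-1) ^ length ks * (LINT x|lebesgue. g x * \<phi> x))"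

text \<open>\<open>W\<^sup>m\<^sup>,\<^sup>\<infinity>(\<real>\<^sup>d, \<complex>)\<close>, without a choice of the continuous representative.\<close>

definition sobolev_inf :: "nat \<Rightarrow> (real^'n \<Rightarrow> complex) set" where
  "sobolev_inf m =
     {f \<in> Linf_space. \<forall>ks. length ks \<le> m \<longrightarrow> (\<exists>g\<in>Linf_space. weak_deriv ks f g)}"


section \<open>Coefficient matrices\<close>

definition sector :: "real \<Rightarrow> complex set" where
  "sector \<theta> = {of_real r * cis \<psi> | r \<psi>. 0 \<le> r \<and> \<bar>\<psi>\<bar> \<le> \<theta>}"

definition cvec_inner :: "complex^'n \<Rightarrow> complex^'n \<Rightarrow> complex" where
  "cvec_inner \<xi> \<eta> = (\<Sum>k\<in>UNIV. \<xi> $ k * cnj (\<eta> $ k))"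

definition antisym_part :: "real^'n^'n \<Rightarrow> real^'n^'n" where
  "antisym_part M = (1/2) *\<^sub>R (M - transpose M)"


section \<open>Forms and their associated operators\<close>

definition elliptic_form ::
    "(real^'n \<Rightarrow> complex^'n^'n) \<Rightarrow> (real^'n \<Rightarrow> complex) \<Rightarrow> (real^'n \<Rightarrow> complex) \<Rightarrow> complex" where
  "elliptic_form C u v =
     (\<Sum>k\<in>UNIV. \<Sum>l\<in>UNIV.
        (LINT x|lebesgue. C x $ k $ l * partial_deriv k u x * partial_deriv l (\<lambda>y. cnj (v y)) x))"

text \<open>
  Convergence with respect to a sectorial form \<open>a\<close> with domain \<open>D\<close>: the sequence in \<open>D\<close>
  converges to \<open>u\<close> in \<open>L\<^sub>2\<close> and is Cauchy with respect to \<open>a\<close>.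
\<close>

definition form_converges ::
    "((real^'n \<Rightarrow> complex) \<Rightarrow> (real^'n \<Rightarrow> complex) \<Rightarrow> complex) \<Rightarrow> (real^'n \<Rightarrow> complex) set \<Rightarrow>
     (nat \<Rightarrow> real^'n \<Rightarrow> complex) \<Rightarrow> (real^'n \<Rightarrow> complex) \<Rightarrow> bool" where
  "form_converges a D w u \<longleftrightarrow>
     (\<forall>n. w n \<in> D) \<and> u \<in> Lp_space 2 \<and>
     (\<lambda>n. Lp_norm 2 (\<lambda>x. w n x - u x)) \<longlonglongrightarrow> 0 \<and>
     (\<forall>\<epsilon>>0. \<exists>N. \<forall>m\<ge>N. \<forall>n\<ge>N. norm (a (\<lambda>x. w m x - w n x) (\<lambda>x. w m x - w n x)) < \<epsilon>)"

definition closure_dom ::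
    "((real^'n \<Rightarrow> complex) \<Rightarrow> (real^'n \<Rightarrow> complex) \<Rightarrow> complex) \<Rightarrow> (real^'n \<Rightarrow> complex) set \<Rightarrow>
     (real^'n \<Rightarrow> complex) set" where
  "closure_dom a D = {u. \<exists>w. form_converges a D w u}"

text \<open>
  For \<open>u\<close> and \<open>v\<close> in \<open>closure_dom a D\<close> the value below is well defined precisely because the
  form is closable.
\<close>

definition closure_form ::
    "((real^'n \<Rightarrow> complex) \<Rightarrow> (real^'n \<Rightarrow> complex) \<Rightarrow> complex) \<Rightarrow> (real^'n \<Rightarrow> complex) set \<Rightarrow>
     (real^'n \<Rightarrow> complex) \<Rightarrow> (real^'n \<Rightarrow> complex) \<Rightarrow> complex" where
  "closure_form a D u v =
     (THE z. \<forall>w w'. form_converges a D w u \<longrightarrow> form_converges a D w' v \<longrightarrow>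
        (\<lambda>n. a (w n) (w' n)) \<longlonglongrightarrow> z)"

text \<open>Graph of the operator in \<open>L\<^sub>2\<close> associated with the form \<open>b\<close> with domain \<open>V\<close>.\<close>

definition form_operator ::
    "((real^'n \<Rightarrow> complex) \<Rightarrow> (real^'n \<Rightarrow> complex) \<Rightarrow> complex) \<Rightarrow> (real^'n \<Rightarrow> complex) set \<Rightarrow>
     ((real^'n \<Rightarrow> complex) \<times> (real^'n \<Rightarrow> complex)) set" where
  "form_operator b V = {(u, f). u \<in> V \<and> f \<in> Lp_space 2 \<and> (\<forall>v\<in>V. b u v = L2_inner f v)}"

definition elliptic_operator ::
    "(real^'n \<Rightarrow> complex^'n^'n) \<Rightarrow> ((real^'n \<Rightarrow> complex) \<times> (real^'n \<Rightarrow> complex)) set" where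
  "elliptic_operator C =
     form_operator (closure_form (elliptic_form C) test_functions)
                   (closure_dom (elliptic_form C) test_functions)"


section \<open>Semigroups on \<open>L\<^sub>p\<close>\<close>

definition bounded_linear_Lp ::
    "real \<Rightarrow> ((real^'n \<Rightarrow> complex) \<Rightarrow> (real^'n \<Rightarrow> complex)) \<Rightarrow> bool" where
  "bounded_linear_Lp p T \<longleftrightarrow>
     (\<forall>f\<in>Lp_space p. T f \<in> Lp_space p) \<and>
     (\<forall>f\<in>Lp_space p. \<forall>g\<in>Lp_space p. AE x in lebesgue. T (\<lambda>y. f y + g y) x = T f x + T g x) \<and>
     (\<forall>c. \<forall>f\<in>Lp_space p. AE x in lebesgue. T (\<lambda>y. c * f y) x = c * T f x) \<and>
     (\<exists>K. \<forall>f\<in>Lp_space p. Lp_norm p (T f) \<le> K * Lp_norm p f)"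

text \<open>Only the values \<open>T t\<close> with \<open>t \<ge> 0\<close> are relevant.\<close>

definition C0_semigroup ::
    "real \<Rightarrow> (real \<Rightarrow> (real^'n \<Rightarrow> complex) \<Rightarrow> (real^'n \<Rightarrow> complex)) \<Rightarrow> bool" where
  "C0_semigroup p T \<longleftrightarrow>
     (\<forall>t\<ge>0. bounded_linear_Lp p (T t)) \<and>
     (\<forall>f\<in>Lp_space p. AE x in lebesgue. T 0 f x = f x) \<and>
     (\<forall>s\<ge>0. \<forall>t\<ge>0. \<forall>f\<in>Lp_space p. AE x in lebesgue. T (s + t) f x = T s (T t f) x) \<and>
     (\<forall>f\<in>Lp_space p. ((\<lambda>t. Lp_norm p (\<lambda>x. T t f x - f x)) \<longlongrightarrow> 0) (at_right 0))"

definition contraction_semigroup ::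
    "real \<Rightarrow> (real \<Rightarrow> (real^'n \<Rightarrow> complex) \<Rightarrow> (real^'n \<Rightarrow> complex)) \<Rightarrow> bool" where
  "contraction_semigroup p T \<longleftrightarrow>
     C0_semigroup p T \<and> (\<forall>t\<ge>0. \<forall>f\<in>Lp_space p. Lp_norm p (T t f) \<le> Lp_norm p f)"

text \<open>Graph of the generator.\<close>

definition generator ::
    "real \<Rightarrow> (real \<Rightarrow> (real^'n \<Rightarrow> complex) \<Rightarrow> (real^'n \<Rightarrow> complex)) \<Rightarrow>
     ((real^'n \<Rightarrow> complex) \<times> (real^'n \<Rightarrow> complex)) set" where
  "generator p T =
     {(u, f). u \<in> Lp_space p \<and> f \<in> Lp_space p \<and>
        ((\<lambda>h. Lp_norm p (\<lambda>x. (T h u x - u x) / of_real h - f x)) \<longlongrightarrow> 0) (at_right 0)}"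

definition extends_consistently ::
    "real \<Rightarrow> (real \<Rightarrow> (real^'n \<Rightarrow> complex) \<Rightarrow> (real^'n \<Rightarrow> complex)) \<Rightarrow>
     (real \<Rightarrow> (real^'n \<Rightarrow> complex) \<Rightarrow> (real^'n \<Rightarrow> complex)) \<Rightarrow> bool" where
  "extends_consistently p S Sp \<longleftrightarrow>
     (\<forall>t>0. \<forall>u\<in>Lp_space 2 \<inter> Lp_space p. AE x in lebesgue. Sp t u x = S t u x)"

end

theory Submission
  imports Defs
begin

text \<open>
  For a weight \<open>\<psi> \<ge> 0\<close> let \<open>F z = \<psi> (\<bar>z\<bar>\<^sup>2) z\<close> and let \<open>G\<close> be its potential, \<open>G z\<close> being half of the
  integral of \<open>\<psi>\<close> over \<open>[0, \<bar>z\<bar>\<^sup>2]\<close>.  For \<open>\<psi> s = s\<^sup>m\<close> with \<open>m = (p - 2) / 2\<close> this is the duality map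
  \<open>\<bar>z\<bar>\<^sup>p\<^sup>-\<^sup>2 z\<close> of \<open>L\<^sub>p\<close> with \<open>G z = \<bar>z\<bar>\<^sup>p / p\<close>.  Along an orbit \<open>u' = - A u\<close> the integral of \<open>G u\<close> has
  derivative \<open>- Re (A u, F u)\<close>, so \<open>S\<close> contracts the \<open>L\<^sub>p\<close> norm once \<open>Re (A u, F u) \<ge> 0\<close>.

  This inequality is pointwise.  With \<open>\<omega>\<close> the phase of \<open>u x\<close> write the gradient of \<open>u\<close> at \<open>x\<close> as
  \<open>\<omega> (a + \<i> b)\<close> with real vectors \<open>a\<close> and \<open>b\<close>.  Applying \<open>F\<close> turns it into \<open>\<omega> (\<alpha> a + \<i> \<beta> b)\<close>, where \<open>\<beta> = \<psi>\<close>
  and \<open>\<alpha>\<close> is the radial derivative of \<open>F\<close> (\<open>reg_map_has_derivative\<close>).  As \<open>B\<close> is symmetric, the real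
  part of the integrand is \<open>\<alpha> R[a,a] + \<beta> R[b,b] - (\<alpha> - \<beta>) B[a,b]\<close> (\<open>Re_hform_frame\<close>).  The sector
  condition on real vectors makes \<open>B\<close> bounded by \<open>tan \<theta>\<close> relative to \<open>R\<close>, so the expression is
  nonnegative as soon as \<open>(\<alpha> - \<beta>)\<^sup>2 tan\<^sup>2 \<theta> \<le> 4 \<alpha> \<beta>\<close> (\<open>frame_accretive\<close>).  For the pure power
  \<open>\<alpha> / \<beta> = p - 1\<close>, and the condition becomes \<open>\<bar>1 - 2 / p\<bar> \<le> cos \<theta>\<close> (\<open>angle_condition\<close>).

  In general the pure power is neither smooth nor Lipschitz, so that \<open>F\<close> need not preserve the form domain.  It
  is replaced by \<open>\<psi> s = ((e + s) / (1 + e s))\<^sup>m\<close> with \<open>0 < e < 1\<close>, for which \<open>\<alpha> / \<beta>\<close> lies between \<open>1\<close>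
  and \<open>p - 1\<close>; the admissible ratios form an interval (\<open>ratio_admissible\<close>).  Now \<open>F\<close> maps test functions
  to test functions and is bounded with respect to the form norm, because for symmetric \<open>B\<close> the real
  part of the form decouples into \<open>R[a,a] + R[b,b]\<close> (\<open>form_F_bounded\<close>).  The coefficients may degenerate, so
  the form norm need not control the gradient; the inequality is carried from test functions to the
  domain of \<open>A\<close> along form-Cauchy sequences only (\<open>form_operator_pairing\<close>, \<open>operator_F_accretive\<close>).

  To integrate along an orbit one needs its continuity from the left, hence local boundedness of
  the semigroup, hence the uniform boundedness principle.  Integration by parts, with one derivative
  falling on the coefficients, puts the test functions into the domain of \<open>A\<close>; they are dense
  in \<open>L\<^sub>2\<close>, so the energy decreases on all of \<open>L\<^sub>2\<close> (\<open>energy_decreasing\<close>), and \<open>e \<rightarrow> 0\<close> gives contractivity on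
  \<open>L\<^sub>2 \<inter> L\<^sub>p\<close> (\<open>Lp_contractive\<close>).  Extension by density then yields \<open>S\<^sup>(\<^sup>p\<^sup>)\<close>.  Its strong continuity uses
  that almost everywhere convergence with norms that do not exceed the norm of the limit
  implies convergence in \<open>L\<^sub>p\<close> (\<open>Lp_tendsto_of_AE\<close>); this covers the extreme exponents, where there is no room to interpolate.
\<close>

section \<open>Lebesgue spaces\<close>

text \<open>
  A bound by a sum of two squares, applied to \<open>r u\<close> and \<open>v / r\<close>, has the form of the assumption with \<open>s = r\<^sup>2\<close>,
  and so becomes a bound by a product.  Cauchy-Schwarz inequalities are obtained in this way for
  \<open>L\<^sub>2\<close>, for sectorial forms and for the imaginary part of the coefficients.
\<close>

lemma young_optimize:
  fixes X a b :: real
  assumes "a \<ge> 0" "b \<ge> 0" and X: "\<And>s. s > 0 \<Longrightarrow> X \<le> s * a + b / s"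
  shows "X \<le> 2 * sqrt (a * b)"
proof (cases "a = 0 \<or> b = 0")
  case True
  have "X \<le> 0"
  proof (rule field_le_epsilon)
    fix e :: real assume e: "e > 0"
    show "X \<le> 0 + e"
    proof (cases "a = 0")
      case True
      have "X \<le> b / ((b + 1) / e)" using X[of "(b + 1) / e"] True e assms by simp
      also have "\<dots> \<le> e" using e assms by (simp add: field_simps)
      finally show ?thesis by simp
    next
      case False
      then have "b = 0" "a > 0" using True assms by auto
      then have "X \<le> (e / a) * a" using X[of "e / a"] e by simp
      then show ?thesis using \<open>a > 0\<close> by simp
    qed
  qed
  moreover have "0 \<le> 2 * sqrt (a * b)" using assms by simp
  ultimately show ?thesis by linarith
next
  case False
  then have pos: "a > 0" "b > 0" using assms by auto
  have "X \<le> sqrt (b / a) * a + b / sqrt (b / a)" using X[of "sqrt (b / a)"] pos by simp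
  also have "sqrt (b / a) * a = sqrt (a * b)"
    using pos by (simp add: real_sqrt_divide real_sqrt_mult field_simps)
  also have "b / sqrt (b / a) = sqrt (a * b)"
    using pos by (simp add: real_sqrt_divide real_sqrt_mult field_simps)
  finally show ?thesis by simp
qed

lemma tendsto_norm_le:
  fixes X :: "'a \<Rightarrow> 'b::real_normed_vector"
  assumes Y: "(Y \<longlongrightarrow> 0) F" and le: "\<And>n. norm (X n - l) \<le> Y n"
  shows "(X \<longlongrightarrow> l) F"
proof -
  have "((\<lambda>n. X n - l) \<longlongrightarrow> 0) F"
    by (rule Lim_null_comparison[OF always_eventually Y]) (use le in simp)
  then show ?thesis by (simp add: LIM_zero_iff)
qed

text \<open>
  Fatou's lemma for the Bochner integral, where the bound on the integrals also gives integrability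
  of the limit.
\<close>

lemma integral_Fatou:
  fixes h :: "nat \<Rightarrow> 'a \<Rightarrow> real"
  assumes int: "\<And>n. integrable M (h n)" and nn: "\<And>n x. 0 \<le> h n x" and g: "g \<in> borel_measurable M"
    and lim: "AE x in M. (\<lambda>n. h n x) \<longlonglongrightarrow> g x" and bd: "\<And>n. (LINT x|M. h n x) \<le> c"
  shows "integrable M g" and "(LINT x|M. g x) \<le> c" and "AE x in M. 0 \<le> g x"
proof -
  show g0: "AE x in M. 0 \<le> g x"
    using lim by eventually_elim (rule LIMSEQ_le_const, auto simp: nn)
  have c0: "0 \<le> c" using bd[of 0] Bochner_Integration.integral_nonneg[of M "h 0", OF nn] by linarith
  have "(\<integral>\<^sup>+x. ennreal (g x) \<partial>M) = (\<integral>\<^sup>+x. liminf (\<lambda>n. ennreal (h n x)) \<partial>M)"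
    by (rule nn_integral_cong_AE, use lim in eventually_elim)
       (metis lim_imp_Liminf tendsto_ennrealI trivial_limit_sequentially)
  also have "\<dots> \<le> liminf (\<lambda>n. \<integral>\<^sup>+x. ennreal (h n x) \<partial>M)"
    by (rule nn_integral_liminf) (use int in auto)
  also have "\<dots> \<le> liminf (\<lambda>n::nat. ennreal c)"
    by (rule Liminf_mono) (simp add: nn_integral_eq_integral[OF int] nn ennreal_leI bd)
  also have "\<dots> = ennreal c" by (simp add: Liminf_const)
  finally have *: "(\<integral>\<^sup>+x. ennreal (g x) \<partial>M) \<le> ennreal c" .
  then have "(\<integral>\<^sup>+x. ennreal (g x) \<partial>M) < \<infinity>" by (simp add: le_less_trans)
  then show i: "integrable M g" by (intro integrableI_nonneg g g0)
  show "(LINT x|M. g x) \<le> c"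
    using * c0 nn_integral_eq_integral[OF i g0] by simp
qed

abbreviation Lp_dist :: "real \<Rightarrow> (real^'n \<Rightarrow> complex) \<Rightarrow> (real^'n \<Rightarrow> complex) \<Rightarrow> real" where
  "Lp_dist p f g \<equiv> Lp_norm p (\<lambda>x. f x - g x)"

abbreviation Lp_tendsto :: "real \<Rightarrow> (nat \<Rightarrow> real^'n \<Rightarrow> complex) \<Rightarrow> (real^'n \<Rightarrow> complex) \<Rightarrow> bool" where
  "Lp_tendsto p f g \<equiv> (\<lambda>n. Lp_dist p (f n) g) \<longlonglongrightarrow> 0"

lemma measurable_Lp [measurable_dest]: "f \<in> Lp_space p \<Longrightarrow> f \<in> borel_measurable lebesgue"
  and integrable_Lp: "f \<in> Lp_space p \<Longrightarrow> integrable lebesgue (\<lambda>x. norm (f x) powr p)"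
  by (auto simp: Lp_space_def)

lemma measurable_cnj [measurable]: "cnj \<in> borel_measurable borel"
  by (intro borel_measurable_continuous_onI continuous_intros)

lemma Lp_spaceI: "f \<in> borel_measurable lebesgue \<Longrightarrow> integrable lebesgue (\<lambda>x. norm (f x) powr p) \<Longrightarrow> f \<in> Lp_space p"
  by (auto simp: Lp_space_def)

lemma Lp_norm_nonneg [simp]: "0 \<le> Lp_norm p f"
  by (simp add: Lp_norm_def)

lemma Lp_norm_powr: "0 < p \<Longrightarrow> Lp_norm p f powr p = (LINT x|lebesgue. norm (f x) powr p)"
  by (simp add: Lp_norm_def powr_powr integral_nonneg)

lemma Lp_norm_le_iff:
  assumes "0 < p" "0 \<le> c"
  shows "Lp_norm p f \<le> c \<longleftrightarrow> (LINT x|lebesgue. norm (f x) powr p) \<le> c powr p"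
  using assms Lp_norm_powr[of p f]
  by (metis Lp_norm_nonneg less_eq_real_def linorder_not_less powr_less_mono2 powr_mono2)

text \<open>
  Lebesgue measure is complete, so a function that equals a measurable one almost everywhere is itself measurable;
  if neither function is measurable, both integrals have the default value 0.  This spares every
  measurability check when representatives are exchanged.
\<close>

lemma integral_lebesgue_cong_AE:
  fixes f g :: "real^'n \<Rightarrow> real"
  assumes ae: "AE x in lebesgue. f x = g x"
  shows "integral\<^sup>L lebesgue f = integral\<^sup>L lebesgue g"
proof -
  have transfer: "k \<in> borel_measurable lebesgue"
    if h: "h \<in> borel_measurable lebesgue" and hk: "AE x in lebesgue. h x = k x" for h k :: "real^'n \<Rightarrow> real"
  proof (rule measurableI)
    fix A :: "real set" assume A: "A \<in> sets borel"
    have "AE x in lebesgue. x \<in> h -` A \<inter> space lebesgue \<longleftrightarrow> x \<in> k -` A \<inter> space lebesgue"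
      using hk by eventually_elim simp
    then show "k -` A \<inter> space lebesgue \<in> sets lebesgue"
      by (rule completion.in_sets_AE[OF _ measurable_sets[OF h A]]) simp
  qed simp
  show ?thesis
  proof (cases "f \<in> borel_measurable lebesgue")
    case True
    then show ?thesis by (intro integral_cong_AE transfer[OF True ae] ae)
  next
    case False
    have "AE x in lebesgue. g x = f x" using ae by eventually_elim simp
    then have "g \<notin> borel_measurable lebesgue" using False transfer by blast
    then show ?thesis
      using False borel_measurable_integrable not_integrable_integral_eq by metis
  qed
qed

lemma Lp_norm_cong_AE:
  assumes "AE x in lebesgue. f x = g x" shows "Lp_norm p f = Lp_norm p g"
  unfolding Lp_norm_def
  by (rule arg_cong[where f="\<lambda>a. a powr _"], rule integral_lebesgue_cong_AE)
     (use assms in eventually_elim, simp)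

lemma Lp_dist_cong_AE:
  assumes "AE x in lebesgue. f x = f' x" shows "Lp_dist p f g = Lp_dist p f' g"
  by (rule Lp_norm_cong_AE) (use assms in eventually_elim, simp)

lemma Lp_space_dominated:
  assumes f: "f \<in> Lp_space p" and g: "g \<in> borel_measurable lebesgue" and p: "0 < p"
    and le: "AE x in lebesgue. norm (g x) \<le> K * norm (f x)"
  shows "g \<in> Lp_space p"
proof (rule Lp_spaceI[OF g])
  have "integrable lebesgue (\<lambda>x. \<bar>K\<bar> powr p * norm (f x) powr p)"
    using integrable_Lp[OF f] by simp
  then show "integrable lebesgue (\<lambda>x. norm (g x) powr p)"
  proof (rule Bochner_Integration.integrable_bound)
    show "AE x in lebesgue. norm (norm (g x) powr p) \<le> norm (\<bar>K\<bar> powr p * norm (f x) powr p)"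
      using le
    proof eventually_elim
      case (elim x)
      then have "norm (g x) \<le> \<bar>K\<bar> * norm (f x)"
        by (smt (verit) mult_right_mono norm_ge_zero)
      then have "norm (g x) powr p \<le> (\<bar>K\<bar> * norm (f x)) powr p" using p by (intro powr_mono2) auto
      then show ?case by (simp add: powr_mult)
    qed
  qed (use g in measurable)
qed

lemma Lp_norm_mono:
  assumes f: "f \<in> Lp_space p" and p: "0 < p" and g: "g \<in> borel_measurable lebesgue"
    and le: "AE x in lebesgue. norm (g x) \<le> norm (f x)"
  shows "Lp_norm p g \<le> Lp_norm p f"
proof -
  have g: "g \<in> Lp_space p" by (rule Lp_space_dominated[OF f g p, of 1]) (use le in auto)
  have "(LINT x|lebesgue. norm (g x) powr p) \<le> (LINT x|lebesgue. norm (f x) powr p)"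
    by (rule integral_mono_AE) (use f g integrable_Lp le p in \<open>auto elim!: eventually_mono intro: powr_mono2\<close>)
  then show ?thesis using p unfolding Lp_norm_def by (intro powr_mono2) (auto intro: integral_nonneg)
qed

lemma Lp_space_zero [simp]: "(\<lambda>x. 0) \<in> Lp_space p"
  by (simp add: Lp_space_def)

lemma Lp_space_cmult:
  assumes "f \<in> Lp_space p" shows "(\<lambda>x. c * f x) \<in> Lp_space p"
  using assms by (auto simp: Lp_space_def norm_mult powr_mult)

lemma Lp_space_uminus:
  assumes "f \<in> Lp_space p" shows "(\<lambda>x. - f x) \<in> Lp_space p"
  using assms by (auto simp: Lp_space_def)

lemma powr_add_le:
  fixes a b p :: real assumes "0 \<le> a" "0 \<le> b" "0 < p"
  shows "(a + b) powr p \<le> 2 powr p * (a powr p + b powr p)"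
proof -
  have "(a + b) powr p \<le> (2 * max a b) powr p" using assms by (intro powr_mono2) auto
  also have "\<dots> = 2 powr p * max a b powr p" using assms by (simp add: powr_mult)
  also have "max a b powr p \<le> a powr p + b powr p" by (auto simp: max_def)
  finally show ?thesis by simp
qed

lemma Lp_space_add:
  assumes f: "f \<in> Lp_space p" and g: "g \<in> Lp_space p" and p: "0 < p"
  shows "(\<lambda>x. f x + g x) \<in> Lp_space p"
proof (rule Lp_spaceI)
  note [measurable] = measurable_Lp[OF f] measurable_Lp[OF g]
  show "(\<lambda>x. f x + g x) \<in> borel_measurable lebesgue" by measurable
  have "integrable lebesgue (\<lambda>x. 2 powr p * (norm (f x) powr p + norm (g x) powr p))"
    using integrable_Lp[OF f] integrable_Lp[OF g] by simp
  then show "integrable lebesgue (\<lambda>x. norm (f x + g x) powr p)"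
  proof (rule Bochner_Integration.integrable_bound)
    have "norm (f x + g x) powr p \<le> 2 powr p * (norm (f x) powr p + norm (g x) powr p)" for x
      by (rule order_trans[OF powr_mono2 powr_add_le]) (use p norm_triangle_ineq in auto)
    then show "AE x in lebesgue. norm (norm (f x + g x) powr p) \<le> norm (2 powr p * (norm (f x) powr p + norm (g x) powr p))"
      by simp
  qed measurable
qed

lemma Lp_space_diff:
  assumes f: "f \<in> Lp_space p" and g: "g \<in> Lp_space p" and p: "0 < p"
  shows "(\<lambda>x. f x - g x) \<in> Lp_space p"
  using Lp_space_add[OF f Lp_space_uminus[OF g] p] by simp

lemma Lp_norm_cmult: assumes "0 < p" shows "Lp_norm p (\<lambda>x. c * f x) = norm c * Lp_norm p f"
  using assms by (simp add: Lp_norm_def norm_mult powr_mult powr_powr integral_nonneg)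

lemma Lp_norm_uminus: "Lp_norm p (\<lambda>x. - f x) = Lp_norm p f"
  by (simp add: Lp_norm_def)

lemma Lp_dist_commute: "Lp_dist p f g = Lp_dist p g f"
  by (simp add: Lp_norm_def norm_minus_commute)

lemma Lp_norm_eq_0:
  assumes f: "f \<in> Lp_space p" and p: "0 < p"
  shows "Lp_norm p f = 0 \<longleftrightarrow> (AE x in lebesgue. f x = 0)"
proof -
  have "Lp_norm p f = 0 \<longleftrightarrow> (LINT x|lebesgue. norm (f x) powr p) = 0"
    using p by (simp add: Lp_norm_def)
  also have "\<dots> \<longleftrightarrow> (AE x in lebesgue. norm (f x) powr p = 0)"
    by (rule integral_nonneg_eq_0_iff_AE) (use integrable_Lp[OF f] in auto)
  finally show ?thesis using p by simp
qed

lemma powr_convex_comb: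
  fixes x y l p :: real
  assumes "0 \<le> x" "0 \<le> y" "0 \<le> l" "l \<le> 1" "1 \<le> p"
  shows "(l * x + (1 - l) * y) powr p \<le> l * x powr p + (1 - l) * y powr p"
proof -
  have aux: "m powr p \<le> m" if "0 \<le> m" "m \<le> 1" for m :: real
    using that assms powr_mono'[of 1 p m] by (cases "m = 0") auto
  consider "x = 0" | "y = 0" | "x > 0" "y > 0" using assms by linarith
  then show ?thesis
  proof cases
    case 1
    then show ?thesis using aux[of "1 - l"] assms by (simp add: powr_mult mult_right_mono)
  next
    case 2
    then show ?thesis using aux[of l] assms by (simp add: powr_mult mult_right_mono)
  next
    case 3
    then show ?thesis
      using convex_onD[OF powr_convex[OF assms(5)], of "1 - l" x y] assms by simp
  qed
qed

text \<open>
  Convexity of \<open>t \<mapsto> t\<^sup>p\<close>, applied to the convex combination of \<open>\<bar>f\<bar> / A\<close> and \<open>\<bar>g\<bar> / B\<close> with weights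
  \<open>A / (A + B)\<close> and \<open>B / (A + B)\<close>, where \<open>A\<close> and \<open>B\<close> are the two norms.
\<close>

lemma Minkowski_Lp_norm:
  assumes f: "f \<in> Lp_space p" and g: "g \<in> Lp_space p" and p: "1 \<le> p"
  shows "Lp_norm p (\<lambda>x. f x + g x) \<le> Lp_norm p f + Lp_norm p g"
proof -
  note [measurable] = measurable_Lp[OF f] measurable_Lp[OF g]
  have p0: "0 < p" using p by simp
  define A B where "A = Lp_norm p f" and "B = Lp_norm p g"
  have nn: "A \<ge> 0" "B \<ge> 0" by (auto simp: A_def B_def)
  consider "A = 0" | "B = 0" | "A > 0" "B > 0" using nn by linarith
  then show ?thesis
  proof cases
    case 1
    then have "AE x in lebesgue. f x = 0" using Lp_norm_eq_0[OF f p0] A_def by simp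
    then have "Lp_norm p (\<lambda>x. f x + g x) = Lp_norm p g" by (intro Lp_norm_cong_AE) (auto elim!: eventually_mono)
    then show ?thesis using nn A_def by simp
  next
    case 2
    then have "AE x in lebesgue. g x = 0" using Lp_norm_eq_0[OF g p0] B_def by simp
    then have "Lp_norm p (\<lambda>x. f x + g x) = Lp_norm p f" by (intro Lp_norm_cong_AE) (auto elim!: eventually_mono)
    then show ?thesis using nn B_def by simp
  next
    case 3
    define l where "l = A / (A + B)"
    have l: "0 \<le> l" "l \<le> 1" "1 - l = B / (A + B)" using 3 by (auto simp: l_def field_simps)
    let ?h = "\<lambda>x. (A + B) powr p * (l * (norm (f x) powr p / A powr p) + (1 - l) * (norm (g x) powr p / B powr p))"
    have pt: "norm (f x + g x) powr p \<le> ?h x" for x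
    proof -
      have eq: "(A + B) * (l * (norm (f x) / A) + (1 - l) * (norm (g x) / B)) = norm (f x) + norm (g x)"
        proof -
        have "(A + B) * (l * (norm (f x) / A)) = norm (f x)" using 3 by (simp add: l_def)
        moreover have "(A + B) * ((1 - l) * (norm (g x) / B)) = norm (g x)" using 3 by (simp add: l)
        ultimately show ?thesis by (simp add: distrib_left)
      qed
      have "norm (f x + g x) powr p \<le> (norm (f x) + norm (g x)) powr p"
        using p by (intro powr_mono2 norm_triangle_ineq) auto
      also have "\<dots> = (A + B) powr p * (l * (norm (f x) / A) + (1 - l) * (norm (g x) / B)) powr p"
        unfolding eq[symmetric] using 3 l by (subst powr_mult) auto
      also have "\<dots> \<le> (A + B) powr p * (l * (norm (f x) / A) powr p + (1 - l) * (norm (g x) / B) powr p)"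
        using 3 l p by (intro mult_left_mono powr_convex_comb) auto
      also have "\<dots> = ?h x" using 3 by (simp add: powr_divide)
      finally show ?thesis .
    qed
    have "(LINT x|lebesgue. norm (f x + g x) powr p) \<le> (LINT x|lebesgue. ?h x)"
      by (rule integral_mono)
         (use integrable_Lp[OF f] integrable_Lp[OF g] integrable_Lp[OF Lp_space_add[OF f g p0]] pt in auto)
    also have "\<dots> = (A + B) powr p * (l * ((LINT x|lebesgue. norm (f x) powr p) / A powr p) + (1 - l) * ((LINT x|lebesgue. norm (g x) powr p) / B powr p))"
      using integrable_Lp[OF f] integrable_Lp[OF g] by simp
    also have "\<dots> = (A + B) powr p"
      using 3 by (simp add: Lp_norm_powr[OF p0, symmetric] A_def[symmetric] B_def[symmetric])
    finally show ?thesis using Lp_norm_le_iff[OF p0, of "A + B" "\<lambda>x. f x + g x"] nn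
      by (simp add: A_def B_def)
  qed
qed

lemma Lp_norm_triangle_diff:
  assumes "f \<in> Lp_space p" "g \<in> Lp_space p" "h \<in> Lp_space p" "1 \<le> p"
  shows "Lp_dist p f h \<le> Lp_dist p f g + Lp_dist p g h"
  using Minkowski_Lp_norm[OF Lp_space_diff Lp_space_diff, of f p g g h] assms by simp

lemma Lp_norm_diff_le:
  assumes "f \<in> Lp_space p" "g \<in> Lp_space p" "1 \<le> p"
  shows "Lp_dist p f g \<le> Lp_norm p f + Lp_norm p g"
  using Minkowski_Lp_norm[OF assms(1) Lp_space_uminus[OF assms(2)]] assms by (simp add: Lp_norm_uminus)

lemma Lp_norm_le_add_diff:
  assumes "f \<in> Lp_space p" "g \<in> Lp_space p" "1 \<le> p"
  shows "Lp_norm p f \<le> Lp_norm p g + Lp_dist p f g"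
  using Minkowski_Lp_norm[OF assms(2) Lp_space_diff[OF assms(1,2)]] assms by simp

lemma Lp_tendsto_AE_subseq:
  assumes f: "\<And>n. f n \<in> Lp_space p" and g: "g \<in> Lp_space p" and p: "0 < p"
    and lim: "Lp_tendsto p f g"
  obtains r :: "nat \<Rightarrow> nat" where "strict_mono r" "AE x in lebesgue. (\<lambda>n. f (r n) x) \<longlonglongrightarrow> g x"
proof -
  let ?u = "\<lambda>n x. norm (f n x - g x) powr p"
  have "(\<lambda>n. Lp_dist p (f n) g powr p) \<longlonglongrightarrow> 0 powr p"
    using p lim by (intro tendsto_powr') auto
  then have "(\<lambda>n. LINT x|lebesgue. norm (?u n x)) \<longlonglongrightarrow> 0"
    using p by (simp add: Lp_norm_powr)
  moreover have "integrable lebesgue (?u n)" for n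
    using integrable_Lp[OF Lp_space_diff[OF f g p]] by simp
  ultimately obtain r :: "nat \<Rightarrow> nat" where r: "strict_mono r" "AE x in lebesgue. (\<lambda>n. ?u (r n) x) \<longlonglongrightarrow> 0"
    using tendsto_L1_AE_subseq[of lebesgue ?u] by blast
  have "AE x in lebesgue. (\<lambda>n. f (r n) x) \<longlonglongrightarrow> g x"
    using r(2)
  proof eventually_elim
    case (elim x)
    have "(\<lambda>n. ?u (r n) x powr (1 / p)) \<longlonglongrightarrow> 0 powr (1 / p)"
      using p elim by (intro tendsto_powr') auto
    then have "(\<lambda>n. norm (f (r n) x - g x)) \<longlonglongrightarrow> 0" using p by (simp add: powr_powr)
    then show ?case by (simp add: tendsto_norm_zero_iff LIM_zero_iff)
  qed
  then show ?thesis using r that by blast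
qed

lemma Lp_Fatou:
  assumes f: "\<And>n. f n \<in> Lp_space p" and g: "g \<in> borel_measurable lebesgue" and p: "0 < p"
    and lim: "AE x in lebesgue. (\<lambda>n. f n x) \<longlonglongrightarrow> g x" and bd: "\<And>n. Lp_norm p (f n) \<le> c"
  shows "g \<in> Lp_space p" and "Lp_norm p g \<le> c"
proof -
  have c: "0 \<le> c" using bd[of 0] Lp_norm_nonneg[of p "f 0"] by linarith
  have l: "AE x in lebesgue. (\<lambda>n. norm (f n x) powr p) \<longlonglongrightarrow> norm (g x) powr p"
    using lim by eventually_elim (intro tendsto_powr' tendsto_norm tendsto_const; use p in auto)
  note * = integral_Fatou[OF integrable_Lp[OF f] _ _ l, of "c powr p"]
  have b: "(LINT x|lebesgue. norm (f n x) powr p) \<le> c powr p" for n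
    using bd[of n] Lp_norm_le_iff[OF p c, of "f n"] by blast
  show "g \<in> Lp_space p" using *(1) b g by (intro Lp_spaceI) auto
  show "Lp_norm p g \<le> c" using *(2) b g Lp_norm_le_iff[OF p c, of g] by auto
qed

text \<open>
  Along a subsequence the increments \<open>d k\<close> have norm at most \<open>4\<^sup>-\<^sup>k\<close>.  Then the \<open>p\<close>-th powers of \<open>2\<^sup>k d k\<close>
  have a finite sum almost everywhere, which forces geometric decay of \<open>d k\<close> and so pointwise convergence;
  Fatou's lemma identifies the pointwise limit as the limit in \<open>L\<^sub>p\<close>.
\<close>

lemma Lp_complete:
  assumes f: "\<And>n. f n \<in> Lp_space p" and p: "1 \<le> p"
    and cauchy: "\<And>e. e > 0 \<Longrightarrow> \<exists>N. \<forall>m\<ge>N. \<forall>n\<ge>N. Lp_dist p (f m) (f n) < e"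
  obtains g where "g \<in> Lp_space p" "Lp_tendsto p f g"
proof -
  have p0: "0 < p" using p by simp
  note [measurable] = measurable_Lp[OF f]
  have "\<exists>r. \<forall>k. (\<forall>i\<ge>r k. \<forall>j\<ge>r k. Lp_dist p (f i) (f j) < (1/4)^k) \<and> r (Suc k) > r k"
  proof (intro dependent_nat_choice, goal_cases)
    case 1
    show ?case using cauchy[of "(1/4)^0"] by simp
  next
    case (2 x k)
    obtain N where "\<forall>i\<ge>N. \<forall>j\<ge>N. Lp_dist p (f i) (f j) < (1/4) ^ Suc k"
      using cauchy[of "(1/4)^Suc k"] by auto
    then show ?case by (intro exI[of _ "max N (Suc x)"]) auto
  qed
  then obtain r where r: "\<And>k i j. i \<ge> r k \<Longrightarrow> j \<ge> r k \<Longrightarrow> Lp_dist p (f i) (f j) < (1/4)^k"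
    and rS: "\<And>k. r (Suc k) > r k" by blast
  define d where "d k x = norm (f (r (Suc k)) x - f (r k) x)" for k x
  have [measurable]: "d k \<in> borel_measurable lebesgue" for k unfolding d_def by measurable
  \<comment> \<open>The weights \<open>2^k\<close> turn an almost everywhere bounded sum of \<open>p\<close>-th powers into geometric decay of the increments.\<close>
  have int: "integrable lebesgue (\<lambda>x. (2^k * d k x) powr p)" for k
    using integrable_Lp[OF Lp_space_diff[OF f f p0]] by (simp add: d_def powr_mult)
  have le: "(LINT x|lebesgue. (2^k * d k x) powr p) \<le> (1/2)^k" for k
  proof -
    have "(LINT x|lebesgue. (2^k * d k x) powr p) = (2^k * Lp_dist p (f (r (Suc k))) (f (r k))) powr p"
      using p0 by (simp add: powr_mult d_def Lp_norm_powr)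
    also have "\<dots> \<le> (2^k * (1/4)^k) powr p"
      using r[of k "r (Suc k)" "r k"] rS[of k] p0 by (intro powr_mono2 mult_left_mono) auto
    also have "\<dots> \<le> (2^k * (1/4)^k) powr 1" using p
      by (intro powr_mono') (auto simp: power_mult_distrib[symmetric] power_le_one)
    also have "\<dots> = (1/2)^k" by (simp add: power_mult_distrib[symmetric])
    finally show ?thesis .
  qed
  have "(\<integral>\<^sup>+x. (\<Sum>k. ennreal ((2^k * d k x) powr p)) \<partial>lebesgue) = (\<Sum>k. \<integral>\<^sup>+x. ennreal ((2^k * d k x) powr p) \<partial>lebesgue)"
    by (rule nn_integral_suminf) measurable
  also have "\<dots> = (\<Sum>k. ennreal (LINT x|lebesgue. (2^k * d k x) powr p))"
    by (simp add: nn_integral_eq_integral[OF int])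
  also have "\<dots> \<le> (\<Sum>k. ennreal ((1/2)^k))" by (intro suminf_le ennreal_leI le) auto
  also have "\<dots> < \<infinity>" by (subst suminf_ennreal2) auto
  finally have "AE x in lebesgue. (\<Sum>k. ennreal ((2^k * d k x) powr p)) \<noteq> \<infinity>"
    by (intro nn_integral_PInf_AE) auto
  then have conv: "AE x in lebesgue. convergent (\<lambda>k. f (r k) x)"
  proof eventually_elim
    case (elim x)
    have "summable (\<lambda>k. (2^k * d k x) powr p)"
      using elim by (intro summable_suminf_not_top) auto
    then have "(\<lambda>k. (2^k * d k x) powr p) \<longlonglongrightarrow> 0" by (rule summable_LIMSEQ_zero)
    then have "eventually (\<lambda>k. (2^k * d k x) powr p < 1) sequentially"
      by (rule order_tendstoD) simp
    then have ev: "eventually (\<lambda>k. norm (d k x) \<le> (1/2)^k) sequentially"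
    proof eventually_elim
      case (elim k)
      then have "2^k * d k x < 1"
        using p0 by (metis ge_one_powr_ge_zero less_eq_real_def linorder_not_less)
      then show ?case by (simp add: d_def field_simps)
    qed
    have "summable (\<lambda>k. d k x)"
      by (rule summable_comparison_test_ev[OF ev]) (simp add: summable_geometric)
    then have "summable (\<lambda>k. f (r (Suc k)) x - f (r k) x)"
      unfolding d_def by (rule summable_norm_cancel)
    then have "convergent (\<lambda>n. \<Sum>k<n. f (r (Suc k)) x - f (r k) x)" by (simp add: summable_iff_convergent)
    then have "convergent (\<lambda>n. f (r n) x - f (r 0) x)"
      using sum_lessThan_telescope[of "\<lambda>k. f (r k) x"] by simp
    then have "convergent (\<lambda>n. (f (r n) x - f (r 0) x) + f (r 0) x)"
      by (rule convergent_add) (rule convergent_const)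
    then show ?case by simp
  qed
  define g where "g x = lim (\<lambda>k. f (r k) x)" for x
  have [measurable]: "g \<in> borel_measurable lebesgue" unfolding g_def by measurable
  have lim: "AE x in lebesgue. (\<lambda>k. f (r k) x) \<longlonglongrightarrow> g x"
    using conv by eventually_elim (simp add: g_def convergent_LIMSEQ_iff)
  have le_r: "k \<le> r k" for k by (induction k) (use rS in \<open>auto simp: Suc_le_eq le_less_trans\<close>)
  have bd: "(\<lambda>x. f n x - g x) \<in> Lp_space p \<and> Lp_dist p (f n) g \<le> e"
    if N: "\<And>m. m \<ge> N \<Longrightarrow> Lp_dist p (f n) (f m) < e" for n N e
  proof -
    have "AE x in lebesgue. (\<lambda>k. f n x - f (r (k + N)) x) \<longlonglongrightarrow> f n x - g x"
      using lim by eventually_elim (intro tendsto_diff tendsto_const LIMSEQ_ignore_initial_segment)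
    moreover have "Lp_dist p (f n) (f (r (k + N))) \<le> e" for k
      using N[of "r (k + N)"] le_r[of "k + N"] by simp
    ultimately show ?thesis
      using Lp_Fatou[of "\<lambda>k x. f n x - f (r (k + N)) x" p "\<lambda>x. f n x - g x" e]
        Lp_space_diff[OF f f p0] p0 by auto
  qed
  obtain N0 where "\<And>m n. m \<ge> N0 \<Longrightarrow> n \<ge> N0 \<Longrightarrow> Lp_dist p (f m) (f n) < 1"
    using cauchy[of 1] by auto
  then have "(\<lambda>x. f N0 x - g x) \<in> Lp_space p" using bd[of N0 N0 1] by auto
  then have "(\<lambda>x. f N0 x - (f N0 x - g x)) \<in> Lp_space p" by (rule Lp_space_diff[OF f _ p0])
  then have g: "g \<in> Lp_space p" by simp
  have "Lp_tendsto p f g"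
  proof (rule LIMSEQ_I)
    fix e :: real assume e: "e > 0"
    obtain N where N: "\<And>m n. m \<ge> N \<Longrightarrow> n \<ge> N \<Longrightarrow> Lp_dist p (f m) (f n) < e / 2"
      using cauchy[of "e / 2"] e by auto
    have "Lp_dist p (f n) g < e" if "n \<ge> N" for n
      using bd[of N n "e / 2"] N that e by fastforce
    then show "\<exists>N. \<forall>n\<ge>N. norm (Lp_dist p (f n) g - 0) < e"
      by (intro exI[of _ N]) auto
  qed
  then show ?thesis using g that by blast
qed

lemma not_tendsto_zero_subseq:
  fixes X :: "nat \<Rightarrow> real"
  assumes "\<not> X \<longlonglongrightarrow> 0"
  obtains e and r :: "nat \<Rightarrow> nat" where "0 < e" "strict_mono r" "\<And>n. e \<le> \<bar>X (r n)\<bar>"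
proof -
  obtain e where e: "e > 0" "\<And>N. \<exists>n\<ge>N. e \<le> \<bar>X n\<bar>"
    using assms by (force simp: LIMSEQ_def not_less)
  then have "infinite {n. e \<le> \<bar>X n\<bar>}"
    by (auto simp: infinite_nat_iff_unbounded_le)
  then show ?thesis using infinite_enumerate that e(1) by blast
qed

lemma tendsto_zero_subseqI:
  fixes X :: "nat \<Rightarrow> real"
  assumes "\<And>r::nat \<Rightarrow> nat. strict_mono r \<Longrightarrow> \<exists>s::nat \<Rightarrow> nat. strict_mono s \<and> (\<lambda>n. X (r (s n))) \<longlonglongrightarrow> 0"
  shows "X \<longlonglongrightarrow> 0"
proof (rule ccontr)
  assume "\<not> X \<longlonglongrightarrow> 0"
  then obtain e and r :: "nat \<Rightarrow> nat" where e: "0 < e" and r: "strict_mono r" "\<And>n. e \<le> \<bar>X (r n)\<bar>"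
    by (rule not_tendsto_zero_subseq) blast
  obtain s :: "nat \<Rightarrow> nat" where "(\<lambda>n. X (r (s n))) \<longlonglongrightarrow> 0" using assms[OF r(1)] by blast
  then obtain n where "\<bar>X (r (s n))\<bar> < e" using e by (force simp: LIMSEQ_def)
  then show False using r(2)[of "s n"] by simp
qed

text \<open>
  Fatou's lemma applied to \<open>2\<^sup>p (\<bar>f n\<bar>\<^sup>p + \<bar>g\<bar>\<^sup>p) - \<bar>f n - g\<bar>\<^sup>p \<ge> 0\<close>, whose limit is
  \<open>2\<^sup>p\<^sup>+\<^sup>1 \<bar>g\<bar>\<^sup>p\<close>: if the integrals of \<open>\<bar>f n - g\<bar>\<^sup>p\<close> stayed above some \<open>e > 0\<close>, the limit would lose \<open>e\<close>.
\<close>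

lemma Lp_tendsto_of_AE:
  assumes f: "\<And>n. f n \<in> Lp_space p" and g: "g \<in> Lp_space p" and p: "0 < p"
    and lim: "AE x in lebesgue. (\<lambda>n. f n x) \<longlonglongrightarrow> g x" and bd: "\<And>n. Lp_norm p (f n) \<le> Lp_norm p g"
  shows "Lp_tendsto p f g"
proof -
  let ?I = "\<lambda>h. LINT x|lebesgue. norm (h x) powr p"
  let ?X = "\<lambda>n. ?I (\<lambda>x. f n x - g x)"
  have X0: "0 \<le> ?X n" for n by (rule Bochner_Integration.integral_nonneg) simp
  have "?X \<longlonglongrightarrow> 0"
  proof (rule ccontr)
    assume "\<not> ?X \<longlonglongrightarrow> 0"
    then obtain e and r :: "nat \<Rightarrow> nat" where e: "0 < e" and r: "strict_mono r" "\<And>n. e \<le> \<bar>?X (r n)\<bar>"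
      by (rule not_tendsto_zero_subseq) blast
    have re: "e \<le> ?X (r n)" for n using X0[of "r n"] r(2)[of n] by linarith
    let ?h = "\<lambda>n x. 2 powr p * (norm (f (r n) x) powr p + norm (g x) powr p) - norm (f (r n) x - g x) powr p"
    \<comment> \<open>The last term is 0; in this form the limit of \<open>?h\<close> follows termwise.\<close>
    let ?k = "\<lambda>x. 2 powr p * (norm (g x) powr p + norm (g x) powr p) - norm (g x - g x) powr p"
    note int = integrable_Lp[OF f] integrable_Lp[OF g] integrable_Lp[OF Lp_space_diff[OF f g p]]
    have i: "integrable lebesgue (?h n)" for n
      using int by simp
    have nn: "0 \<le> ?h n x" for n x
    proof -
      have "norm (f (r n) x - g x) powr p \<le> (norm (f (r n) x) + norm (g x)) powr p"
        using p by (intro powr_mono2 norm_triangle_ineq4) auto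
      also have "\<dots> \<le> 2 powr p * (norm (f (r n) x) powr p + norm (g x) powr p)"
        using p by (intro powr_add_le) auto
      finally show ?thesis by simp
    qed
    have l: "AE x in lebesgue. (\<lambda>n. ?h n x) \<longlonglongrightarrow> ?k x"
      using lim
    proof eventually_elim
      case (elim x)
      then have "(\<lambda>n. f (r n) x) \<longlonglongrightarrow> g x" using r(1) LIMSEQ_subseq_LIMSEQ by (force simp: o_def)
      then show ?case using p by (intro tendsto_intros tendsto_powr') auto
    qed
    have bd': "?I (f n) \<le> ?I g" for n
      using bd[of n] Lp_norm_powr[OF p, of "f n"] Lp_norm_powr[OF p, of g] p
      by (metis Lp_norm_nonneg less_imp_le powr_mono2)
    have b: "integral\<^sup>L lebesgue (?h n) \<le> 2 powr p * (?I g + ?I g) - e" for n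
    proof -
      have "integral\<^sup>L lebesgue (?h n) = 2 powr p * (?I (f (r n)) + ?I g) - ?X (r n)"
        using int by simp
      also have "\<dots> \<le> 2 powr p * (?I g + ?I g) - e"
        using bd'[of "r n"] re[of n] by (intro diff_mono mult_left_mono add_mono) auto
      finally show ?thesis .
    qed
    have "integral\<^sup>L lebesgue ?k \<le> 2 powr p * (?I g + ?I g) - e"
      using g by (intro integral_Fatou(2)[OF i nn _ l b]) (auto dest: measurable_Lp)
    moreover have "integral\<^sup>L lebesgue ?k = 2 powr p * (?I g + ?I g)"
      using int p by simp
    ultimately show False using e by simp
  qed
  then have "(\<lambda>n. ?X n powr (1 / p)) \<longlonglongrightarrow> 0 powr (1 / p)"
    using p by (intro tendsto_powr') (auto intro!: Bochner_Integration.integral_nonneg)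
  then show ?thesis by (simp add: Lp_norm_def)
qed

text \<open>
  Cutting off small values too makes the truncation belong to every \<open>L\<^sub>q\<close> at once.
\<close>

definition truncation :: "nat \<Rightarrow> (real^'n \<Rightarrow> complex) \<Rightarrow> real^'n \<Rightarrow> complex" where
  "truncation n f x = (if 1 / Suc n \<le> norm (f x) \<and> norm (f x) \<le> Suc n then f x else 0)"

lemma truncation_in_Lp_space:
  assumes f: "f \<in> Lp_space p" and p: "0 < p" and q: "0 < q"
  shows "truncation n f \<in> Lp_space q"
proof (rule Lp_spaceI)
  note [measurable] = measurable_Lp[OF f]
  show m: "truncation n f \<in> borel_measurable lebesgue"
    unfolding truncation_def[abs_def] by measurable
  define K where "K = real (Suc n) powr q * real (Suc n) powr p"
  have K: "norm (truncation n f x) powr q \<le> K * norm (f x) powr p" for x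
  proof (cases "1 / Suc n \<le> norm (f x) \<and> norm (f x) \<le> Suc n")
    case True
    then have "norm (f x) powr q \<le> real (Suc n) powr q * 1" using q by (simp add: powr_mono2)
    also have "1 powr p \<le> (real (Suc n) * norm (f x)) powr p"
      using True p by (intro powr_mono2) (auto simp: field_simps)
    then have "real (Suc n) powr q * 1 \<le> real (Suc n) powr q * (real (Suc n) powr p * norm (f x) powr p)"
      by (intro mult_left_mono) (auto simp: powr_mult)
    finally show ?thesis using True by (simp add: truncation_def K_def mult.assoc)
  qed (auto simp: truncation_def K_def)
  show "integrable lebesgue (\<lambda>x. norm (truncation n f x) powr q)"
  proof (rule Bochner_Integration.integrable_bound)
    show "integrable lebesgue (\<lambda>x. K * norm (f x) powr p)" using integrable_Lp[OF f] by simp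
    show "AE x in lebesgue. norm (norm (truncation n f x) powr q) \<le> norm (K * norm (f x) powr p)"
      by (rule AE_I2) (simp, metis K abs_ge_self order_trans)
  qed (use m in measurable)
qed

lemma truncation_tendsto:
  assumes f: "f \<in> Lp_space p" and p: "0 < p"
  shows "Lp_tendsto p (\<lambda>n. truncation n f) f"
proof (rule Lp_tendsto_of_AE[OF truncation_in_Lp_space[OF f p p] f p])
  show "Lp_norm p (truncation n f) \<le> Lp_norm p f" for n
    by (rule Lp_norm_mono[OF f p measurable_Lp[OF truncation_in_Lp_space[OF f p p]]])
       (auto simp: truncation_def)
  have "eventually (\<lambda>n. truncation n f x = f x) sequentially" for x
  proof (cases "f x = 0")
    case False
    obtain N1 where N1: "norm (f x) \<le> real N1" using real_arch_simple by blast
    obtain N2 where N2: "inverse (real (Suc N2)) < norm (f x)" using False reals_Archimedean[of "norm (f x)"] by auto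
    show ?thesis unfolding eventually_sequentially
    proof (intro exI[of _ "max N1 N2"] allI impI)
      fix n assume n: "max N1 N2 \<le> n"
      have "1 / real (Suc n) \<le> inverse (real (Suc N2))" using n by (auto simp: field_simps)
      moreover have "real N1 \<le> real (Suc n)" using n by auto
      ultimately show "truncation n f x = f x" using N1 N2 by (auto simp: truncation_def)
    qed
  qed (auto simp: truncation_def)
  then show "AE x in lebesgue. (\<lambda>n. truncation n f x) \<longlonglongrightarrow> f x"
    by (auto intro: tendsto_eventually)
qed

lemma Lp2_power2: "Lp_norm 2 f ^ 2 = (LINT x|lebesgue. (norm (f x))\<^sup>2)"
  using Lp_norm_powr[of 2 f] by simp

lemma L2_spaceI: "f \<in> borel_measurable lebesgue \<Longrightarrow> integrable lebesgue (\<lambda>x. (norm (f x))\<^sup>2) \<Longrightarrow> f \<in> Lp_space 2"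
  by (auto simp: Lp_space_def)

lemma integrable_L2: "f \<in> Lp_space 2 \<Longrightarrow> integrable lebesgue (\<lambda>x. (norm (f x))\<^sup>2)"
  by (auto simp: Lp_space_def)

lemma L2_Cauchy_Schwarz:
  assumes f: "f \<in> Lp_space 2" and g: "g \<in> Lp_space 2"
  shows "integrable lebesgue (\<lambda>x. norm (f x) * norm (g x))"
    and "(LINT x|lebesgue. norm (f x) * norm (g x)) \<le> Lp_norm 2 f * Lp_norm 2 g"
proof -
  note [measurable] = measurable_Lp[OF f] measurable_Lp[OF g]
  have yng: "2 * (a * b) \<le> s * a\<^sup>2 + b\<^sup>2 / s" if "s > 0" for a b s :: real
  proof -
    have "0 \<le> (s * a - b)\<^sup>2 / s" using that by simp
    also have "\<dots> = s * a\<^sup>2 + b\<^sup>2 / s - 2 * (a * b)"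
      using that by (simp add: power2_diff field_simps power2_eq_square)
    finally show ?thesis by simp
  qed
  note int = integrable_L2[OF f] integrable_L2[OF g]
  show i: "integrable lebesgue (\<lambda>x. norm (f x) * norm (g x))"
  proof (rule Bochner_Integration.integrable_bound)
    show "integrable lebesgue (\<lambda>x. (norm (f x))\<^sup>2 + (norm (g x))\<^sup>2)" using int by simp
    show "AE x in lebesgue. norm (norm (f x) * norm (g x)) \<le> norm ((norm (f x))\<^sup>2 + (norm (g x))\<^sup>2)"
    proof (rule AE_I2)
      fix x
      have "0 \<le> norm (f x) * norm (g x)" by simp
      then show "norm (norm (f x) * norm (g x)) \<le> norm ((norm (f x))\<^sup>2 + (norm (g x))\<^sup>2)"
        using yng[of 1 "norm (f x)" "norm (g x)"] by (simp del: mult_nonneg_nonneg)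
    qed
  qed measurable
  have "2 * (LINT x|lebesgue. norm (f x) * norm (g x)) \<le> 2 * sqrt ((Lp_norm 2 f)\<^sup>2 * (Lp_norm 2 g)\<^sup>2)"
  proof (rule young_optimize)
    fix s :: real assume s: "s > 0"
    have "(LINT x|lebesgue. 2 * (norm (f x) * norm (g x))) \<le> (LINT x|lebesgue. s * (norm (f x))\<^sup>2 + (norm (g x))\<^sup>2 / s)"
      by (rule integral_mono) (use i int yng[OF s] in auto)
    also have "\<dots> = s * (Lp_norm 2 f)\<^sup>2 + (Lp_norm 2 g)\<^sup>2 / s"
      using int by (simp add: Lp2_power2)
    finally show "2 * (LINT x|lebesgue. norm (f x) * norm (g x)) \<le> s * (Lp_norm 2 f)\<^sup>2 + (Lp_norm 2 g)\<^sup>2 / s" by simp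
  qed auto
  then show "(LINT x|lebesgue. norm (f x) * norm (g x)) \<le> Lp_norm 2 f * Lp_norm 2 g"
    by (simp add: real_sqrt_mult)
qed

lemma L2_inner_integrable:
  assumes f: "f \<in> Lp_space 2" and g: "g \<in> Lp_space 2"
  shows "integrable lebesgue (\<lambda>x. f x * cnj (g x))"
proof -
  note [measurable] = measurable_Lp[OF f] measurable_Lp[OF g]
  show ?thesis
    by (rule Bochner_Integration.integrable_bound[OF L2_Cauchy_Schwarz(1)[OF f g]]) (auto simp: norm_mult)
qed

lemma L2_inner_bound:
  assumes f: "f \<in> Lp_space 2" and g: "g \<in> Lp_space 2"
  shows "norm (L2_inner f g) \<le> Lp_norm 2 f * Lp_norm 2 g"
proof -
  have "norm (L2_inner f g) \<le> (LINT x|lebesgue. norm (f x * cnj (g x)))"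
    unfolding L2_inner_def by (rule integral_norm_bound)
  also have "\<dots> = (LINT x|lebesgue. norm (f x) * norm (g x))" by (simp add: norm_mult)
  finally show ?thesis using L2_Cauchy_Schwarz(2)[OF f g] by simp
qed

lemma L2_inner_diff_right:
  assumes "f \<in> Lp_space 2" "g \<in> Lp_space 2" "h \<in> Lp_space 2"
  shows "L2_inner f (\<lambda>x. g x - h x) = L2_inner f g - L2_inner f h"
  using L2_inner_integrable[OF assms(1,2)] L2_inner_integrable[OF assms(1,3)]
  by (simp add: L2_inner_def right_diff_distrib)

lemma L2_inner_tendsto_right:
  assumes f: "f \<in> Lp_space 2" and g: "\<And>n. g n \<in> Lp_space 2" and h: "h \<in> Lp_space 2"
    and lim: "Lp_tendsto 2 g h"
  shows "(\<lambda>n. L2_inner f (g n)) \<longlonglongrightarrow> L2_inner f h"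
proof -
  have "(\<lambda>n. Lp_norm 2 f * Lp_dist 2 (g n) h) \<longlonglongrightarrow> 0"
    using tendsto_mult_right_zero[OF lim] by simp
  moreover have "norm (L2_inner f (g n) - L2_inner f h) \<le> Lp_norm 2 f * Lp_dist 2 (g n) h" for n
    using L2_inner_bound[OF f Lp_space_diff[OF g h]] by (simp add: L2_inner_diff_right[OF f g h])
  ultimately show ?thesis by (rule tendsto_norm_le)
qed

section \<open>Smooth functions and density of test functions\<close>

definition smooth :: "(real^'n \<Rightarrow> complex) \<Rightarrow> bool" where
  "smooth f \<longleftrightarrow> (\<forall>ks. iter_partial_deriv ks f differentiable_on UNIV)"

lemma test_functions_iff: "\<phi> \<in> test_functions \<longleftrightarrow> smooth \<phi> \<and> bounded {x. \<phi> x \<noteq> 0}"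
  by (simp add: test_functions_def smooth_def)

lemma iter_partial_deriv_append: "iter_partial_deriv (ks @ [k]) f = iter_partial_deriv ks (partial_deriv k f)"
  by (simp add: iter_partial_deriv_def)

lemma smooth_partial_deriv: "smooth f \<Longrightarrow> smooth (partial_deriv k f)"
  unfolding smooth_def by (metis iter_partial_deriv_append)

lemma smooth_differentiable: "smooth f \<Longrightarrow> f differentiable at x"
  unfolding smooth_def by (drule spec[of _ "[]"]) (simp add: iter_partial_deriv_def differentiable_on_def)

text \<open>
  Smoothness of a composite function is proved by exhibiting a class of differentiable functions that is closed
  under partial derivatives; formulas for higher derivatives are then never needed.
\<close>

lemma smooth_coinduct:
  assumes f: "P f" and P: "\<And>g. P g \<Longrightarrow> (\<forall>x. g differentiable at x) \<and> (\<forall>k. P (partial_deriv k g))"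
  shows "smooth f"
proof -
  have "P g \<Longrightarrow> iter_partial_deriv ks g differentiable_on UNIV" for ks g
  proof (induction ks arbitrary: g rule: rev_induct)
    case Nil
    then show ?case using P[of g] by (auto simp: iter_partial_deriv_def differentiable_on_def)
  next
    case (snoc k ks)
    then show ?case using P[of g] by (simp add: iter_partial_deriv_append)
  qed
  then show ?thesis using f by (simp add: smooth_def)
qed

lemma partial_deriv_eq: "(f has_derivative f') (at x) \<Longrightarrow> partial_deriv k f x = f' (axis k 1)"
  using frechet_derivative_at[of f f' x] by (simp add: partial_deriv_def)

lemma has_derivative_frechet: "f differentiable at x \<Longrightarrow> (f has_derivative frechet_derivative f (at x)) (at x)"
  by (simp add: frechet_derivative_works)

text \<open>
  The derivatives of the flat function \<open>exp (- 1 / t)\<close> are combinations of these functions, so that the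
  family as a whole is closed under differentiation.
\<close>

definition bump_germ :: "nat \<Rightarrow> real \<Rightarrow> real" where
  "bump_germ j t = (if t \<le> 0 then 0 else exp (- 1 / t) / t ^ j)"

lemma bump_germ_at_0: "(bump_germ j \<longlongrightarrow> 0) (at_right 0)"
proof -
  have "((\<lambda>s::real. s ^ j / exp s) \<longlongrightarrow> 0) at_top" by (rule tendsto_power_div_exp_0)
  then have "((\<lambda>t::real. inverse t ^ j / exp (inverse t)) \<longlongrightarrow> 0) (at_right 0)"
    by (rule filterlim_compose[OF _ filterlim_inverse_at_top_right])
  then show ?thesis
  proof (rule Lim_transform_eventually)
    have "eventually (\<lambda>t::real. t > 0) (at_right 0)" by (simp add: eventually_at_right_less)
    then show "eventually (\<lambda>t. inverse t ^ j / exp (inverse t) = bump_germ j t) (at_right 0)"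
      by eventually_elim (simp add: bump_germ_def exp_minus field_simps)
  qed
qed

lemma bump_germ_has_derivative:
  "(bump_germ j has_real_derivative (bump_germ (j + 2) t - real j * bump_germ (j + 1) t)) (at t)"
proof -
  consider "t > 0" | "t < 0" | "t = 0" by linarith
  then show ?thesis
  proof cases
    case 1
    have "((\<lambda>t. exp (- 1 / t) / t ^ j) has_real_derivative (bump_germ (j + 2) t - real j * bump_germ (j + 1) t)) (at t)"
    proof (cases j)
      case 0
      show ?thesis unfolding 0 using 1
        by (auto intro!: derivative_eq_intros simp: bump_germ_def power2_eq_square)
    next
      case (Suc m)
      have [simp]: "real m * t ^ (m - Suc 0) * t = real m * t ^ m" by (cases m) auto
      have "((\<lambda>t. exp (- 1 / t) / t ^ Suc m) has_real_derivative
         (exp (- 1 / t) * (1 / t^2) * t ^ Suc m - exp (- 1 / t) * (real (Suc m) * t ^ m)) / (t ^ Suc m * t ^ Suc m)) (at t)"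
        using 1 by (auto intro!: derivative_eq_intros simp: power2_eq_square distrib_right)
      moreover have "(exp (- 1 / t) * (1 / t^2) * t ^ Suc m - exp (- 1 / t) * (real (Suc m) * t ^ m)) / (t ^ Suc m * t ^ Suc m)
          = exp (- 1 / t) / t ^ (Suc m + 2) - real (Suc m) * (exp (- 1 / t) / t ^ (Suc m + 1))"
        using 1 by (simp add: divide_simps power2_eq_square) (simp add: algebra_simps)
      ultimately show ?thesis using 1 by (simp add: Suc bump_germ_def)
    qed
    then show ?thesis
      by (rule has_field_derivative_transform_within_open[where S="{0<..}"])
         (use 1 in \<open>auto simp: bump_germ_def\<close>)
  next
    case 2
    have "((\<lambda>t. 0) has_real_derivative (bump_germ (j + 2) t - real j * bump_germ (j + 1) t)) (at t)"
      using 2 by (simp add: bump_germ_def)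
    then show ?thesis
      by (rule has_field_derivative_transform_within_open[where S="{..<0}"])
         (use 2 in \<open>auto simp: bump_germ_def\<close>)
  next
    case 3
    have "((\<lambda>h. (bump_germ j (0 + h) - bump_germ j 0) / h) \<longlongrightarrow> 0) (at 0)"
    proof (rule filterlim_split_at)
      have "eventually (\<lambda>t::real. t < 0) (at_left 0)" using eventually_at_left_real[of "-1" 0] by (auto elim: eventually_mono)
      then have "eventually (\<lambda>h. (0::real) = (bump_germ j (0 + h) - bump_germ j 0) / h) (at_left 0)"
        by eventually_elim (simp add: bump_germ_def)
      then show "((\<lambda>h. (bump_germ j (0 + h) - bump_germ j 0) / h) \<longlongrightarrow> 0) (at_left 0)"
        by (rule Lim_transform_eventually[OF tendsto_const])
      have "eventually (\<lambda>t::real. t > 0) (at_right 0)" by (simp add: eventually_at_right_less)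
      then have "eventually (\<lambda>h. bump_germ (Suc j) h = (bump_germ j (0 + h) - bump_germ j 0) / h) (at_right 0)"
        by eventually_elim (simp add: bump_germ_def)
      then show "((\<lambda>h. (bump_germ j (0 + h) - bump_germ j 0) / h) \<longlongrightarrow> 0) (at_right 0)"
        by (rule Lim_transform_eventually[OF bump_germ_at_0])
    qed
    then show ?thesis using 3 by (simp add: DERIV_def bump_germ_def)
  qed
qed

text \<open>
  The class to which coinduction is applied.  It contains the smooth functions themselves, so
  its closure properties are closure properties of smoothness.
\<close>

inductive smooth_term :: "(real^'n \<Rightarrow> complex) \<Rightarrow> bool" where
  base: "smooth f \<Longrightarrow> smooth_term f"
| const: "smooth_term (\<lambda>x. c)"
| add: "smooth_term f \<Longrightarrow> smooth_term g \<Longrightarrow> smooth_term (\<lambda>x. f x + g x)"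
| mult: "smooth_term f \<Longrightarrow> smooth_term g \<Longrightarrow> smooth_term (\<lambda>x. f x * g x)"
| cnj: "smooth_term f \<Longrightarrow> smooth_term (\<lambda>x. cnj (f x))"
| powr: "smooth_term f \<Longrightarrow> (\<And>x. Re (f x) > 0) \<Longrightarrow> smooth_term (\<lambda>x. of_real (Re (f x) powr a))"
| bump: "smooth_term (\<lambda>x. of_real (bump_germ j (s * x $ i + t)))"

lemma smooth_term_step:
  fixes f :: "real^'n \<Rightarrow> complex"
  assumes "smooth_term f"
  shows "(\<forall>x. f differentiable at x) \<and> (\<forall>k. smooth_term (partial_deriv k f))"
  using assms
proof induction
  case (base f)
  then show ?case using smooth_differentiable smooth_partial_deriv smooth_term.base by blast
next
  case (const c)
  have "partial_deriv k (\<lambda>x::real^'n. c) = (\<lambda>x. 0)" for k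
    by (rule ext, rule partial_deriv_eq[OF has_derivative_const])
  then show ?case by (auto intro: smooth_term.const)
next
  case (add f g)
  have d: "((\<lambda>x. f x + g x) has_derivative (\<lambda>h. frechet_derivative f (at x) h + frechet_derivative g (at x) h)) (at x)" for x
    using add by (intro has_derivative_add has_derivative_frechet) auto
  have "partial_deriv k (\<lambda>x. f x + g x) = (\<lambda>x. partial_deriv k f x + partial_deriv k g x)" for k
    by (rule ext, subst partial_deriv_eq[OF d]) (simp add: partial_deriv_def)
  then show ?case using add d by (auto intro: smooth_term.add simp: differentiable_def)
next
  case (mult f g)
  have d: "((\<lambda>x. f x * g x) has_derivative (\<lambda>h. f x * frechet_derivative g (at x) h + frechet_derivative f (at x) h * g x)) (at x)" for x
    using mult by (intro has_derivative_mult has_derivative_frechet) auto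
  have "partial_deriv k (\<lambda>x. f x * g x) = (\<lambda>x. f x * partial_deriv k g x + partial_deriv k f x * g x)" for k
    by (rule ext, subst partial_deriv_eq[OF d]) (simp add: partial_deriv_def)
  then show ?case using mult d by (auto intro!: smooth_term.add smooth_term.mult simp: differentiable_def)
next
  case (cnj f)
  have d: "((\<lambda>x. cnj (f x)) has_derivative (\<lambda>h. cnj (frechet_derivative f (at x) h))) (at x)" for x
    using cnj by (intro has_derivative_cnj has_derivative_frechet) auto
  have "partial_deriv k (\<lambda>x. cnj (f x)) = (\<lambda>x. cnj (partial_deriv k f x))" for k
    by (rule ext, subst partial_deriv_eq[OF d]) (simp add: partial_deriv_def)
  then show ?case using cnj d by (auto intro!: smooth_term.cnj simp: differentiable_def)
next
  case (powr f a)
  have d: "((\<lambda>x. of_real (Re (f x) powr a)) has_derivative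
      (\<lambda>h. complex_of_real (Re (frechet_derivative f (at x) h) * (a * Re (f x) powr (a - 1))))) (at x)" for x
    using powr
    by (intro has_derivative_of_real has_derivative_Re has_derivative_frechet
          DERIV_compose_FDERIV[OF has_real_derivative_powr]) auto
  have "partial_deriv k (\<lambda>x. complex_of_real (Re (f x) powr a)) =
      (\<lambda>x. ((1/2) * (partial_deriv k f x + cnj (partial_deriv k f x))) * (of_real a * of_real (Re (f x) powr (a - 1))))" for k
    by (rule ext, subst partial_deriv_eq[OF d]) (simp add: partial_deriv_def complex_add_cnj)
  moreover have "smooth_term (\<lambda>x. ((1/2) * (partial_deriv k f x + cnj (partial_deriv k f x))) * (of_real a * of_real (Re (f x) powr (a - 1))))" for k
    using powr by (intro smooth_term.add smooth_term.mult smooth_term.cnj smooth_term.powr smooth_term.const) auto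
  ultimately show ?case using d unfolding differentiable_def by (metis (no_types, lifting))
next
  case (bump j s i t)
  have d: "((\<lambda>x::real^'n. of_real (bump_germ j (s * x $ i + t))) has_derivative
      (\<lambda>h. complex_of_real ((s * h $ i) * (bump_germ (j + 2) (s * x $ i + t) - real j * bump_germ (j + 1) (s * x $ i + t))))) (at x)" for x
    by (intro has_derivative_of_real DERIV_compose_FDERIV[OF bump_germ_has_derivative])
       (auto intro!: derivative_eq_intros bounded_linear_imp_has_derivative[OF bounded_linear_vec_nth])
  have "partial_deriv k (\<lambda>x::real^'n. complex_of_real (bump_germ j (s * x $ i + t))) =
      (\<lambda>x. of_real (s * axis k 1 $ i) * (of_real (bump_germ (j + 2) (s * x $ i + t)) + of_real (- real j) * of_real (bump_germ (j + 1) (s * x $ i + t))))" for k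
    by (rule ext, subst partial_deriv_eq[OF d]) (simp add: algebra_simps)
  moreover have "smooth_term (\<lambda>x::real^'n. of_real (s * axis k 1 $ i) * (of_real (bump_germ (j + 2) (s * x $ i + t)) + of_real (- real j) * of_real (bump_germ (j + 1) (s * x $ i + t))))" for k
    by (intro smooth_term.add smooth_term.mult smooth_term.bump smooth_term.const)
  ultimately show ?case using d unfolding differentiable_def by (metis (no_types, lifting))
qed

lemma smooth_iff_smooth_term: "smooth f \<longleftrightarrow> smooth_term f"
  using smooth_coinduct[of smooth_term f] smooth_term_step smooth_term.base by blast

lemmas smooth_const = smooth_term.const[folded smooth_iff_smooth_term]
  and smooth_add = smooth_term.add[folded smooth_iff_smooth_term]
  and smooth_mult = smooth_term.mult[folded smooth_iff_smooth_term]
  and smooth_cnj = smooth_term.cnj[folded smooth_iff_smooth_term]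
  and smooth_powr = smooth_term.powr[folded smooth_iff_smooth_term]
  and smooth_bump_germ = smooth_term.bump[folded smooth_iff_smooth_term]

lemma smooth_prod:
  assumes "finite I" "\<And>i. i \<in> I \<Longrightarrow> smooth (f i)" shows "smooth (\<lambda>x. \<Prod>i\<in>I. f i x)"
  using assms by (induction I rule: finite_induct) (auto intro: smooth_const smooth_mult)

lemma smooth_continuous: "smooth f \<Longrightarrow> continuous_on A f"
  by (meson smooth_differentiable differentiable_imp_continuous_on differentiable_at_withinI differentiable_on_def)

lemma partial_deriv_mult:
  assumes "smooth f" "smooth g"
  shows "partial_deriv k (\<lambda>x. f x * g x) x = f x * partial_deriv k g x + partial_deriv k f x * g x"
  by (subst partial_deriv_eq[OF has_derivative_mult[OF has_derivative_frechet has_derivative_frechet]])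
     (auto simp: assms smooth_differentiable partial_deriv_def)

lemma partial_deriv_add:
  assumes "smooth f" "smooth g"
  shows "partial_deriv k (\<lambda>x. f x + g x) x = partial_deriv k f x + partial_deriv k g x"
  by (subst partial_deriv_eq[OF has_derivative_add[OF has_derivative_frechet has_derivative_frechet]])
     (auto simp: assms smooth_differentiable partial_deriv_def)

lemma partial_deriv_cmult:
  assumes "smooth f"
  shows "partial_deriv k (\<lambda>x. c * f x) x = c * partial_deriv k f x"
  by (subst partial_deriv_eq[OF has_derivative_mult_right[OF has_derivative_frechet]])
     (auto simp: assms smooth_differentiable partial_deriv_def)

lemma partial_deriv_cnj:
  assumes "smooth f"
  shows "partial_deriv k (\<lambda>x. cnj (f x)) x = cnj (partial_deriv k f x)"
  by (subst partial_deriv_eq[OF has_derivative_cnj[OF has_derivative_frechet]])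
     (auto simp: assms smooth_differentiable partial_deriv_def)

lemma test_function_smooth: "\<phi> \<in> test_functions \<Longrightarrow> smooth \<phi>"
  by (simp add: test_functions_iff)

lemma test_functions_subset_support:
  assumes "\<phi> \<in> test_functions" "smooth f" "\<And>x. \<phi> x = 0 \<Longrightarrow> f x = 0"
  shows "f \<in> test_functions"
proof -
  have "{x. f x \<noteq> 0} \<subseteq> {x. \<phi> x \<noteq> 0}" using assms(3) by auto
  then show ?thesis using assms by (auto simp: test_functions_iff intro: bounded_subset)
qed

lemma test_functions_mult: "\<phi> \<in> test_functions \<Longrightarrow> smooth f \<Longrightarrow> (\<lambda>x. f x * \<phi> x) \<in> test_functions"
  by (rule test_functions_subset_support[of \<phi>]) (auto intro: smooth_mult test_function_smooth)

lemma test_functions_cmult: "\<phi> \<in> test_functions \<Longrightarrow> (\<lambda>x. c * \<phi> x) \<in> test_functions"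
  by (intro test_functions_mult smooth_const)

lemma test_functions_add:
  assumes "\<phi> \<in> test_functions" "\<psi> \<in> test_functions"
  shows "(\<lambda>x. \<phi> x + \<psi> x) \<in> test_functions"
proof -
  have "{x. \<phi> x + \<psi> x \<noteq> 0} \<subseteq> {x. \<phi> x \<noteq> 0} \<union> {x. \<psi> x \<noteq> 0}" by auto
  moreover have "bounded ({x. \<phi> x \<noteq> 0} \<union> {x. \<psi> x \<noteq> 0})"
    using assms by (simp add: test_functions_iff)
  ultimately have "bounded {x. \<phi> x + \<psi> x \<noteq> 0}" by (rule bounded_subset[rotated])
  then show ?thesis using assms by (simp add: test_functions_iff smooth_add)
qed

lemma partial_deriv_test:
  assumes "\<phi> \<in> test_functions"
  shows "partial_deriv k \<phi> \<in> test_functions"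
proof -
  have "partial_deriv k \<phi> x = 0" if x: "x \<notin> closure {x. \<phi> x \<noteq> 0}" for x
  proof (rule trans[OF partial_deriv_eq])
    have "((\<lambda>y. 0 :: complex) has_derivative (\<lambda>h. 0)) (at x)" by (rule has_derivative_const)
    then show "(\<phi> has_derivative (\<lambda>h. 0)) (at x)"
    proof (rule has_derivative_transform_within_open[where s="- closure {x. \<phi> x \<noteq> 0}"])
      show "0 = \<phi> y" if "y \<in> - closure {x. \<phi> x \<noteq> 0}" for y
        using that closure_subset[of "{x. \<phi> x \<noteq> 0}"] by auto
    qed (use x in auto)
  qed simp
  then have "{x. partial_deriv k \<phi> x \<noteq> 0} \<subseteq> closure {x. \<phi> x \<noteq> 0}" by auto
  then have "bounded {x. partial_deriv k \<phi> x \<noteq> 0}"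
    using assms by (metis bounded_closure bounded_subset test_functions_iff)
  then show ?thesis using assms by (simp add: test_functions_iff smooth_partial_deriv)
qed

lemma smooth_measurable: "smooth f \<Longrightarrow> f \<in> borel_measurable lebesgue"
  by (intro measurable_completion) (simp add: borel_measurable_continuous_onI smooth_continuous)

lemma test_function_Lp:
  assumes "\<phi> \<in> test_functions" "0 < q"
  shows "\<phi> \<in> Lp_space q"
proof (rule Lp_spaceI)
  show m: "\<phi> \<in> borel_measurable lebesgue" using assms by (intro smooth_measurable test_function_smooth)
  let ?K = "closure {x. \<phi> x \<noteq> 0}"
  have cont: "continuous_on A \<phi>" for A by (intro smooth_continuous test_function_smooth assms)
  have "integrable lborel (\<lambda>x. indicator ?K x *\<^sub>R (norm (\<phi> x) powr q))"
    by (rule borel_integrable_compact)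
       (use assms in \<open>auto simp: test_functions_iff intro!: continuous_on_powr' continuous_on_norm continuous_on_const cont\<close>)
  also have "(\<lambda>x. indicator ?K x *\<^sub>R (norm (\<phi> x) powr q)) = (\<lambda>x. norm (\<phi> x) powr q)"
    using closure_subset[of "{x. \<phi> x \<noteq> 0}"] by (auto simp: fun_eq_iff indicator_def)
  finally show "integrable lebesgue (\<lambda>x. norm (\<phi> x) powr q)"
    by (subst integrable_completion) (rule borel_measurable_integrable)
qed

lemma integrable_of_Lp_1: "f \<in> Lp_space 1 \<Longrightarrow> integrable lebesgue f"
  by (rule integrable_norm_cancel) (auto simp: Lp_space_def)

lemma Linf_mult_Lp:
  assumes "c \<in> Linf_space" "f \<in> Lp_space q" "0 < q"
  shows "(\<lambda>x. c x * f x) \<in> Lp_space q"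
proof -
  obtain K where K: "AE x in lebesgue. norm (c x) \<le> K" and [measurable]: "c \<in> borel_measurable lebesgue"
    using assms(1) by (auto simp: Linf_space_def)
  note [measurable] = measurable_Lp[OF assms(2)]
  show ?thesis
  proof (rule Lp_space_dominated[OF assms(2) _ assms(3)])
    show "AE x in lebesgue. norm (c x * f x) \<le> K * norm (f x)"
      using K by eventually_elim (simp add: norm_mult mult_right_mono)
  qed measurable
qed

lemma Linf_mult_test_integrable:
  "c \<in> Linf_space \<Longrightarrow> \<phi> \<in> test_functions \<Longrightarrow> integrable lebesgue (\<lambda>x. c x * \<phi> x)"
  by (intro integrable_of_Lp_1 Linf_mult_Lp test_function_Lp) auto


lemma L2_tendsto_of_dominated:
  assumes f: "\<And>n. f n \<in> borel_measurable lebesgue" and g: "g \<in> borel_measurable lebesgue"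
    and h: "h \<in> Lp_space 2"
    and lim: "AE x in lebesgue. (\<lambda>n. f n x) \<longlonglongrightarrow> g x"
    and bd: "\<And>n x. norm (f n x) \<le> K * norm (h x)"
  shows "g \<in> Lp_space 2" and "Lp_tendsto 2 f g"
proof -
  note [measurable] = f g measurable_Lp[OF h]
  have gb: "AE x in lebesgue. norm (g x) \<le> K * norm (h x)"
    using lim by eventually_elim (rule LIMSEQ_le_const2[OF tendsto_norm], auto simp: bd)
  show "g \<in> Lp_space 2" by (rule Lp_space_dominated[OF h g _ gb]) simp
  have "(\<lambda>n. LINT x|lebesgue. (norm (f n x - g x))\<^sup>2) \<longlonglongrightarrow> (LINT x::real^'a|lebesgue. 0)"
  proof (rule integral_dominated_convergence)
    show "integrable lebesgue (\<lambda>x. (2 * K)\<^sup>2 * (norm (h x))\<^sup>2)" using integrable_L2[OF h] by simp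
    show "AE x in lebesgue. (\<lambda>n. (norm (f n x - g x))\<^sup>2) \<longlonglongrightarrow> 0"
      using lim by eventually_elim (simp add: LIM_zero_iff tendsto_norm_zero_iff tendsto_null_power)
    show "AE x in lebesgue. norm ((norm (f n x - g x))\<^sup>2) \<le> (2 * K)\<^sup>2 * (norm (h x))\<^sup>2" for n
      using gb
    proof eventually_elim
      case (elim x)
      have "norm (f n x - g x) \<le> (2 * K) * norm (h x)"
        using norm_triangle_ineq4[of "f n x" "g x"] elim bd[of n x] by linarith
      then have "(norm (f n x - g x))\<^sup>2 \<le> ((2 * K) * norm (h x))\<^sup>2" by (intro power_mono) auto
      then show ?case by (simp add: power_mult_distrib)
    qed
  qed measurable
  then have "(\<lambda>n. sqrt ((Lp_dist 2 (f n) g)\<^sup>2)) \<longlonglongrightarrow> sqrt 0"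
    by (intro tendsto_real_sqrt) (simp add: Lp2_power2)
  then show "Lp_tendsto 2 f g" by simp
qed

definition test_closure :: "(real^'n \<Rightarrow> complex) set" where
  "test_closure = {f \<in> Lp_space 2. \<forall>e>0. \<exists>\<phi>\<in>test_functions. Lp_dist 2 \<phi> f < e}"

lemma test_closure_Lp: "f \<in> test_closure \<Longrightarrow> f \<in> Lp_space 2"
  by (simp add: test_closure_def)

lemma test_closure_limit:
  assumes f: "\<And>n. f n \<in> test_closure" and g: "g \<in> Lp_space 2"
    and lim: "Lp_tendsto 2 f g"
  shows "g \<in> test_closure"
  unfolding test_closure_def
proof (intro CollectI conjI allI impI g)
  fix e :: real assume e: "e > 0"
  then obtain n where n: "Lp_dist 2 (f n) g < e / 2"
    using order_tendstoD(2)[OF lim, of "e / 2"] by (auto simp: eventually_sequentially)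
  obtain \<phi> where \<phi>: "\<phi> \<in> test_functions" "Lp_dist 2 \<phi> (f n) < e / 2"
    using f[of n] e unfolding test_closure_def by (auto dest: spec[of _ "e / 2"])
  have "Lp_dist 2 \<phi> g \<le> Lp_dist 2 \<phi> (f n) + Lp_dist 2 (f n) g"
    by (intro Lp_norm_triangle_diff test_function_Lp \<phi> test_closure_Lp f g) auto
  then show "\<exists>\<phi>\<in>test_functions. Lp_dist 2 \<phi> g < e"
    using \<phi> n by (intro bexI[of _ \<phi>]) auto
qed

lemma test_closure_cong:
  assumes "f \<in> test_closure" "g \<in> borel_measurable lebesgue" "AE x in lebesgue. f x = g x"
  shows "g \<in> test_closure"
proof (rule test_closure_limit[OF assms(1)])
  note [measurable] = assms(2) measurable_Lp[OF test_closure_Lp[OF assms(1)]]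
  show "g \<in> Lp_space 2"
    by (rule Lp_space_dominated[OF test_closure_Lp[OF assms(1)], of _ 1]) (use assms(3) in auto)
  have "Lp_dist 2 f g = Lp_norm 2 (\<lambda>x::real^'a. 0)"
    by (rule Lp_norm_cong_AE) (use assms(3) in \<open>auto elim!: eventually_mono\<close>)
  then show "Lp_tendsto 2 (\<lambda>n. f) g" by (simp add: Lp_norm_def)
qed

lemma test_closure_cmult:
  assumes f: "f \<in> test_closure" shows "(\<lambda>x. c * f x) \<in> test_closure"
  unfolding test_closure_def
proof (intro CollectI conjI allI impI Lp_space_cmult test_closure_Lp f)
  fix e :: real assume e: "e > 0"
  then have "e / (norm c + 1) > 0" by (simp add: add_nonneg_pos)
  then obtain \<phi> where \<phi>: "\<phi> \<in> test_functions" "Lp_dist 2 \<phi> f < e / (norm c + 1)"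
    using f unfolding test_closure_def by blast
  have "Lp_norm 2 (\<lambda>x. c * \<phi> x - c * f x) = norm c * Lp_dist 2 \<phi> f"
    by (simp add: Lp_norm_cmult right_diff_distrib[symmetric])
  also have "\<dots> \<le> (norm c + 1) * Lp_dist 2 \<phi> f" by (simp add: mult_right_mono)
  also have "\<dots> < e" using \<phi>(2) add_nonneg_pos[OF norm_ge_zero zero_less_one, of c]
    by (simp only: pos_less_divide_eq mult.commute)
  finally show "\<exists>\<phi>\<in>test_functions. Lp_norm 2 (\<lambda>x. \<phi> x - c * f x) < e"
    using test_functions_cmult[OF \<phi>(1)] by (intro bexI[of _ "\<lambda>x. c * \<phi> x"])
qed

lemma test_closure_add:
  assumes f: "f \<in> test_closure" and g: "g \<in> test_closure"
  shows "(\<lambda>x. f x + g x) \<in> test_closure"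
  unfolding test_closure_def
proof (intro CollectI conjI allI impI Lp_space_add test_closure_Lp f g)
  fix e :: real assume "e > 0"
  then have e: "e / 2 > 0" by simp
  obtain \<phi> where \<phi>: "\<phi> \<in> test_functions" "Lp_dist 2 \<phi> f < e / 2"
    using f e unfolding test_closure_def by blast
  obtain \<psi> where \<psi>: "\<psi> \<in> test_functions" "Lp_dist 2 \<psi> g < e / 2"
    using g e unfolding test_closure_def by blast
  have "Lp_norm 2 (\<lambda>x. (\<phi> x - f x) + (\<psi> x - g x)) \<le> Lp_dist 2 \<phi> f + Lp_dist 2 \<psi> g"
    by (intro Minkowski_Lp_norm Lp_space_diff test_function_Lp \<phi> \<psi> test_closure_Lp f g) auto
  also have "(\<lambda>x. (\<phi> x - f x) + (\<psi> x - g x)) = (\<lambda>x. (\<phi> x + \<psi> x) - (f x + g x))" by auto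
  finally show "\<exists>\<phi>\<in>test_functions. Lp_norm 2 (\<lambda>x. \<phi> x - (f x + g x)) < e"
    using \<phi> \<psi> test_functions_add[OF \<phi>(1) \<psi>(1)] by (intro bexI[of _ "\<lambda>x. \<phi> x + \<psi> x"]) auto
qed simp

lemma test_closure_sum:
  assumes "finite I" "\<And>i. i \<in> I \<Longrightarrow> f i \<in> test_closure"
  shows "(\<lambda>x. \<Sum>i\<in>I. f i x) \<in> test_closure"
  using assms
proof (induction I rule: finite_induct)
  case empty
  have "(\<lambda>x. 0) \<in> test_functions" by (simp add: test_functions_iff smooth_const)
  then show ?case by (force simp: test_closure_def Lp_norm_def)
qed (auto intro: test_closure_add)

lemma test_function_in_test_closure: "\<phi> \<in> test_functions \<Longrightarrow> \<phi> \<in> test_closure"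
  by (force simp: test_closure_def Lp_norm_def intro: test_function_Lp)

lemma indicator_box_Lp: "(\<lambda>x. indicator (box a b) x) \<in> Lp_space 2"
proof (rule L2_spaceI)
  have "integrable lebesgue (indicator (box a b) :: real^'a \<Rightarrow> real)"
    by (rule integrable_real_indicator) (use emeasure_bounded_finite[OF bounded_box[of a b]] in auto)
  also have "(indicator (box a b) :: real^'a \<Rightarrow> real) = (\<lambda>x. (norm (indicator (box a b) x :: complex))\<^sup>2)"
    by (auto simp: indicator_def)
  finally show "integrable lebesgue (\<lambda>x. (norm (indicator (box a b) x :: complex))\<^sup>2)" .
qed (rule borel_measurable_indicator, simp)

text \<open>
  A product \<open>g\<close> of flat functions is smooth and positive exactly on the box; \<open>g / (g + 1 / (n + 1))\<close> then
  increases to the indicator of the box.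
\<close>

lemma indicator_box_in_test_closure:
  fixes a b :: "real^'n"
  shows "(\<lambda>x. indicator (box a b) x) \<in> test_closure"
proof -
  define g where "g x = (\<Prod>i\<in>UNIV. bump_germ 0 (1 * x $ i + - a $ i) * bump_germ 0 (- 1 * x $ i + b $ i))" for x :: "real^'n"
  have nn: "0 \<le> bump_germ 0 t" and pos: "0 < bump_germ 0 t \<longleftrightarrow> t > 0" for t
    by (auto simp: bump_germ_def)
  have g0: "0 \<le> g x" for x unfolding g_def by (intro prod_nonneg ballI mult_nonneg_nonneg nn)
  have gz: "g x = 0" if xn: "x \<notin> box a b" for x
  proof -
    obtain i where "\<not> (a $ i < x $ i \<and> x $ i < b $ i)" using xn unfolding mem_box_cart by blast
    then have "bump_germ 0 (1 * x $ i + - a $ i) * bump_germ 0 (- 1 * x $ i + b $ i) = 0"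
      by (auto simp: bump_germ_def)
    then show ?thesis unfolding g_def by (intro prod_zero) auto
  qed
  have gp: "0 < g x" if "x \<in> box a b" for x
    unfolding g_def using that by (intro prod_pos) (auto simp: mem_box_cart pos)
  have gs: "smooth (\<lambda>x. complex_of_real (g x))"
    unfolding g_def of_real_prod of_real_mult by (intro smooth_prod smooth_mult smooth_bump_germ) auto
  define \<phi> where "\<phi> n x = complex_of_real (g x) * of_real (Re (of_real (g x) + of_real (1 / Suc n)) powr (- 1))" for n :: nat and x
  have \<phi>_eq: "\<phi> n x = of_real (g x / (g x + 1 / Suc n))" for n x
    using g0[of x] by (simp add: \<phi>_def powr_minus_divide)
  have "\<phi> n \<in> test_functions" for n
  proof -
    have "smooth (\<phi> n)" unfolding \<phi>_def[abs_def]
      by (intro smooth_mult gs smooth_powr smooth_add smooth_const) (simp add: g0 add_nonneg_pos)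
    moreover have "{x. \<phi> n x \<noteq> 0} \<subseteq> box a b" using gz by (auto simp: \<phi>_def)
    ultimately show ?thesis using bounded_subset[OF bounded_box] by (auto simp: test_functions_iff)
  qed
  then have t: "\<phi> n \<in> test_functions" for n .
  show ?thesis
  proof (rule test_closure_limit[OF test_function_in_test_closure[OF t]])
    show "(\<lambda>x::real^'n. indicator (box a b) x) \<in> Lp_space 2" by (rule indicator_box_Lp)
    show "Lp_tendsto 2 \<phi> (indicator (box a b))"
    proof (rule L2_tendsto_of_dominated(2)[where K=1 and h="\<lambda>x. indicator (box a b) x", OF _ _ indicator_box_Lp])
      show "\<phi> n \<in> borel_measurable lebesgue" for n
        by (intro smooth_measurable test_function_smooth t)
      show "norm (\<phi> n x) \<le> 1 * norm (indicator (box a b) x :: complex)" for n x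
      proof (cases "x \<in> box a b")
        case True
        have "norm (\<phi> n x) = g x / (g x + 1 / Suc n)"
          unfolding \<phi>_eq norm_of_real using g0[of x] by simp
        also have "\<dots> \<le> 1" using g0[of x] by (simp add: divide_le_eq_1 add_nonneg_pos)
        finally show ?thesis using True by simp
      qed (simp add: \<phi>_eq gz)
      show "AE x in lebesgue. (\<lambda>n. \<phi> n x) \<longlonglongrightarrow> indicator (box a b) x"
      proof (rule AE_I2)
        fix x :: "real^'n"
        show "(\<lambda>n. \<phi> n x) \<longlonglongrightarrow> indicator (box a b) x"
        proof (cases "x \<in> box a b")
          case True
          have "(\<lambda>n. 1 / real (Suc n)) \<longlonglongrightarrow> 0" by (rule LIMSEQ_Suc[OF lim_1_over_n])
          then have "(\<lambda>n. g x / (g x + 1 / Suc n)) \<longlonglongrightarrow> g x / (g x + 0)"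
            using gp[OF True] by (intro tendsto_intros) auto
          then have "(\<lambda>n. \<phi> n x) \<longlonglongrightarrow> of_real (g x / (g x + 0))" unfolding \<phi>_eq by (rule tendsto_of_real)
          then show ?thesis using gp[OF True] True by simp
        next
          case False
          then show ?thesis by (simp add: \<phi>_eq gz)
        qed
      qed
    qed (rule borel_measurable_indicator, simp)
  qed
qed

text \<open>
  Boxes form a generator of the Borel sets that is stable under intersection, and the sets whose
  trace on a fixed box has an approximable indicator form a Dynkin system.
\<close>

lemma indicator_borel_in_test_closure:
  fixes A :: "(real^'n) set"
  assumes "A \<in> sets borel"
  shows "(\<lambda>x. indicator (A \<inter> box a b) x) \<in> test_closure"
proof -
  have ml: "(\<lambda>x. indicator (B \<inter> box a b) x :: complex) \<in> borel_measurable lebesgue" if "B \<in> sets borel" for B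
    using that by (intro borel_measurable_indicator) auto
  have sig: "sigma_sets UNIV (range (\<lambda>(a, b). box a b)) = sets (borel :: (real^'n) measure)"
    by (subst borel_eq_box) simp
  have stab: "Int_stable (range (\<lambda>(a, b). box a b :: (real^'n) set))"
    by (auto simp: Int_stable_def box_Int_box)
  show ?thesis
    using stab subset_UNIV[of "range (\<lambda>(a, b). box a b :: (real^'n) set)"] assms
    unfolding sig[symmetric] Pow_UNIV[symmetric]
  proof (induction rule: sigma_sets_induct_disjoint)
    case (basic A)
    then obtain c d where "A = box c d" by auto
    then show ?case unfolding box_Int_box by (simp add: indicator_box_in_test_closure box_Int_box)
  next
    case empty
    then show ?case using test_closure_cmult[OF indicator_box_in_test_closure, of 0] by simp
  next
    case (compl A)
    have "(\<lambda>x. indicator (box a b) x + (-1) * indicator (A \<inter> box a b) x) \<in> test_closure"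
      by (intro test_closure_add indicator_box_in_test_closure test_closure_cmult compl)
    also have "(\<lambda>x. indicator (box a b) x + (-1) * indicator (A \<inter> box a b) x) = (\<lambda>x. indicator ((UNIV - A) \<inter> box a b) x :: complex)"
      by (auto simp: indicator_def)
    finally show ?case .
  next
    case (union A)
    have Ab: "A i \<in> sets borel" for i using union(2) sig by auto
    let ?f = "\<lambda>n x. \<Sum>i<n. indicator (A i \<inter> box a b) x :: complex"
    have f_eq: "?f n x = indicator ((\<Union>i<n. A i) \<inter> box a b) x" for n x
    proof (cases "x \<in> box a b")
      case True
      have "?f n x = (\<Sum>i<n. indicator (A i) x)" using True by (intro sum.cong) (auto simp: indicator_def)
      also have "\<dots> = indicator (\<Union>i<n. A i) x"
        using union(1) by (intro indicator_UN_disjoint[symmetric]) (auto simp: disjoint_family_on_def)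
      finally show ?thesis using True by (simp add: indicator_def)
    qed auto
    show ?case
    proof (rule test_closure_limit[where f = ?f])
      show "?f n \<in> test_closure" for n by (intro test_closure_sum union) auto
      have lim: "AE x in lebesgue. (\<lambda>n. ?f n x) \<longlonglongrightarrow> indicator ((\<Union>i. A i) \<inter> box a b) x"
      proof (rule AE_I2)
        fix x :: "real^'n"
        have "eventually (\<lambda>n. ?f n x = indicator ((\<Union>i. A i) \<inter> box a b) x) sequentially"
        proof (cases "\<exists>i. x \<in> A i")
          case True
          then obtain i where "x \<in> A i" by blast
          then show ?thesis unfolding f_eq eventually_sequentially
            by (intro exI[of _ "Suc i"]) (auto simp: indicator_def)
        qed (auto simp: f_eq)
        then show "(\<lambda>n. ?f n x) \<longlonglongrightarrow> indicator ((\<Union>i. A i) \<inter> box a b) x" by (rule tendsto_eventually)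
      qed
      have bd: "norm (?f n x) \<le> 1 * norm (indicator (box a b) x :: complex)" for n x
        unfolding f_eq by (auto simp: indicator_def)
      have m: "?f n \<in> borel_measurable lebesgue" for n using ml Ab by (intro borel_measurable_sum) auto
      have mU: "(\<lambda>x. indicator ((\<Union>i. A i) \<inter> box a b) x :: complex) \<in> borel_measurable lebesgue"
        using Ab by (intro ml) auto
      note * = L2_tendsto_of_dominated[OF m mU indicator_box_Lp lim bd]
      show "(\<lambda>x. indicator ((\<Union>i. A i) \<inter> box a b) x) \<in> Lp_space 2" by (rule *(1))
      show "Lp_tendsto 2 ?f (indicator ((\<Union>i. A i) \<inter> box a b))" by (rule *(2))
    qed
  qed
qed

lemma indicator_in_test_closure:
  fixes A :: "(real^'n) set"
  assumes A: "(\<lambda>x. indicator A x) \<in> Lp_space 2" "A \<in> sets lebesgue"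
  shows "(\<lambda>x. indicator A x) \<in> test_closure"
proof -
  obtain S N N' where S: "A = S \<union> N" "N \<subseteq> N'" "N' \<in> null_sets lborel" "S \<in> sets lborel"
    using sets_completionE[OF A(2)] by metis
  have ae: "AE x in lebesgue. x \<notin> N'" using S(3) by (intro AE_completion AE_not_in)
  define Q :: "nat \<Rightarrow> (real^'n) set" where "Q n = box (\<chi> i. - real n) (\<chi> i. real n)" for n
  have 1: "(\<lambda>x. indicator (S \<inter> Q n) x) \<in> test_closure" for n
    unfolding Q_def using S(4) by (intro indicator_borel_in_test_closure) simp
  have m: "(\<lambda>x. indicator (S \<inter> Q n) x :: complex) \<in> borel_measurable lebesgue" for n
    by (rule measurable_Lp[OF test_closure_Lp[OF 1]])
  have Sm: "(\<lambda>x. indicator S x :: complex) \<in> borel_measurable lebesgue"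
    using S(4) by (intro borel_measurable_indicator) auto
  have lim: "AE x in lebesgue. (\<lambda>n. indicator (S \<inter> Q n) x :: complex) \<longlonglongrightarrow> indicator S x"
  proof (rule AE_I2)
    fix x :: "real^'n"
    obtain M where M: "norm x < real M" using reals_Archimedean2 by blast
    have "x \<in> Q n" if "n \<ge> M" for n unfolding Q_def mem_box_cart
    proof
      fix i
      have "\<bar>x $ i\<bar> < real n" using component_le_norm_cart[of x i] M that
        by (smt (verit) of_nat_le_iff)
      then show "(\<chi> i. - real n) $ i < x $ i \<and> x $ i < (\<chi> i. real n) $ i" by auto
    qed
    then have "eventually (\<lambda>n. indicator (S \<inter> Q n) x = (indicator S x :: complex)) sequentially"
      unfolding eventually_sequentially by (intro exI[of _ M]) (auto simp: indicator_def)
    then show "(\<lambda>n. indicator (S \<inter> Q n) x :: complex) \<longlonglongrightarrow> indicator S x" by (rule tendsto_eventually)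
  qed
  have bd: "norm (indicator (S \<inter> Q n) x :: complex) \<le> 1 * norm (indicator A x :: complex)" for n x
    using S(1) by (auto simp: indicator_def)
  note * = L2_tendsto_of_dominated[OF m Sm A(1) lim bd]
  have "(\<lambda>x. indicator S x) \<in> test_closure" by (rule test_closure_limit[OF 1 *])
  then show ?thesis
  proof (rule test_closure_cong)
    show "(\<lambda>x. indicator A x :: complex) \<in> borel_measurable lebesgue" by (rule measurable_Lp[OF A(1)])
    show "AE x in lebesgue. indicator S x = (indicator A x :: complex)"
      using ae by eventually_elim (use S in \<open>auto simp: indicator_def\<close>)
  qed
qed

lemma L2_subset_test_closure:
  assumes f: "f \<in> Lp_space 2" shows "f \<in> test_closure"
proof -
  obtain s where s: "\<And>i. simple_function lebesgue (s i)" "\<And>x. (\<lambda>i. s i x) \<longlonglongrightarrow> f x"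
    "\<And>i x. dist (s i x) 0 \<le> 2 * dist (f x) 0"
    using borel_measurable_implies_sequence_metric[OF measurable_Lp[OF f], of 0] by auto
  have sm: "s i \<in> borel_measurable lebesgue" for i by (rule borel_measurable_simple_function[OF s(1)])
  have bd: "norm (s i x) \<le> 2 * norm (f x)" for i x using s(3)[of i x] by simp
  have "s i \<in> test_closure" for i
  proof -
    have sL: "s i \<in> Lp_space 2" by (rule Lp_space_dominated[OF f sm, of _ 2]) (auto simp: bd)
    have fin: "finite (range (s i))" using simple_functionD(1)[OF s(1)[of i]] by simp
    have "(\<lambda>x. y * indicator (s i -` {y}) x) \<in> test_closure" for y
    proof (cases "y = 0")
      case True
      then show ?thesis using test_closure_sum[of "{}"] by simp
    next
      case False
      have ms: "s i -` {y} \<in> sets lebesgue" using simple_functionD(2)[OF s(1)[of i], of "{y}"] by simp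
      have "(\<lambda>x. indicator (s i -` {y}) x :: complex) \<in> Lp_space 2"
        by (rule Lp_space_dominated[OF sL borel_measurable_indicator[OF ms], of "1 / norm y"])
           (use False in \<open>auto simp: indicator_def\<close>)
      then show ?thesis by (intro test_closure_cmult indicator_in_test_closure ms)
    qed
    then have "(\<lambda>x. \<Sum>y\<in>range (s i). y * indicator (s i -` {y}) x) \<in> test_closure"
      by (intro test_closure_sum fin)
    also have "(\<lambda>x. \<Sum>y\<in>range (s i). y * indicator (s i -` {y}) x) = s i"
    proof
      fix x
      have "(\<Sum>y\<in>range (s i). y * indicator (s i -` {y}) x) = (\<Sum>y\<in>range (s i). if y = s i x then y else 0)"
        by (intro sum.cong) (auto simp: indicator_def)
      also have "\<dots> = s i x" using fin by simp
      finally show "(\<Sum>y\<in>range (s i). y * indicator (s i -` {y}) x) = s i x" .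
    qed
    finally show ?thesis .
  qed
  then show ?thesis
    using L2_tendsto_of_dominated(2)[OF sm measurable_Lp[OF f] f _ bd] s(2)
    by (intro test_closure_limit[of s, OF _ f]) auto
qed

lemma test_functions_dense_L2:
  assumes "f \<in> Lp_space 2"
  obtains \<phi> where "\<And>n. \<phi> n \<in> test_functions" "Lp_tendsto 2 \<phi> f"
proof -
  have "\<exists>\<phi>\<in>test_functions. Lp_dist 2 \<phi> f < inverse (real (Suc n))" for n
    using L2_subset_test_closure[OF assms] by (simp add: test_closure_def)
  then obtain \<phi> where \<phi>: "\<And>n. \<phi> n \<in> test_functions" "\<And>n. Lp_dist 2 (\<phi> n) f < inverse (real (Suc n))"
    by metis
  have "Lp_tendsto 2 \<phi> f"
    by (rule tendsto_norm_le[OF LIMSEQ_inverse_real_of_nat]) (use \<phi>(2) in \<open>auto intro: less_imp_le\<close>)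
  then show ?thesis using that \<phi>(1) by blast
qed

section \<open>Closures of sectorial forms\<close>

text \<open>
  The last assumption says that \<open>D\<close> lies in the domain of the operator associated with the form; it
  is what makes the form closable.
\<close>

locale sectorial_form =
  fixes D :: "(real^'n \<Rightarrow> complex) set" and a :: "(real^'n \<Rightarrow> complex) \<Rightarrow> (real^'n \<Rightarrow> complex) \<Rightarrow> complex"
    and M :: real
  assumes D_zero: "(\<lambda>x. 0) \<in> D"
    and D_add: "u \<in> D \<Longrightarrow> v \<in> D \<Longrightarrow> (\<lambda>x. u x + v x) \<in> D"
    and D_cmult: "u \<in> D \<Longrightarrow> (\<lambda>x. c * u x) \<in> D"
    and D_L2: "u \<in> D \<Longrightarrow> u \<in> Lp_space 2"
    and a_add_left: "u \<in> D \<Longrightarrow> u' \<in> D \<Longrightarrow> v \<in> D \<Longrightarrow> a (\<lambda>x. u x + u' x) v = a u v + a u' v"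
    and a_add_right: "u \<in> D \<Longrightarrow> v \<in> D \<Longrightarrow> v' \<in> D \<Longrightarrow> a u (\<lambda>x. v x + v' x) = a u v + a u v'"
    and a_cmult_left: "u \<in> D \<Longrightarrow> v \<in> D \<Longrightarrow> a (\<lambda>x. c * u x) v = c * a u v"
    and a_cmult_right: "u \<in> D \<Longrightarrow> v \<in> D \<Longrightarrow> a u (\<lambda>x. c * v x) = cnj c * a u v"
    and M_pos: "0 < M"
    and sectorial: "u \<in> D \<Longrightarrow> norm (a u u) \<le> M * Re (a u u)"
    and represented: "u \<in> D \<Longrightarrow> \<exists>f\<in>Lp_space 2. \<forall>v\<in>D. a u v = L2_inner f v"
begin

abbreviation q where "q u \<equiv> Re (a u u)"

lemma q_nonneg: "u \<in> D \<Longrightarrow> 0 \<le> q u"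
  using sectorial[of u] M_pos norm_ge_zero[of "a u u"] by (smt (verit) zero_le_mult_iff)

lemma D_diff: "u \<in> D \<Longrightarrow> v \<in> D \<Longrightarrow> (\<lambda>x. u x - v x) \<in> D"
  using D_add[of u "\<lambda>x. - 1 * v x"] D_cmult[of v "-1"] by simp

lemma a_diff_left: "u \<in> D \<Longrightarrow> u' \<in> D \<Longrightarrow> v \<in> D \<Longrightarrow> a (\<lambda>x. u x - u' x) v = a u v - a u' v"
  using a_add_left[of u "\<lambda>x. - 1 * u' x" v] D_cmult[of u' "-1"] a_cmult_left[of u' v "-1"] by simp

lemma a_diff_right: "u \<in> D \<Longrightarrow> v \<in> D \<Longrightarrow> v' \<in> D \<Longrightarrow> a u (\<lambda>x. v x - v' x) = a u v - a u v'"
  using a_add_right[of u v "\<lambda>x. - 1 * v' x"] D_cmult[of v' "-1"] a_cmult_right[of u v' "-1"] by simp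

lemma a_expand:
  assumes "u \<in> D" "v \<in> D"
  shows "a (\<lambda>x. u x + c * v x) (\<lambda>x. u x + c * v x) = a u u + cnj c * a u v + c * a v u + c * cnj c * a v v"
  using assms D_cmult[OF assms(2), of c] D_add[OF assms(1) D_cmult[OF assms(2), of c]]
  by (simp add: a_add_left a_add_right a_cmult_left a_cmult_right algebra_simps)

lemma q_parallelogram:
  assumes "u \<in> D" "v \<in> D"
  shows "q (\<lambda>x. u x + c * v x) + q (\<lambda>x. u x + (- c) * v x) = 2 * q u + 2 * (norm c)\<^sup>2 * q v"
  unfolding a_expand[OF assms] by (simp add: complex_mult_cnj cmod_power2 algebra_simps)

lemma q_diff_le: "u \<in> D \<Longrightarrow> v \<in> D \<Longrightarrow> q (\<lambda>x. u x - v x) \<le> 2 * q u + 2 * q v"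
  using q_parallelogram[of u v 1] q_nonneg[OF D_add[of u v]] by simp

lemma q_le_diff: "u \<in> D \<Longrightarrow> v \<in> D \<Longrightarrow> q u \<le> 2 * q (\<lambda>x. u x - v x) + 2 * q v"
  using q_parallelogram[OF D_diff, of u v v 1] q_nonneg[OF D_diff[OF D_diff], of u v v] by simp

lemma q_scale: "u \<in> D \<Longrightarrow> q (\<lambda>x. of_real r * u x) = r\<^sup>2 * q u"
  by (simp add: a_cmult_left a_cmult_right D_cmult mult.assoc[symmetric] power2_eq_square)

text \<open>
  Polarisation bounds \<open>a u v\<close> by \<open>M (q u + q v)\<close>, and scaling \<open>u\<close> against \<open>v\<close> turns the sum into a product.
\<close>

lemma form_bounded:
  assumes u: "u \<in> D" and v: "v \<in> D"
  shows "norm (a u v) \<le> 2 * M * sqrt (q u * q v)"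
proof -
  have sum_bound: "norm (a u v) \<le> M * (q u + q v)" if u: "u \<in> D" and v: "v \<in> D" for u v
  proof -
    let ?w = "\<lambda>c x. u x + c * v x"
    have w: "?w c \<in> D" for c by (intro D_add D_cmult u v)
    \<comment> \<open>Polarisation with the four fourth roots of unity.\<close>
    have "4 * a u v = (a (?w 1) (?w 1) - a (?w (-1)) (?w (-1))) + \<i> * (a (?w \<i>) (?w \<i>) - a (?w (-\<i>)) (?w (-\<i>)))"
      unfolding a_expand[OF u v] by (simp add: algebra_simps)
    then have "norm (4 * a u v) \<le> norm (a (?w 1) (?w 1)) + norm (a (?w (-1)) (?w (-1)))
        + (norm (a (?w \<i>) (?w \<i>)) + norm (a (?w (-\<i>)) (?w (-\<i>))))"
      by (metis (no_types, lifting) add_mono norm_mult norm_ii mult_1 norm_triangle_ineq4 norm_triangle_mono)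
    also have "\<dots> \<le> M * q (?w 1) + M * q (?w (-1)) + (M * q (?w \<i>) + M * q (?w (-\<i>)))"
      by (intro add_mono sectorial w)
    also have "\<dots> = M * ((q (?w 1) + q (?w (-1))) + (q (?w \<i>) + q (?w (-\<i>))))"
      by (simp add: distrib_left)
    also have "\<dots> = M * (4 * (q u + q v))"
      using q_parallelogram[OF u v, of 1] q_parallelogram[OF u v, of \<i>] by simp
    finally show ?thesis by (simp add: algebra_simps)
  qed
  have "norm (a u v) \<le> 2 * sqrt ((M * q u) * (M * q v))"
  proof (rule young_optimize)
    fix s :: real assume s: "s > 0"
    define r where "r = sqrt s"
    have r: "r > 0" "r * r = s" using s by (auto simp: r_def)
    let ?u = "\<lambda>x. of_real r * u x" and ?v = "\<lambda>x. of_real (1 / r) * v x"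
    have D: "?u \<in> D" "?v \<in> D" by (rule D_cmult[OF u], rule D_cmult[OF v])
    have "a u v = a ?u ?v" unfolding a_cmult_left[OF u D(2)] a_cmult_right[OF u v] using r by simp
    also have "norm \<dots> \<le> M * (q ?u + q ?v)" by (rule sum_bound[OF D])
    also have "q ?u = s * q u" using q_scale[OF u, of r] r by (simp add: power2_eq_square)
    also have "q ?v = q v / s" using q_scale[OF v, of "1 / r"] r by (simp add: power2_eq_square)
    finally show "norm (a u v) \<le> s * (M * q u) + M * q v / s" by (simp add: algebra_simps)
  qed (use M_pos q_nonneg u v in auto)
  moreover have "sqrt ((M * q u) * (M * q v)) = M * sqrt (q u * q v)"
    using M_pos real_sqrt_mult[of "M\<^sup>2" "q u * q v"] by (simp add: power2_eq_square mult_ac)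
  ultimately show ?thesis by simp
qed


lemma form_converges_D: "form_converges a D w u \<Longrightarrow> w n \<in> D"
  and form_converges_L2: "form_converges a D w u \<Longrightarrow> u \<in> Lp_space 2"
  and form_converges_norm: "form_converges a D w u \<Longrightarrow> Lp_tendsto 2 w u"
  by (auto simp: form_converges_def)

lemma form_converges_cauchy:
  assumes "form_converges a D w u" "e > 0"
  shows "\<exists>N. \<forall>m\<ge>N. \<forall>n\<ge>N. q (\<lambda>x. w m x - w n x) < e"
proof -
  obtain N where N: "\<And>m n. m \<ge> N \<Longrightarrow> n \<ge> N \<Longrightarrow> norm (a (\<lambda>x. w m x - w n x) (\<lambda>x. w m x - w n x)) < e"
    using assms unfolding form_converges_def by blast
  have "q (\<lambda>x. w m x - w n x) < e" if "m \<ge> N" "n \<ge> N" for m n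
    using complex_Re_le_cmod N[OF that] by (rule le_less_trans)
  then show ?thesis by blast
qed

lemma form_convergesI:
  assumes w: "\<And>n. w n \<in> D" and u: "u \<in> Lp_space 2" and lim: "Lp_tendsto 2 w u"
    and c: "\<And>e. e > 0 \<Longrightarrow> \<exists>N. \<forall>m\<ge>N. \<forall>n\<ge>N. q (\<lambda>x. w m x - w n x) < e"
  shows "form_converges a D w u"
  unfolding form_converges_def
proof (intro conjI allI impI w u lim)
  fix e :: real assume "e > 0"
  then have "e / M > 0" using M_pos by simp
  from c[OF this] obtain N where N: "\<And>m n. m \<ge> N \<Longrightarrow> n \<ge> N \<Longrightarrow> q (\<lambda>x. w m x - w n x) < e / M" by blast
  have "norm (a (\<lambda>x. w m x - w n x) (\<lambda>x. w m x - w n x)) < e" if "m \<ge> N" "n \<ge> N" for m n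
  proof -
    have "norm (a (\<lambda>x. w m x - w n x) (\<lambda>x. w m x - w n x)) \<le> M * q (\<lambda>x. w m x - w n x)"
      by (intro sectorial D_diff w)
    also have "\<dots> < e" using N[OF that] M_pos by (simp add: field_simps)
    finally show ?thesis .
  qed
  then show "\<exists>N. \<forall>m\<ge>N. \<forall>n\<ge>N. norm (a (\<lambda>x. w m x - w n x) (\<lambda>x. w m x - w n x)) < e" by blast
qed

lemma form_converges_const: "v \<in> D \<Longrightarrow> form_converges a D (\<lambda>n. v) v"
proof (rule form_convergesI)
  have "a (\<lambda>x. 0) (\<lambda>x. 0) = 0" using a_cmult_left[OF D_zero D_zero, of 0] by simp
  then show "\<exists>N. \<forall>m\<ge>N. \<forall>n\<ge>N. q (\<lambda>x. v x - v x) < e" if "e > 0" for e using that by simp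
qed (auto simp: Lp_norm_def D_L2)

lemma form_converges_diff:
  assumes w: "form_converges a D w u" and x: "form_converges a D w' u"
  shows "form_converges a D (\<lambda>n y. w n y - w' n y) (\<lambda>y. 0)"
proof (rule form_convergesI)
  note D = form_converges_D[OF w] form_converges_D[OF x]
  show "(\<lambda>y. w n y - w' n y) \<in> D" for n by (intro D_diff D)
  have le: "Lp_dist 2 (w n) (w' n) \<le> Lp_dist 2 (w n) u + Lp_dist 2 (w' n) u" for n
    using Lp_norm_triangle_diff[OF D_L2[OF D(1)] form_converges_L2[OF w] D_L2[OF D(2)], of n n]
    by (simp add: Lp_dist_commute[of 2 u])
  have "(\<lambda>n. Lp_dist 2 (w n) u + Lp_dist 2 (w' n) u) \<longlonglongrightarrow> 0"
    using tendsto_add[OF form_converges_norm[OF w] form_converges_norm[OF x]] by simp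
  then show "(\<lambda>n. Lp_norm 2 (\<lambda>y. w n y - w' n y - 0)) \<longlonglongrightarrow> 0"
    by (rule tendsto_norm_le) (use le in simp)
  fix e :: real assume e: "e > 0"
  obtain N1 where N1: "\<And>m n. m \<ge> N1 \<Longrightarrow> n \<ge> N1 \<Longrightarrow> q (\<lambda>x. w m x - w n x) < e / 4"
    using form_converges_cauchy[OF w, of "e / 4"] e by auto
  obtain N2 where N2: "\<And>m n. m \<ge> N2 \<Longrightarrow> n \<ge> N2 \<Longrightarrow> q (\<lambda>x. w' m x - w' n x) < e / 4"
    using form_converges_cauchy[OF x, of "e / 4"] e by auto
  have "q (\<lambda>y. (w m y - w' m y) - (w n y - w' n y)) < e" if "m \<ge> max N1 N2" "n \<ge> max N1 N2" for m n
  proof -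
    have "(\<lambda>y. (w m y - w' m y) - (w n y - w' n y)) = (\<lambda>y. (w m y - w n y) - (w' m y - w' n y))"
      by (simp add: algebra_simps)
    then have "q (\<lambda>y. (w m y - w' m y) - (w n y - w' n y)) \<le> 2 * q (\<lambda>y. w m y - w n y) + 2 * q (\<lambda>y. w' m y - w' n y)"
      using q_diff_le[OF D_diff[OF D(1) D(1)] D_diff[OF D(2) D(2)], of m n m n] by simp
    then show ?thesis using N1[of m n] N2[of m n] that by simp
  qed
  then show "\<exists>N. \<forall>m\<ge>N. \<forall>n\<ge>N. q (\<lambda>y. (w m y - w' m y) - (w n y - w' n y)) < e" by blast
qed simp

lemma form_converges_bounded:
  assumes w: "form_converges a D w u"
  obtains K where "K \<ge> 0" "\<And>n. q (w n) \<le> K"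
proof -
  note D = form_converges_D[OF w]
  obtain N where N: "\<And>m n. m \<ge> N \<Longrightarrow> n \<ge> N \<Longrightarrow> q (\<lambda>x. w m x - w n x) < 1"
    using form_converges_cauchy[OF w, of 1] by auto
  define K where "K = 2 + 2 * (\<Sum>i\<le>N. q (w i))"
  have le: "q (w i) \<le> (\<Sum>i\<le>N. q (w i))" if "i \<le> N" for i
    using that by (intro member_le_sum q_nonneg D) auto
  have nn: "0 \<le> (\<Sum>i\<le>N. q (w i))" by (intro sum_nonneg q_nonneg D)
  have "q (w n) \<le> K" for n
  proof (cases "n \<le> N")
    case True
    then show ?thesis using le[of n] nn by (simp add: K_def)
  next
    case False
    then show ?thesis using q_le_diff[OF D D, of n N] N[of n N] le[of N] by (simp add: K_def)
  qed
  then show ?thesis using that[of K] nn by (simp add: K_def)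
qed

lemma small_product:
  assumes "0 < e" "0 \<le> K"
  obtains d where "0 < d" "\<And>s t. 0 \<le> s \<Longrightarrow> s < d \<Longrightarrow> 0 \<le> t \<Longrightarrow> t \<le> K \<Longrightarrow> 2 * M * sqrt (s * t) < e"
proof -
  \<comment> \<open>\<open>K + 1\<close> rather than \<open>K\<close> since \<open>K\<close> may be 0.\<close>
  define d where "d = (e / (2 * M))\<^sup>2 / (K + 1)"
  have d: "d > 0" using assms M_pos unfolding d_def by (intro divide_pos_pos zero_less_power) auto
  have "2 * M * sqrt (s * t) < e" if "0 \<le> s" "s < d" "0 \<le> t" "t \<le> K" for s t
  proof -
    have "s * t \<le> s * (K + 1)" using that by (intro mult_left_mono) auto
    also have "\<dots> < d * (K + 1)" using that assms by (intro mult_strict_right_mono) auto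
    also have "\<dots> = (e / (2 * M))\<^sup>2" unfolding d_def using assms by simp
    finally have "sqrt (s * t) < e / (2 * M)" using assms M_pos by (intro real_less_lsqrt) auto
    then show ?thesis using M_pos by (simp add: field_simps)
  qed
  then show ?thesis using d that by blast
qed

text \<open>
  Fix a late \<open>N\<close> and split \<open>q (w n)\<close> into \<open>a (w n - w N) (w n)\<close>, small because the sequence is form-Cauchy,
  and \<open>a (w N) (w n) = L2_inner f (w n)\<close>, which tends to 0 with \<open>w n\<close>.
\<close>

lemma form_closable:
  assumes w: "form_converges a D w (\<lambda>x. 0)"
  shows "(\<lambda>n. q (w n)) \<longlonglongrightarrow> 0"
proof (rule LIMSEQ_I)
  note D = form_converges_D[OF w]
  obtain K where K: "K \<ge> 0" "\<And>n. q (w n) \<le> K" using form_converges_bounded[OF w] by blast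
  fix e :: real assume e: "e > 0"
  obtain d where d: "0 < d" "\<And>s t. 0 \<le> s \<Longrightarrow> s < d \<Longrightarrow> 0 \<le> t \<Longrightarrow> t \<le> K \<Longrightarrow> 2 * M * sqrt (s * t) < e / 2"
    using small_product[of "e / 2" K] e K(1) by auto
  obtain N where N: "\<And>m n. m \<ge> N \<Longrightarrow> n \<ge> N \<Longrightarrow> q (\<lambda>x. w m x - w n x) < d"
    using form_converges_cauchy[OF w d(1)] by auto
  obtain f where f: "f \<in> Lp_space 2" "\<And>v. v \<in> D \<Longrightarrow> a (w N) v = L2_inner f v"
    using represented[OF D[of N]] by blast
  have "(\<lambda>n. L2_inner f (w n)) \<longlonglongrightarrow> L2_inner f (\<lambda>x. 0)"
    by (rule L2_inner_tendsto_right[OF f(1) D_L2[OF D] _ form_converges_norm[OF w]]) simp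
  then have "(\<lambda>n. norm (L2_inner f (w n))) \<longlonglongrightarrow> 0" by (simp add: L2_inner_def tendsto_norm_zero)
  then have "eventually (\<lambda>n. norm (L2_inner f (w n)) < e / 2) sequentially"
    using e by (intro order_tendstoD(2)) auto
  then obtain N' where N': "\<And>n. n \<ge> N' \<Longrightarrow> norm (L2_inner f (w n)) < e / 2" by (auto simp: eventually_sequentially)
  have "q (w n) < e" if n: "n \<ge> max N N'" for n
  proof -
    have "a (w n) (w n) = a (\<lambda>x. w n x - w N x) (w n) + L2_inner f (w n)"
      using D f(2)[OF D] by (simp add: a_diff_left)
    then have "q (w n) \<le> norm (a (\<lambda>x. w n x - w N x) (w n)) + norm (L2_inner f (w n))"
      by (metis complex_Re_le_cmod norm_triangle_ineq order_trans)
    also have "norm (a (\<lambda>x. w n x - w N x) (w n)) \<le> 2 * M * sqrt (q (\<lambda>x. w n x - w N x) * q (w n))"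
      by (intro form_bounded D_diff D)
    also have "\<dots> < e / 2" using N[of n N] n K(2) by (intro d(2) q_nonneg D_diff D) auto
    also have "e / 2 + norm (L2_inner f (w n)) < e" using N'[of n] n by simp
    finally show ?thesis by simp
  qed
  then show "\<exists>N. \<forall>n\<ge>N. norm (q (w n) - 0) < e"
    using q_nonneg[OF D] by (intro exI[of _ "max N N'"]) auto
qed

lemma form_product_tendsto_zero:
  assumes w: "\<And>n. w n \<in> D" "(\<lambda>n. q (w n)) \<longlonglongrightarrow> 0" and v: "\<And>n. v n \<in> D" "\<And>n. q (v n) \<le> K"
  shows "(\<lambda>n. a (w n) (v n)) \<longlonglongrightarrow> 0" and "(\<lambda>n. a (v n) (w n)) \<longlonglongrightarrow> 0"
proof -
  have l: "(\<lambda>n. 2 * M * sqrt (q (w n) * K)) \<longlonglongrightarrow> 0"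
    using tendsto_mult[OF tendsto_const[of "2 * M"] tendsto_real_sqrt[OF tendsto_mult[OF w(2) tendsto_const[of K]]]] by simp
  have *: "norm (a (w n) (v n)) \<le> 2 * M * sqrt (q (w n) * K) \<and> norm (a (v n) (w n)) \<le> 2 * M * sqrt (q (w n) * K)" for n
  proof -
    have "sqrt (q (w n) * q (v n)) \<le> sqrt (q (w n) * K)" using v w q_nonneg by (simp add: mult_left_mono)
    then have "2 * M * sqrt (q (w n) * q (v n)) \<le> 2 * M * sqrt (q (w n) * K)" using M_pos by simp
    then show ?thesis using form_bounded[OF w(1) v(1), of n n] form_bounded[OF v(1) w(1), of n n]
      by (simp add: mult.commute[of "q (v n)"])
  qed
  show "(\<lambda>n. a (w n) (v n)) \<longlonglongrightarrow> 0" by (rule tendsto_norm_le[OF l]) (use * in simp)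
  show "(\<lambda>n. a (v n) (w n)) \<longlonglongrightarrow> 0" by (rule tendsto_norm_le[OF l]) (use * in simp)
qed

lemma form_convergent:
  assumes w: "form_converges a D w u" and v: "form_converges a D w' v"
  shows "convergent (\<lambda>n. a (w n) (w' n))"
proof -
  note D = form_converges_D[OF w] form_converges_D[OF v]
  obtain K where K: "K \<ge> 0" "\<And>n. q (w n) \<le> K" using form_converges_bounded[OF w] by blast
  obtain L where L: "L \<ge> 0" "\<And>n. q (w' n) \<le> L" using form_converges_bounded[OF v] by blast
  have "Cauchy (\<lambda>n. a (w n) (w' n))"
  proof (rule metric_CauchyI)
    fix e :: real assume e: "e > 0"
    obtain d where d: "0 < d" "\<And>s t. 0 \<le> s \<Longrightarrow> s < d \<Longrightarrow> 0 \<le> t \<Longrightarrow> t \<le> K + L \<Longrightarrow> 2 * M * sqrt (s * t) < e / 2"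
      using small_product[of "e / 2" "K + L"] e K(1) L(1) by auto
    obtain N1 where N1: "\<And>m n. m \<ge> N1 \<Longrightarrow> n \<ge> N1 \<Longrightarrow> q (\<lambda>x. w m x - w n x) < d"
      using form_converges_cauchy[OF w d(1)] by auto
    obtain N2 where N2: "\<And>m n. m \<ge> N2 \<Longrightarrow> n \<ge> N2 \<Longrightarrow> q (\<lambda>x. w' m x - w' n x) < d"
      using form_converges_cauchy[OF v d(1)] by auto
    have "dist (a (w m) (w' m)) (a (w n) (w' n)) < e" if mn: "m \<ge> max N1 N2" "n \<ge> max N1 N2" for m n
    proof -
      have "a (w m) (w' m) - a (w n) (w' n) = a (\<lambda>x. w m x - w n x) (w' m) + a (w n) (\<lambda>x. w' m x - w' n x)"
        using D by (simp add: a_diff_left a_diff_right)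
      then have "dist (a (w m) (w' m)) (a (w n) (w' n)) \<le> norm (a (\<lambda>x. w m x - w n x) (w' m)) + norm (a (w n) (\<lambda>x. w' m x - w' n x))"
        by (simp add: dist_norm norm_triangle_ineq)
      also have "norm (a (\<lambda>x. w m x - w n x) (w' m)) \<le> 2 * M * sqrt (q (\<lambda>x. w m x - w n x) * q (w' m))"
        by (intro form_bounded D_diff D)
      also have "\<dots> < e / 2" using N1[of m n] mn K L(2)[of m] by (intro d(2) q_nonneg D_diff D) auto
      also have "norm (a (w n) (\<lambda>x. w' m x - w' n x)) \<le> 2 * M * sqrt (q (\<lambda>x. w' m x - w' n x) * q (w n))"
        using form_bounded[OF D(1) D_diff[OF D(2) D(2)], of n m n] by (simp add: mult.commute)
      also have "\<dots> < e / 2" using N2[of m n] mn L K(2)[of n] by (intro d(2) q_nonneg D_diff D) auto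
      finally show ?thesis by simp
    qed
    then show "\<exists>N. \<forall>m\<ge>N. \<forall>n\<ge>N. dist (a (w m) (w' m)) (a (w n) (w' n)) < e" by blast
  qed
  then show ?thesis by (simp add: Cauchy_convergent_iff)
qed

text \<open>
  Two approximations of the same function differ by a null sequence, which is small in form norm by
  closability; hence the limit does not depend on the approximations and the definite description is meaningful.
\<close>

lemma closure_form_tendsto:
  assumes w: "form_converges a D w u" and v: "form_converges a D w' v"
  shows "(\<lambda>n. a (w n) (w' n)) \<longlonglongrightarrow> closure_form a D u v"
proof -
  obtain z where z: "(\<lambda>n. a (w n) (w' n)) \<longlonglongrightarrow> z" using form_convergent[OF w v] by (auto simp: convergent_def)
  have indep: "(\<lambda>n. a (x n) (x' n)) \<longlonglongrightarrow> z" if x: "form_converges a D x u" and x': "form_converges a D x' v" for x x'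
  proof -
    note D = form_converges_D[OF w] form_converges_D[OF v] form_converges_D[OF x] form_converges_D[OF x']
    obtain K where K: "\<And>n. q (w n) \<le> K" using form_converges_bounded[OF w] by blast
    obtain L where L: "\<And>n. q (x' n) \<le> L" using form_converges_bounded[OF x'] by blast
    have 1: "(\<lambda>n. a (\<lambda>y. x n y - w n y) (x' n)) \<longlonglongrightarrow> 0"
      by (intro form_product_tendsto_zero(1)[OF _ form_closable[OF form_converges_diff[OF x w]] _ L] D_diff D)
    have 2: "(\<lambda>n. a (w n) (\<lambda>y. x' n y - w' n y)) \<longlonglongrightarrow> 0"
      by (intro form_product_tendsto_zero(2)[OF _ form_closable[OF form_converges_diff[OF x' v]] _ K] D_diff D)
    have "(\<lambda>n. a (\<lambda>y. x n y - w n y) (x' n) + a (w n) (\<lambda>y. x' n y - w' n y) + a (w n) (w' n)) \<longlonglongrightarrow> 0 + 0 + z"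
      by (intro tendsto_add 1 2 z)
    then show ?thesis using D by (simp add: a_diff_left a_diff_right)
  qed
  have "closure_form a D u v = z"
    unfolding closure_form_def
  proof (rule the_equality)
    show "\<forall>w w'. form_converges a D w u \<longrightarrow> form_converges a D w' v \<longrightarrow> (\<lambda>n. a (w n) (w' n)) \<longlonglongrightarrow> z"
      using indep by blast
  next
    fix z' assume "\<forall>w w'. form_converges a D w u \<longrightarrow> form_converges a D w' v \<longrightarrow> (\<lambda>n. a (w n) (w' n)) \<longlonglongrightarrow> z'"
    then have "(\<lambda>n. a (w n) (w' n)) \<longlonglongrightarrow> z'" using w v by blast
    then show "z' = z" using z LIMSEQ_unique by blast
  qed
  then show ?thesis using z by simp
qed

lemma form_operator_core:
  assumes u: "u \<in> D"
  shows "\<exists>f. (u, f) \<in> form_operator (closure_form a D) (closure_dom a D)"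
proof -
  obtain f where f: "f \<in> Lp_space 2" "\<And>v. v \<in> D \<Longrightarrow> a u v = L2_inner f v"
    using represented[OF u] by blast
  have "closure_form a D u v = L2_inner f v" if v: "v \<in> closure_dom a D" for v
  proof -
    obtain w where w: "form_converges a D w v" using v by (auto simp: closure_dom_def)
    have "(\<lambda>n. a u (w n)) \<longlonglongrightarrow> closure_form a D u v"
      by (rule closure_form_tendsto[OF form_converges_const[OF u] w])
    moreover have "(\<lambda>n. a u (w n)) \<longlonglongrightarrow> L2_inner f v"
      using L2_inner_tendsto_right[OF f(1) D_L2[OF form_converges_D[OF w]] form_converges_L2[OF w] form_converges_norm[OF w]]
      by (simp add: f(2)[OF form_converges_D[OF w]])
    ultimately show ?thesis by (rule LIMSEQ_unique)
  qed
  moreover have "u \<in> closure_dom a D" using form_converges_const[OF u] by (auto simp: closure_dom_def)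
  ultimately show ?thesis using f(1) by (auto simp: form_operator_def)
qed

text \<open>
  This transfers inequalities from \<open>D\<close> to the operator when the second argument depends nonlinearly on the
  first: the \<open>v n\<close> are only bounded in form norm, yet \<open>a (w m) (v n)\<close> is close to
  \<open>a (w n) (v n)\<close> as soon as \<open>m\<close> and \<open>n\<close> are large.
\<close>

lemma form_operator_pairing:
  assumes uf: "(u, f) \<in> form_operator (closure_form a D) (closure_dom a D)"
    and w: "form_converges a D w u"
    and v: "\<And>n. v n \<in> D" "\<And>n. q (v n) \<le> K" and vl: "g \<in> Lp_space 2" "Lp_tendsto 2 v g"
  shows "(\<lambda>n. a (w n) (v n)) \<longlonglongrightarrow> L2_inner f g"
proof -
  note D = form_converges_D[OF w]
  have f: "f \<in> Lp_space 2" and b: "\<And>x. x \<in> closure_dom a D \<Longrightarrow> closure_form a D u x = L2_inner f x"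
    using uf by (auto simp: form_operator_def)
  have K: "0 \<le> K" using q_nonneg[OF v(1)] v(2) order_trans by blast
  have "v n \<in> closure_dom a D" for n
    using form_converges_const[OF v(1)] by (auto simp: closure_dom_def)
  then have av: "(\<lambda>m. a (w m) (v n)) \<longlonglongrightarrow> L2_inner f (v n)" for n
    using closure_form_tendsto[OF w form_converges_const[OF v(1)], of n] b[of "v n"] by simp
  have "(\<lambda>n. a (w n) (v n) - L2_inner f (v n)) \<longlonglongrightarrow> 0"
  proof (rule LIMSEQ_I)
    fix e :: real assume e: "e > 0"
    obtain d where d: "0 < d" "\<And>s t. 0 \<le> s \<Longrightarrow> s < d \<Longrightarrow> 0 \<le> t \<Longrightarrow> t \<le> K \<Longrightarrow> 2 * M * sqrt (s * t) < e / 2"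
      using small_product[of "e / 2" K] e K by auto
    obtain N where N: "\<And>m n. m \<ge> N \<Longrightarrow> n \<ge> N \<Longrightarrow> q (\<lambda>x. w m x - w n x) < d"
      using form_converges_cauchy[OF w d(1)] by auto
    have "norm (a (w n) (v n) - L2_inner f (v n)) \<le> e / 2" if n: "n \<ge> N" for n
    proof (rule LIMSEQ_le_const2)
      show "(\<lambda>m. norm (a (w n) (v n) - a (w m) (v n))) \<longlonglongrightarrow> norm (a (w n) (v n) - L2_inner f (v n))"
        by (intro tendsto_intros av)
      have "norm (a (w n) (v n) - a (w m) (v n)) \<le> e / 2" if m: "m \<ge> N" for m
      proof -
        have "norm (a (w n) (v n) - a (w m) (v n)) = norm (a (\<lambda>x. w n x - w m x) (v n))"
          using D v by (simp add: a_diff_left)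
        also have "\<dots> \<le> 2 * M * sqrt (q (\<lambda>x. w n x - w m x) * q (v n))"
          by (intro form_bounded D_diff D v)
        also have "\<dots> < e / 2" using N[OF n m] v by (intro d(2) q_nonneg D_diff D) auto
        finally show ?thesis by simp
      qed
      then show "\<exists>N. \<forall>m\<ge>N. norm (a (w n) (v n) - a (w m) (v n)) \<le> e / 2" by blast
    qed
    then show "\<exists>N. \<forall>n\<ge>N. norm (a (w n) (v n) - L2_inner f (v n) - 0) < e"
      using e by (intro exI[of _ N]) force
  qed
  then have "(\<lambda>n. (a (w n) (v n) - L2_inner f (v n)) + L2_inner f (v n)) \<longlonglongrightarrow> 0 + L2_inner f g"
    by (intro tendsto_add L2_inner_tendsto_right[OF f D_L2[OF v(1)] vl])
  then show ?thesis by simp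
qed

end

section \<open>The elliptic form on test functions\<close>

definition hform :: "complex^'n^'n \<Rightarrow> ('n \<Rightarrow> complex) \<Rightarrow> ('n \<Rightarrow> complex) \<Rightarrow> complex" where
  "hform A \<xi> \<eta> = (\<Sum>k\<in>UNIV. \<Sum>l\<in>UNIV. A $ k $ l * \<xi> k * cnj (\<eta> l))"

abbreviation grad :: "(real^'n \<Rightarrow> complex) \<Rightarrow> real^'n \<Rightarrow> 'n \<Rightarrow> complex" where
  "grad u x \<equiv> (\<lambda>k. partial_deriv k u x)"

lemma hform_add_left: "hform A (\<lambda>k. \<xi> k + \<xi>' k) \<eta> = hform A \<xi> \<eta> + hform A \<xi>' \<eta>"
  by (simp add: hform_def sum.distrib[symmetric] algebra_simps)

lemma hform_add_right: "hform A \<xi> (\<lambda>k. \<eta> k + \<eta>' k) = hform A \<xi> \<eta> + hform A \<xi> \<eta>'"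
  by (simp add: hform_def sum.distrib[symmetric] algebra_simps)

lemma hform_cmult_left: "hform A (\<lambda>k. c * \<xi> k) \<eta> = c * hform A \<xi> \<eta>"
  by (simp add: hform_def sum_distrib_left mult_ac)

lemma hform_cmult_right: "hform A \<xi> (\<lambda>k. c * \<eta> k) = cnj c * hform A \<xi> \<eta>"
  by (simp add: hform_def sum_distrib_left mult_ac)

lemma sectorD:
  assumes z: "z \<in> sector \<theta>" and \<theta>: "0 \<le> \<theta>" "\<theta> < pi / 2"
  shows "0 \<le> Re z" and "norm z \<le> 1 / cos \<theta> * Re z" and "\<bar>Im z\<bar> \<le> tan \<theta> * Re z"
proof -
  obtain r \<psi> where z_eq: "z = of_real r * cis \<psi>" and r: "0 \<le> r" and \<psi>: "\<bar>\<psi>\<bar> \<le> \<theta>"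
    using z by (auto simp: sector_def)
  have c: "0 < cos \<theta>" using \<theta> by (intro cos_gt_zero_pi) auto
  have cc: "cos \<theta> \<le> cos \<psi>" using cos_monotone_0_pi_le[of "\<bar>\<psi>\<bar>" \<theta>] \<psi> \<theta> by simp
  have Re: "Re z = r * cos \<psi>" and Im: "Im z = r * sin \<psi>" by (auto simp: z_eq)
  show "0 \<le> Re z" using r c cc by (simp add: Re)
  have nz: "norm z = r" using r by (simp add: z_eq norm_mult)
  have "r * cos \<theta> \<le> r * cos \<psi>" using r cc by (rule mult_left_mono[rotated])
  then show "norm z \<le> 1 / cos \<theta> * Re z" using c by (simp add: nz Re field_simps)
  have "0 \<le> sin (\<theta> - \<bar>\<psi>\<bar>)" using \<psi> \<theta> by (intro sin_ge_zero) auto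
  then have "sin \<bar>\<psi>\<bar> * cos \<theta> \<le> sin \<theta> * cos \<psi>" by (simp add: sin_diff mult.commute)
  moreover have "\<bar>sin \<psi>\<bar> = sin \<bar>\<psi>\<bar>" using \<psi> \<theta> sin_ge_zero[of "\<bar>\<psi>\<bar>"] by (cases "\<psi> \<ge> 0") auto
  ultimately have "\<bar>sin \<psi>\<bar> \<le> tan \<theta> * cos \<psi>" using c by (simp add: tan_def field_simps)
  then have "r * \<bar>sin \<psi>\<bar> \<le> r * (tan \<theta> * cos \<psi>)" using r by (rule mult_left_mono)
  then show "\<bar>Im z\<bar> \<le> tan \<theta> * Re z" using r by (simp add: Re Im abs_mult mult_ac)
qed

locale elliptic_coefficients =
  fixes \<theta> :: real and C :: "real^'n \<Rightarrow> complex^'n^'n"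
  assumes \<theta>_nonneg: "0 \<le> \<theta>" and \<theta>_less: "\<theta> < pi / 2"
    and coeff_sobolev: "(\<lambda>x. C x $ k $ l) \<in> sobolev_inf 1"
    and coeff_sector: "cvec_inner (C x *v \<xi>) \<xi> \<in> sector \<theta>"
begin

lemma cos_\<theta>: "0 < cos \<theta>"
  using \<theta>_nonneg \<theta>_less by (intro cos_gt_zero_pi) auto

lemma coeff_Linf: "(\<lambda>x. C x $ k $ l) \<in> Linf_space"
  using coeff_sobolev by (simp add: sobolev_inf_def)

lemma coeff_weak_deriv: "\<exists>g\<in>Linf_space. weak_deriv [j] (\<lambda>x. C x $ k $ l) g"
  using coeff_sobolev[of k l] by (simp add: sobolev_inf_def)

text \<open>
  The form pairs \<open>c\<^sub>k\<^sub>l\<close> with \<open>\<xi> k\<close> and \<open>cnj (\<xi> l)\<close>, which is the transpose of the convention in \<open>cvec_inner\<close>;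
  replacing the vector by its conjugate exchanges the two.
\<close>

lemma hform_sector: "hform (C x) \<xi> \<xi> \<in> sector \<theta>"
proof -
  have "hform (C x) \<xi> \<xi> = cvec_inner (C x *v (\<chi> k. cnj (\<xi> k))) (\<chi> k. cnj (\<xi> k))"
    unfolding hform_def cvec_inner_def matrix_vector_mult_def
    by (simp add: sum_distrib_right sum_distrib_left) (rule sum.cong, auto intro!: sum.cong simp: mult_ac)
  then show ?thesis using coeff_sector by simp
qed

lemma elliptic_form_eq:
  assumes u: "u \<in> test_functions" and v: "v \<in> test_functions"
  shows "integrable lebesgue (\<lambda>x. hform (C x) (grad u x) (grad v x))"
    and "elliptic_form C u v = (LINT x|lebesgue. hform (C x) (grad u x) (grad v x))"
proof -
  have p: "partial_deriv l (\<lambda>y. cnj (v y)) x = cnj (partial_deriv l v x)" for l x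
    by (rule partial_deriv_cnj[OF test_function_smooth[OF v]])
  have i: "integrable lebesgue (\<lambda>x. C x $ k $ l * partial_deriv k u x * cnj (partial_deriv l v x))" for k l
  proof -
    have "(\<lambda>x. cnj (partial_deriv l v x) * partial_deriv k u x) \<in> test_functions"
      by (intro test_functions_mult partial_deriv_test u smooth_cnj test_function_smooth v)
    from Linf_mult_test_integrable[OF coeff_Linf[of k l] this] show ?thesis by (simp add: mult_ac)
  qed
  show "integrable lebesgue (\<lambda>x. hform (C x) (grad u x) (grad v x))"
    unfolding hform_def by (intro Bochner_Integration.integrable_sum i)
  show "elliptic_form C u v = (LINT x|lebesgue. hform (C x) (grad u x) (grad v x))"
    unfolding elliptic_form_def hform_def p by (simp add: i)
qed

text \<open>
  Integration by parts: the weak derivative of a coefficient is tested against \<open>\<partial>\<^sub>k u cnj v\<close>, itself a test function.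
\<close>

lemma elliptic_form_represented:
  assumes u: "u \<in> test_functions"
  shows "\<exists>f\<in>Lp_space 2. \<forall>v\<in>test_functions. elliptic_form C u v = L2_inner f v"
proof -
  define g where "g k l = (SOME g. g \<in> Linf_space \<and> weak_deriv [l] (\<lambda>x. C x $ k $ l) g)" for k l
  have "g k l \<in> Linf_space \<and> weak_deriv [l] (\<lambda>x. C x $ k $ l) (g k l)" for k l
  proof -
    have "\<exists>g. g \<in> Linf_space \<and> weak_deriv [l] (\<lambda>x. C x $ k $ l) g" using coeff_weak_deriv[of l k l] by blast
    from someI_ex[OF this] show ?thesis by (simp only: g_def)
  qed
  then have g: "\<And>k l. g k l \<in> Linf_space" "\<And>k l. weak_deriv [l] (\<lambda>x. C x $ k $ l) (g k l)"
    by blast+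
  let ?h = "\<lambda>k l x. - (g k l x * partial_deriv k u x + C x $ k $ l * partial_deriv l (partial_deriv k u) x)"
  have h: "?h k l \<in> Lp_space 2" for k l
    by (intro Lp_space_uminus Lp_space_add Linf_mult_Lp g coeff_Linf test_function_Lp partial_deriv_test u) auto
  have eq: "(LINT x|lebesgue. C x $ k $ l * partial_deriv k u x * partial_deriv l (\<lambda>y. cnj (v y)) x) = L2_inner (?h k l) v"
    if v: "v \<in> test_functions" for k l v
  proof -
    let ?w = "\<lambda>x. cnj (v x)"
    have sm: "smooth ?w" "smooth (partial_deriv k u)"
      using v u by (auto intro: smooth_cnj test_function_smooth smooth_partial_deriv)
    have \<phi>: "(\<lambda>x. ?w x * partial_deriv k u x) \<in> test_functions" by (intro test_functions_mult partial_deriv_test u sm)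
    have i1: "integrable lebesgue (\<lambda>x. C x $ k $ l * (partial_deriv l ?w x * partial_deriv k u x))"
      by (intro Linf_mult_test_integrable coeff_Linf test_functions_mult partial_deriv_test u smooth_partial_deriv sm)
    have i2: "integrable lebesgue (\<lambda>x. C x $ k $ l * (?w x * partial_deriv l (partial_deriv k u) x))"
      by (intro Linf_mult_test_integrable coeff_Linf test_functions_mult partial_deriv_test u sm)
    have i3: "integrable lebesgue (\<lambda>x. g k l x * (?w x * partial_deriv k u x))"
      by (intro Linf_mult_test_integrable g \<phi>)
    have "(LINT x|lebesgue. C x $ k $ l * partial_deriv l (\<lambda>x. ?w x * partial_deriv k u x) x)
        = - (LINT x|lebesgue. g k l x * (?w x * partial_deriv k u x))"
      using g(2)[of l k] \<phi> unfolding weak_deriv_def by (simp add: iter_partial_deriv_def)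
    moreover have "(LINT x|lebesgue. C x $ k $ l * partial_deriv l (\<lambda>x. ?w x * partial_deriv k u x) x)
       = (LINT x|lebesgue. C x $ k $ l * (partial_deriv l ?w x * partial_deriv k u x))
         + (LINT x|lebesgue. C x $ k $ l * (?w x * partial_deriv l (partial_deriv k u) x))"
      unfolding partial_deriv_mult[OF sm] Bochner_Integration.integral_add[OF i1 i2, symmetric]
      by (rule Bochner_Integration.integral_cong) (auto simp: algebra_simps)
    ultimately have "(LINT x|lebesgue. C x $ k $ l * (partial_deriv l ?w x * partial_deriv k u x))
       = - (LINT x|lebesgue. g k l x * (?w x * partial_deriv k u x))
         - (LINT x|lebesgue. C x $ k $ l * (?w x * partial_deriv l (partial_deriv k u) x))"
      by (simp add: algebra_simps)
    also have "\<dots> = - (LINT x|lebesgue. g k l x * (?w x * partial_deriv k u x) + C x $ k $ l * (?w x * partial_deriv l (partial_deriv k u) x))"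
      by (simp add: i2 i3)
    also have "\<dots> = L2_inner (?h k l) v"
      unfolding L2_inner_def Bochner_Integration.integral_minus[symmetric]
      by (rule Bochner_Integration.integral_cong) (auto simp: algebra_simps)
    finally show ?thesis by (simp add: mult_ac)
  qed
  let ?f = "\<lambda>x. \<Sum>k\<in>UNIV. \<Sum>l\<in>UNIV. ?h k l x"
  have sum_L2: "(\<lambda>x. \<Sum>i\<in>I. F i x) \<in> Lp_space 2" if "finite I" "\<And>i. F i \<in> Lp_space 2" for I :: "'n set" and F
    using that by (induction I rule: finite_induct) (auto intro: Lp_space_add)
  have "?f \<in> Lp_space 2" by (intro sum_L2 h) auto
  moreover have "elliptic_form C u v = L2_inner ?f v" if v: "v \<in> test_functions" for v
  proof -
    have int: "integrable lebesgue (\<lambda>x. ?h k l x * cnj (v x))" for k l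
      by (intro L2_inner_integrable h test_function_Lp v) simp
    have "elliptic_form C u v = (\<Sum>k\<in>UNIV. \<Sum>l\<in>UNIV. L2_inner (?h k l) v)"
      unfolding elliptic_form_def by (simp only: eq[OF v])
    also have "\<dots> = L2_inner ?f v"
      unfolding L2_inner_def sum_distrib_right
      by (simp only: Bochner_Integration.integral_sum Bochner_Integration.integrable_sum int)
    finally show ?thesis .
  qed
  ultimately show ?thesis by blast
qed

lemma sectorial_form_elliptic: "sectorial_form test_functions (elliptic_form C) (1 / cos \<theta>)"
proof
  show "(\<lambda>x. 0) \<in> test_functions" by (simp add: test_functions_iff smooth_const)
  show "0 < 1 / cos \<theta>" using cos_\<theta> by simp
  fix u :: "real^'n \<Rightarrow> complex" assume u: "u \<in> test_functions"
  show "u \<in> Lp_space 2" by (rule test_function_Lp[OF u]) simp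
  show "(\<lambda>x. c * u x) \<in> test_functions" for c by (rule test_functions_cmult[OF u])
  show "\<exists>f\<in>Lp_space 2. \<forall>v\<in>test_functions. elliptic_form C u v = L2_inner f v"
    by (rule elliptic_form_represented[OF u])
  note i = elliptic_form_eq(1)[OF u u]
  have "norm (elliptic_form C u u) \<le> (LINT x|lebesgue. norm (hform (C x) (grad u x) (grad u x)))"
    unfolding elliptic_form_eq(2)[OF u u] by (rule integral_norm_bound)
  also have "\<dots> \<le> (LINT x|lebesgue. 1 / cos \<theta> * Re (hform (C x) (grad u x) (grad u x)))"
    using i sectorD(2)[OF hform_sector \<theta>_nonneg \<theta>_less] by (intro integral_mono) auto
  also have "\<dots> = 1 / cos \<theta> * Re (elliptic_form C u u)"
    unfolding elliptic_form_eq(2)[OF u u] using i by simp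
  finally show "norm (elliptic_form C u u) \<le> 1 / cos \<theta> * Re (elliptic_form C u u)" .
  fix v :: "real^'n \<Rightarrow> complex" assume v: "v \<in> test_functions"
  show "(\<lambda>x. u x + v x) \<in> test_functions" by (rule test_functions_add[OF u v])
  note us = test_function_smooth[OF u] and vs = test_function_smooth[OF v]
  show "elliptic_form C (\<lambda>x. c * u x) v = c * elliptic_form C u v" for c
    unfolding elliptic_form_eq(2)[OF u v] elliptic_form_eq(2)[OF test_functions_cmult[OF u] v]
    by (simp add: partial_deriv_cmult[OF us] hform_cmult_left)
  show "elliptic_form C u (\<lambda>x. c * v x) = cnj c * elliptic_form C u v" for c
    unfolding elliptic_form_eq(2)[OF u v] elliptic_form_eq(2)[OF u test_functions_cmult[OF v]]
    by (simp add: partial_deriv_cmult[OF vs] hform_cmult_right)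
  fix w :: "real^'n \<Rightarrow> complex" assume w: "w \<in> test_functions"
  note ws = test_function_smooth[OF w]
  show "elliptic_form C (\<lambda>x. u x + v x) w = elliptic_form C u w + elliptic_form C v w"
    unfolding elliptic_form_eq(2)[OF u w] elliptic_form_eq(2)[OF v w] elliptic_form_eq(2)[OF test_functions_add[OF u v] w]
    by (simp add: partial_deriv_add[OF us vs] hform_add_left elliptic_form_eq(1)[OF u w] elliptic_form_eq(1)[OF v w])
  show "elliptic_form C u (\<lambda>x. v x + w x) = elliptic_form C u v + elliptic_form C u w"
    unfolding elliptic_form_eq(2)[OF u v] elliptic_form_eq(2)[OF u w] elliptic_form_eq(2)[OF u test_functions_add[OF v w]]
    by (simp add: partial_deriv_add[OF vs ws] hform_add_right elliptic_form_eq(1)[OF u v] elliptic_form_eq(1)[OF u w])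
qed

end

section \<open>Accretivity along the regularised duality map\<close>

definition bil :: "('n::finite \<Rightarrow> 'n \<Rightarrow> real) \<Rightarrow> ('n \<Rightarrow> real) \<Rightarrow> ('n \<Rightarrow> real) \<Rightarrow> real" where
  "bil A a b = (\<Sum>k\<in>UNIV. \<Sum>l\<in>UNIV. A k l * a k * b l)"

lemma bil_expand: "bil A (\<lambda>k. a k + c * b k) (\<lambda>k. a k + c * b k) = bil A a a + c * bil A a b + c * bil A b a + c\<^sup>2 * bil A b b"
  by (simp add: bil_def sum.distrib[symmetric] sum_distrib_left algebra_simps power2_eq_square)

lemma bil_scale: "bil A (\<lambda>k. c * a k) (\<lambda>k. d * b k) = c * d * bil A a b"
  by (simp add: bil_def sum_distrib_left mult_ac)

lemma bil_symmetric: assumes "\<And>k l. A k l = A l k" shows "bil A a b = bil A b a"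
proof -
  have "bil A a b = (\<Sum>l\<in>UNIV. \<Sum>k\<in>UNIV. A k l * a k * b l)" unfolding bil_def by (rule sum.swap)
  also have "\<dots> = bil A b a" unfolding bil_def by (intro sum.cong refl) (simp add: assms mult_ac)
  finally show ?thesis .
qed

text \<open>
  The imaginary part of the matrix contributes \<open>- \<alpha> B[b,a] + \<beta> B[a,b]\<close>, which symmetry combines into a single
  term that vanishes for \<open>\<alpha> = \<beta>\<close>.  The case \<open>\<alpha> = \<beta> = 1\<close> shows that on the diagonal the real part is
  \<open>R[a,a] + R[b,b]\<close>.
\<close>

lemma Re_hform_frame:
  assumes sym: "\<And>k l. Im (A $ k $ l) = Im (A $ l $ k)" and \<omega>: "norm \<omega> = 1"
  shows "Re (hform A (\<lambda>k. \<omega> * Complex (a k) (b k)) (\<lambda>k. \<omega> * Complex (\<alpha> * a k) (\<beta> * b k))) =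
     \<alpha> * bil (\<lambda>k l. Re (A $ k $ l)) a a + \<beta> * bil (\<lambda>k l. Re (A $ k $ l)) b b - (\<alpha> - \<beta>) * bil (\<lambda>k l. Im (A $ k $ l)) a b"
proof -
  have "hform A (\<lambda>k. \<omega> * Complex (a k) (b k)) (\<lambda>k. \<omega> * Complex (\<alpha> * a k) (\<beta> * b k))
      = \<omega> * cnj \<omega> * hform A (\<lambda>k. Complex (a k) (b k)) (\<lambda>k. Complex (\<alpha> * a k) (\<beta> * b k))"
    by (simp add: hform_cmult_left hform_cmult_right)
  also have "\<omega> * cnj \<omega> = 1" using complex_norm_square[of \<omega>] \<omega> by simp
  finally have "Re (hform A (\<lambda>k. \<omega> * Complex (a k) (b k)) (\<lambda>k. \<omega> * Complex (\<alpha> * a k) (\<beta> * b k)))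
     = (\<Sum>k\<in>UNIV. \<Sum>l\<in>UNIV. Re (A $ k $ l * Complex (a k) (b k) * cnj (Complex (\<alpha> * a l) (\<beta> * b l))))"
    by (simp only: hform_def Re_sum mult_1)
  also have "\<dots> = (\<Sum>k\<in>UNIV. \<Sum>l\<in>UNIV. \<alpha> * (Re (A $ k $ l) * a k * a l) + \<beta> * (Re (A $ k $ l) * b k * b l)
      - (\<alpha> * (Im (A $ k $ l) * b k * a l) - \<beta> * (Im (A $ k $ l) * a k * b l)))"
    by (intro sum.cong refl) (simp add: algebra_simps)
  also have "\<dots> = \<alpha> * bil (\<lambda>k l. Re (A $ k $ l)) a a + \<beta> * bil (\<lambda>k l. Re (A $ k $ l)) b b
     - (\<alpha> * bil (\<lambda>k l. Im (A $ k $ l)) b a - \<beta> * bil (\<lambda>k l. Im (A $ k $ l)) a b)"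
    by (simp add: bil_def sum.distrib sum_subtractf sum_distrib_left)
  also have "bil (\<lambda>k l. Im (A $ k $ l)) b a = bil (\<lambda>k l. Im (A $ k $ l)) a b" by (rule bil_symmetric[OF sym])
  finally show ?thesis by (simp add: algebra_simps)
qed

lemma phase_exists: obtains \<omega> where "norm \<omega> = 1" "z = of_real (norm z) * (\<omega>::complex)"
proof (cases "z = 0")
  case True
  then show ?thesis using that[of 1] by simp
next
  case False
  then show ?thesis using that[of "z / of_real (norm z)"] by (simp add: norm_divide)
qed

lemma frame_components:
  fixes \<omega> h :: complex assumes "norm \<omega> = 1"
  shows "h = \<omega> * Complex (Re (cnj \<omega> * h)) (Im (cnj \<omega> * h))"
proof -
  have "\<omega> * cnj \<omega> = 1" using complex_norm_square[of \<omega>] assms by simp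
  then have "h = \<omega> * (cnj \<omega> * h)" by (simp add: mult.assoc[symmetric])
  then show ?thesis by (simp add: complex_eq_iff)
qed

locale elliptic_symmetric = elliptic_coefficients +
  assumes Im_symmetric: "Im (C x $ k $ l) = Im (C x $ l $ k)"
begin

abbreviation Rf where "Rf x \<equiv> bil (\<lambda>k l. Re (C x $ k $ l))"
abbreviation Bf where "Bf x \<equiv> bil (\<lambda>k l. Im (C x $ k $ l))"

lemma tan_nonneg: "0 \<le> tan \<theta>"
  using \<theta>_nonneg \<theta>_less cos_\<theta> by (simp add: tan_def sin_ge_zero)

lemma real_sector: "0 \<le> Rf x a a" "\<bar>Bf x a a\<bar> \<le> tan \<theta> * Rf x a a"
proof -
  have "hform (C x) (\<lambda>k. of_real (a k)) (\<lambda>k. of_real (a k)) \<in> sector \<theta>" by (rule hform_sector)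
  moreover have "Re (hform (C x) (\<lambda>k. of_real (a k)) (\<lambda>k. of_real (a k))) = Rf x a a"
    "Im (hform (C x) (\<lambda>k. of_real (a k)) (\<lambda>k. of_real (a k))) = Bf x a a"
    by (simp_all add: hform_def bil_def)
  ultimately show "0 \<le> Rf x a a" "\<bar>Bf x a a\<bar> \<le> tan \<theta> * Rf x a a"
    using sectorD[OF _ \<theta>_nonneg \<theta>_less] by metis+
qed

text \<open>
  The sector condition on real vectors bounds the quadratic form of \<open>B\<close> by \<open>tan \<theta>\<close> times that of \<open>R\<close>;
  polarisation, which needs the symmetry of \<open>B\<close>, extends this to the bilinear form.
\<close>

lemma imaginary_Cauchy_Schwarz: "\<bar>Bf x a b\<bar> \<le> tan \<theta> * sqrt (Rf x a a * Rf x b b)"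
proof -
  have *: "2 * \<bar>Bf x a b\<bar> \<le> tan \<theta> * (Rf x a a + Rf x b b)" for a b
  proof -
    let ?p = "\<lambda>k. a k + 1 * b k" and ?m = "\<lambda>k. a k + (-1) * b k"
    have "4 * Bf x a b = Bf x ?p ?p - Bf x ?m ?m"
      unfolding bil_expand using bil_symmetric[of "\<lambda>k l. Im (C x $ k $ l)" a b] Im_symmetric by simp
    then have "4 * \<bar>Bf x a b\<bar> \<le> \<bar>Bf x ?p ?p\<bar> + \<bar>Bf x ?m ?m\<bar>" by linarith
    also have "\<dots> \<le> tan \<theta> * Rf x ?p ?p + tan \<theta> * Rf x ?m ?m" by (intro add_mono real_sector)
    also have "\<dots> = tan \<theta> * (2 * (Rf x a a + Rf x b b))" unfolding bil_expand by (simp add: algebra_simps)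
    finally show ?thesis by (simp only: mult.left_commute[of "tan \<theta>" 2])
  qed
  have "2 * \<bar>Bf x a b\<bar> \<le> 2 * sqrt ((tan \<theta> * Rf x a a) * (tan \<theta> * Rf x b b))"
  proof (rule young_optimize)
    fix s :: real assume s: "s > 0"
    define r where "r = sqrt s"
    have r: "r > 0" "r * r = s" using s by (auto simp: r_def)
    have "Bf x a b = Bf x (\<lambda>k. r * a k) (\<lambda>k. 1 / r * b k)" unfolding bil_scale using r by simp
    then have "2 * \<bar>Bf x a b\<bar> \<le> tan \<theta> * (Rf x (\<lambda>k. r * a k) (\<lambda>k. r * a k) + Rf x (\<lambda>k. 1 / r * b k) (\<lambda>k. 1 / r * b k))"
      using *[of "\<lambda>k. r * a k" "\<lambda>k. 1 / r * b k"] by simp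
    also have "\<dots> = s * (tan \<theta> * Rf x a a) + tan \<theta> * Rf x b b / s"
      unfolding bil_scale using r by (simp add: algebra_simps)
    finally show "2 * \<bar>Bf x a b\<bar> \<le> s * (tan \<theta> * Rf x a a) + tan \<theta> * Rf x b b / s" .
  qed (use tan_nonneg real_sector in auto)
  moreover have "sqrt ((tan \<theta> * Rf x a a) * (tan \<theta> * Rf x b b)) = tan \<theta> * sqrt (Rf x a a * Rf x b b)"
    using tan_nonneg real_sqrt_mult[of "(tan \<theta>)\<^sup>2" "Rf x a a * Rf x b b"] by (simp add: power2_eq_square mult_ac)
  ultimately show ?thesis by simp
qed

text \<open>
  A quadratic form in \<open>X = \<surd>(\<alpha> R[a,a])\<close> and \<open>Y = \<surd>(\<beta> R[b,b])\<close>: the assumption bounds the mixed term by \<open>2 X Y\<close>.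
\<close>

lemma frame_accretive:
  assumes "0 \<le> \<alpha>" "0 \<le> \<beta>" and adm: "(\<alpha> - \<beta>)\<^sup>2 * (tan \<theta>)\<^sup>2 \<le> 4 * \<alpha> * \<beta>"
  shows "0 \<le> \<alpha> * Rf x a a + \<beta> * Rf x b b - (\<alpha> - \<beta>) * Bf x a b"
proof -
  define X Y where "X = sqrt (\<alpha> * Rf x a a)" and "Y = sqrt (\<beta> * Rf x b b)"
  have sq: "X\<^sup>2 = \<alpha> * Rf x a a" "Y\<^sup>2 = \<beta> * Rf x b b" using assms real_sector by (auto simp: X_def Y_def)
  have t: "\<bar>\<alpha> - \<beta>\<bar> * tan \<theta> \<le> 2 * sqrt (\<alpha> * \<beta>)"
  proof -
    have "\<bar>\<alpha> - \<beta>\<bar> * tan \<theta> = sqrt ((\<alpha> - \<beta>)\<^sup>2 * (tan \<theta>)\<^sup>2)" using tan_nonneg by (simp add: real_sqrt_mult)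
    also have "\<dots> \<le> sqrt (2\<^sup>2 * (\<alpha> * \<beta>))" using adm by (intro real_sqrt_le_mono) simp
    also have "\<dots> = 2 * sqrt (\<alpha> * \<beta>)" unfolding real_sqrt_mult by simp
    finally show ?thesis .
  qed
  have "(\<alpha> - \<beta>) * Bf x a b \<le> \<bar>\<alpha> - \<beta>\<bar> * \<bar>Bf x a b\<bar>" by (metis abs_ge_self abs_mult)
  also have "\<dots> \<le> \<bar>\<alpha> - \<beta>\<bar> * (tan \<theta> * sqrt (Rf x a a * Rf x b b))"
    by (intro mult_left_mono imaginary_Cauchy_Schwarz) simp
  also have "\<dots> = (\<bar>\<alpha> - \<beta>\<bar> * tan \<theta>) * sqrt (Rf x a a * Rf x b b)" by simp
  also have "\<dots> \<le> 2 * sqrt (\<alpha> * \<beta>) * sqrt (Rf x a a * Rf x b b)"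
    using t real_sector by (intro mult_right_mono) auto
  also have "\<dots> = 2 * X * Y" by (simp add: X_def Y_def real_sqrt_mult mult_ac)
  also have "\<dots> \<le> X\<^sup>2 + Y\<^sup>2" by (rule sum_squares_bound)
  finally show ?thesis using sq by simp
qed

end

text \<open>
  For \<open>s > 0\<close> and \<open>e \<rightarrow> 0\<close> this tends to \<open>s powr m\<close>.  The base stays between \<open>e\<close> and \<open>1 / e\<close>, so that the weight
  neither degenerates nor blows up at 0 and at infinity.
\<close>

definition reg_power :: "real \<Rightarrow> real \<Rightarrow> real \<Rightarrow> real" where
  "reg_power m e s = ((e + s) / (1 + e * s)) powr m"

text \<open>
  For \<open>\<psi> = reg_power m e\<close> one has \<open>s \<psi>' s = m \<tau> \<psi> s\<close> with this \<open>\<tau>\<close>.  For \<open>e = 0\<close>, the pure power, it equals 1; and taking values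
  in \<open>[0, 1]\<close> is what keeps \<open>\<alpha> / \<beta>\<close> between 1 and \<open>p - 1\<close>.
\<close>

definition reg_ratio :: "real \<Rightarrow> real \<Rightarrow> real" where
  "reg_ratio e s = s * (1 - e\<^sup>2) / ((e + s) * (1 + e * s))"

lemma reg_ratio_bounds:
  assumes "0 < e" "e < 1" "0 \<le> s"
  shows "0 \<le> reg_ratio e s" "reg_ratio e s \<le> 1"
proof -
  have e2: "e\<^sup>2 \<le> 1" using assms by (simp add: power_le_one)
  have pos: "0 < (e + s) * (1 + e * s)" using assms by (intro mult_pos_pos) (auto intro: add_pos_nonneg)
  show "0 \<le> reg_ratio e s" unfolding reg_ratio_def using assms e2 pos by (intro divide_nonneg_pos mult_nonneg_nonneg) auto
  have "s * (1 - e\<^sup>2) \<le> s * 1" using assms by (intro mult_left_mono) auto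
  also have "\<dots> \<le> (e + s) * (1 + e * s)" using assms by (simp add: algebra_simps)
  finally show "reg_ratio e s \<le> 1" unfolding reg_ratio_def using pos by (simp add: divide_le_eq_1)
qed

lemma reg_power_pos: "0 < e \<Longrightarrow> 0 \<le> s \<Longrightarrow> 0 < reg_power m e s"
  using add_pos_nonneg[of 1 "e * s"] add_pos_nonneg[of e s] by (simp add: reg_power_def)

lemma reg_power_bound:
  assumes e: "0 < e" "e < 1" and s: "0 \<le> s"
  shows "reg_power m e s \<le> e powr (- \<bar>m\<bar>)"
proof -
  let ?x = "(e + s) / (1 + e * s)"
  have d: "0 < 1 + e * s" using e s by (simp add: add_pos_nonneg)
  have e2: "e * e \<le> 1" using e by (simp add: mult_le_one)
  have l: "e \<le> ?x"
  proof -
    have "e * (e * s) \<le> s" using mult_right_mono[OF e2 s] by (simp add: mult.assoc)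
    then show ?thesis using d by (simp add: le_divide_eq algebra_simps)
  qed
  have u: "?x \<le> 1 / e"
  proof -
    have "(e + s) * e \<le> 1 + e * s" using e2 by (simp add: algebra_simps)
    then show ?thesis using d e by (simp add: divide_le_eq le_divide_eq field_simps)
  qed
  show ?thesis
  proof (cases "m \<ge> 0")
    case True
    have "?x powr m \<le> (1 / e) powr m" using True l u e by (intro powr_mono2) auto
    then show ?thesis using True e by (simp add: reg_power_def powr_divide powr_minus_divide)
  next
    case False
    have "?x powr m \<le> e powr m" using False l e by (intro powr_mono2') auto
    then show ?thesis using False by (simp add: reg_power_def)
  qed
qed

lemma reg_power_has_derivative:
  assumes e: "0 < e" and s: "0 \<le> s"
  shows "(reg_power m e has_real_derivative (m * reg_power m e s * (1 - e\<^sup>2) / ((e + s) * (1 + e * s)))) (at s)"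
proof -
  have d: "0 < 1 + e * s" "0 < e + s" using e s by (auto simp: add_pos_nonneg)
  have q: "((\<lambda>s. (e + s) / (1 + e * s)) has_real_derivative ((1 - e\<^sup>2) / (1 + e * s)\<^sup>2)) (at s)"
    using d by (auto intro!: derivative_eq_intros simp: power2_eq_square field_simps)
  have "((\<lambda>s. ((e + s) / (1 + e * s)) powr m) has_real_derivative
      (m * ((e + s) / (1 + e * s)) powr (m - 1)) * ((1 - e\<^sup>2) / (1 + e * s)\<^sup>2)) (at s)"
    by (rule DERIV_chain2[OF has_real_derivative_powr q]) (use d in simp)
  moreover have "(m * ((e + s) / (1 + e * s)) powr (m - 1)) * ((1 - e\<^sup>2) / (1 + e * s)\<^sup>2)
      = m * reg_power m e s * (1 - e\<^sup>2) / ((e + s) * (1 + e * s))"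
  proof -
    have "((e + s) / (1 + e * s)) powr (m - 1) = reg_power m e s / ((e + s) / (1 + e * s))"
      using d by (simp add: reg_power_def powr_diff)
    then show ?thesis using d by (simp add: power2_eq_square)
  qed
  ultimately show ?thesis unfolding reg_power_def[abs_def] by simp
qed

text \<open>
  With \<open>\<rho> = 1 + (p - 2) \<tau>\<close> the condition \<open>(\<rho> - 1)\<^sup>2 t\<^sup>2 \<le> 4 \<rho>\<close> holds for \<open>\<tau> = 0\<close> and, by assumption, for
  \<open>\<tau> = 1\<close>.  The solutions \<open>\<rho>\<close> form an interval; concretely \<open>(p - 1) \<tau>\<^sup>2 \<le> \<rho>\<close>, since the difference factors as
  \<open>(1 - \<tau>) (1 + (p - 1) \<tau>)\<close>.
\<close>

lemma ratio_admissible: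
  fixes p t \<tau> :: real
  assumes p: "1 < p" and adm: "(p - 2)\<^sup>2 * t\<^sup>2 \<le> 4 * (p - 1)" and \<tau>: "0 \<le> \<tau>" "\<tau> \<le> 1"
  shows "((p - 2) * \<tau>)\<^sup>2 * t\<^sup>2 \<le> 4 * (1 + (p - 2) * \<tau>)"
proof -
  have "((p - 2) * \<tau>)\<^sup>2 * t\<^sup>2 = \<tau>\<^sup>2 * ((p - 2)\<^sup>2 * t\<^sup>2)" by (simp add: power_mult_distrib)
  also have "\<dots> \<le> \<tau>\<^sup>2 * (4 * (p - 1))" using adm by (rule mult_left_mono) simp
  also have "\<dots> \<le> 4 * (1 + (p - 2) * \<tau>)"
  proof -
    have "0 \<le> (1 - \<tau>) * (1 + (p - 1) * \<tau>)" using p \<tau> by (intro mult_nonneg_nonneg add_nonneg_nonneg) auto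
    also have "\<dots> = 1 + (p - 2) * \<tau> - (p - 1) * \<tau>\<^sup>2" by (simp add: algebra_simps power2_eq_square)
    finally show ?thesis by (simp add: algebra_simps)
  qed
  finally show ?thesis .
qed

text \<open>
  Squaring gives \<open>(p - 2)\<^sup>2 \<le> p\<^sup>2 cos\<^sup>2 \<theta>\<close>, that is \<open>p\<^sup>2 sin\<^sup>2 \<theta> \<le> 4 (p - 1)\<close>.
\<close>

lemma angle_condition:
  fixes p \<theta> :: real
  assumes p: "1 < p" and \<theta>: "0 \<le> \<theta>" "\<theta> < pi / 2" and le: "\<bar>1 - 2 / p\<bar> \<le> cos \<theta>"
  shows "(p - 2)\<^sup>2 * (tan \<theta>)\<^sup>2 \<le> 4 * (p - 1)"
proof -
  have c: "0 < cos \<theta>" using \<theta> by (intro cos_gt_zero_pi) auto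
  have eq: "1 - 2 / p = (p - 2) / p" using p by (simp add: field_simps)
  have "\<bar>(p - 2) / p\<bar>\<^sup>2 \<le> (cos \<theta>)\<^sup>2" using le unfolding eq by (intro power_mono) auto
  then have A: "(p - 2)\<^sup>2 \<le> (cos \<theta>)\<^sup>2 * p\<^sup>2" using p by (simp add: power_divide divide_le_eq)
  have s: "(sin \<theta>)\<^sup>2 = 1 - (cos \<theta>)\<^sup>2" using sin_cos_squared_add[of \<theta>] by linarith
  have "(p - 2)\<^sup>2 * (tan \<theta>)\<^sup>2 \<le> (cos \<theta>)\<^sup>2 * p\<^sup>2 * (tan \<theta>)\<^sup>2" using A by (rule mult_right_mono) simp
  also have "\<dots> = p\<^sup>2 * (cos \<theta> * tan \<theta>)\<^sup>2" by (simp add: power_mult_distrib)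
  also have "cos \<theta> * tan \<theta> = sin \<theta>" using c by (simp add: tan_def)
  also have "p\<^sup>2 * (sin \<theta>)\<^sup>2 = p\<^sup>2 - (cos \<theta>)\<^sup>2 * p\<^sup>2" unfolding s by (simp add: algebra_simps)
  also have "\<dots> \<le> p\<^sup>2 - (p - 2)\<^sup>2" using A by simp
  also have "\<dots> = 4 * (p - 1)" by (simp add: power2_eq_square algebra_simps)
  finally show ?thesis .
qed

definition reg_map :: "real \<Rightarrow> real \<Rightarrow> complex \<Rightarrow> complex" where
  "reg_map m e z = of_real (reg_power m e ((norm z)\<^sup>2)) * z"

text \<open>
  The derivative of \<open>r \<mapsto> r \<psi>(r\<^sup>2)\<close> at \<open>r\<^sup>2 = s\<close> for \<open>\<psi> = reg_power m e\<close>, that is \<open>\<psi> s + 2 s \<psi>' s\<close>.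
\<close>

definition reg_slope :: "real \<Rightarrow> real \<Rightarrow> real \<Rightarrow> real" where
  "reg_slope m e s = reg_power m e s * (1 + 2 * m * reg_ratio e s)"

text \<open>
  Relative to the phase \<open>\<omega>\<close> of \<open>z\<close> the derivative is diagonal: it stretches the radial component by \<open>reg_slope\<close>
  and the angular one by \<open>reg_power\<close>.
\<close>

lemma reg_map_has_derivative:
  assumes e: "0 < e" and \<omega>: "norm \<omega> = 1" "z = of_real (norm z) * \<omega>"
  shows "(reg_map m e has_derivative
     (\<lambda>h. \<omega> * Complex (reg_slope m e ((norm z)\<^sup>2) * Re (cnj \<omega> * h)) (reg_power m e ((norm z)\<^sup>2) * Im (cnj \<omega> * h)))) (at z)"
proof -
  let ?s = "(norm z)\<^sup>2"
  let ?\<psi>' = "m * reg_power m e ?s * (1 - e\<^sup>2) / ((e + ?s) * (1 + e * ?s))"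
  have n: "((\<lambda>z::complex. (norm z)\<^sup>2) has_derivative (\<lambda>h. 2 * (norm z * Re (cnj \<omega> * h)))) (at z)"
  proof -
    have "((\<lambda>z::complex. z \<bullet> z) has_derivative (\<lambda>h. z \<bullet> h + h \<bullet> z)) (at z)"
      by (intro has_derivative_inner has_derivative_ident)
    moreover have "z \<bullet> h = norm z * Re (cnj \<omega> * h)" for h
      by (subst \<omega>(2)) (simp add: inner_complex_def algebra_simps)
    ultimately show ?thesis by (simp add: power2_norm_eq_inner inner_commute[of _ z])
  qed
  have r: "((\<lambda>z. reg_power m e ((norm z)\<^sup>2)) has_derivative (\<lambda>h. 2 * (norm z * Re (cnj \<omega> * h)) * ?\<psi>')) (at z)"
    by (rule DERIV_compose_FDERIV[OF reg_power_has_derivative[OF e] n]) simp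
  have "(reg_map m e has_derivative
      (\<lambda>h. of_real (reg_power m e ?s) * h + of_real (2 * (norm z * Re (cnj \<omega> * h)) * ?\<psi>') * z)) (at z)"
    unfolding reg_map_def[abs_def] by (intro has_derivative_mult has_derivative_of_real r has_derivative_ident)
  moreover have "of_real (reg_power m e ?s) * h + of_real (2 * (norm z * Re (cnj \<omega> * h)) * ?\<psi>') * z
      = \<omega> * Complex (reg_slope m e ?s * Re (cnj \<omega> * h)) (reg_power m e ?s * Im (cnj \<omega> * h))" for h
  proof -
    define a b where "a = Re (cnj \<omega> * h)" and "b = Im (cnj \<omega> * h)"
    have h: "h = \<omega> * Complex a b" using frame_components[OF \<omega>(1), of h] by (simp add: a_def b_def)
    have sl: "reg_slope m e ?s = reg_power m e ?s + 2 * ?s * ?\<psi>'"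
      by (simp add: reg_slope_def reg_ratio_def algebra_simps)
    have z': "of_real (2 * (norm z * a) * ?\<psi>') * z = \<omega> * of_real (2 * ?s * ?\<psi>' * a)"
      by (subst (3) \<omega>(2)) (simp add: power2_eq_square mult_ac)
    have "of_real (reg_power m e ?s) * h + of_real (2 * (norm z * a) * ?\<psi>') * z
        = \<omega> * (of_real (reg_power m e ?s) * Complex a b + of_real (2 * ?s * ?\<psi>' * a))"
      unfolding z' by (subst h) (simp add: algebra_simps)
    also have "of_real (reg_power m e ?s) * Complex a b + of_real (2 * ?s * ?\<psi>' * a)
        = Complex (reg_slope m e ?s * a) (reg_power m e ?s * b)"
      unfolding sl by (simp add: complex_eq_iff algebra_simps)
    finally show ?thesis unfolding a_def b_def .
  qed
  ultimately show ?thesis by simp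
qed

locale power_regularisation =
  fixes p e :: real
  assumes p: "1 < p" and e: "0 < e" "e < 1"
begin

definition m :: real where "m = (p - 2) / 2"

text \<open>
  A common bound of the weight and of its slope, hence a Lipschitz constant of the regularised duality map.
\<close>

definition K :: real where "K = p * e powr (- \<bar>m\<bar>)"

lemma two_m: "2 * m = p - 2" by (simp add: m_def)

lemma K_pos: "0 < K" using p e by (simp add: K_def)

lemma slope_factor: assumes "0 \<le> s" shows "0 \<le> 1 + 2 * m * reg_ratio e s" "1 + 2 * m * reg_ratio e s \<le> p"
proof -
  note r = reg_ratio_bounds[OF e assms]
  have eq: "1 + 2 * m * reg_ratio e s = (1 - reg_ratio e s) + (p - 1) * reg_ratio e s"
    unfolding two_m by (simp add: algebra_simps)
  show "0 \<le> 1 + 2 * m * reg_ratio e s" unfolding eq using r p by simp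
  have "(p - 1) * reg_ratio e s \<le> (p - 1) * 1" using r p by (intro mult_left_mono) auto
  then show "1 + 2 * m * reg_ratio e s \<le> p" unfolding eq using r by simp
qed

lemma power_bounds:
  assumes "0 \<le> s"
  shows "0 \<le> reg_power m e s" "reg_power m e s \<le> K" "0 \<le> reg_slope m e s" "reg_slope m e s \<le> K"
proof -
  have b: "reg_power m e s \<le> e powr (- \<bar>m\<bar>)" by (rule reg_power_bound[OF e assms])
  show 0: "0 \<le> reg_power m e s" using reg_power_pos[OF e(1) assms] by (rule less_imp_le)
  have "1 * e powr (- \<bar>m\<bar>) \<le> p * e powr (- \<bar>m\<bar>)" using p by (intro mult_right_mono) auto
  then show "reg_power m e s \<le> K" using b by (simp add: K_def)
  show "0 \<le> reg_slope m e s" unfolding reg_slope_def by (intro mult_nonneg_nonneg 0 slope_factor assms)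
  have "reg_slope m e s \<le> e powr (- \<bar>m\<bar>) * p"
    unfolding reg_slope_def by (intro mult_mono b slope_factor assms) auto
  then show "reg_slope m e s \<le> K" by (simp add: K_def mult.commute)
qed

abbreviation F where "F \<equiv> reg_map m e"

lemma F_zero [simp]: "F 0 = 0" by (simp add: reg_map_def)

lemma F_lipschitz: "norm (F z - F w) \<le> K * norm (z - w)"
proof (rule differentiable_bound[of UNIV F "\<lambda>z. frechet_derivative F (at z)" K z w])
  fix x :: complex
  obtain \<omega> where \<omega>: "norm \<omega> = 1" "x = of_real (norm x) * \<omega>" by (rule phase_exists)
  note d = reg_map_has_derivative[OF e(1) \<omega>, of m]
  show "(F has_derivative frechet_derivative F (at x)) (at x within UNIV)"
    using d frechet_derivative_at[OF d] by simp
  show "onorm (frechet_derivative F (at x)) \<le> K"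
  proof (rule onorm_bound)
    fix h :: complex
    let ?a = "Re (cnj \<omega> * h)" and ?b = "Im (cnj \<omega> * h)" and ?s = "(norm x)\<^sup>2"
    have "norm (frechet_derivative F (at x) h) = norm (Complex (reg_slope m e ?s * ?a) (reg_power m e ?s * ?b))"
      unfolding frechet_derivative_at[OF d, symmetric] using \<omega>(1) by (simp add: norm_mult)
    also have "\<dots> = sqrt ((reg_slope m e ?s * ?a)\<^sup>2 + (reg_power m e ?s * ?b)\<^sup>2)" by (simp add: cmod_def)
    also have "\<dots> \<le> sqrt ((K * ?a)\<^sup>2 + (K * ?b)\<^sup>2)"
      unfolding power_mult_distrib
      by (intro real_sqrt_le_mono add_mono mult_right_mono power_mono power_bounds) auto
    also have "\<dots> = K * norm (cnj \<omega> * h)"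
    proof -
      have "sqrt ((K * x)\<^sup>2 + (K * y)\<^sup>2) = K * sqrt (x\<^sup>2 + y\<^sup>2)" for x y
        using K_pos real_sqrt_mult[of "K\<^sup>2" "x\<^sup>2 + y\<^sup>2"] by (simp add: power_mult_distrib distrib_left)
      then show ?thesis by (simp only: cmod_def)
    qed
    also have "norm (cnj \<omega> * h) = norm h" using \<omega>(1) by (simp add: norm_mult)
    finally show "norm (frechet_derivative F (at x) h) \<le> K * norm h" .
  qed (use K_pos in simp)
qed auto

lemma F_bound: "norm (F z) \<le> K * norm z"
  using F_lipschitz[of z 0] by simp

lemma F_continuous: "continuous_on A F"
proof (rule continuous_at_imp_continuous_on, rule ballI)
  fix x :: complex
  obtain \<omega> where "norm \<omega> = 1" "x = of_real (norm x) * \<omega>" by (rule phase_exists)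
  from reg_map_has_derivative[OF e(1) this] show "isCont F x" by (rule has_derivative_continuous)
qed

lemma F_measurable [measurable]: "F \<in> borel_measurable borel"
  by (intro borel_measurable_continuous_onI F_continuous)

text \<open>
  On values of \<open>\<bar>u\<bar>\<^sup>2\<close> the regularised power is a product of real powers of positive smooth functions.
\<close>

lemma F_smooth:
  assumes u: "smooth u" shows "smooth (\<lambda>x. F (u x))"
proof -
  let ?w = "\<lambda>x. of_real (Re (of_real e + u x * cnj (u x)) powr m) * of_real (Re (1 + of_real e * (u x * cnj (u x))) powr (- m)) * u x"
  have Re: "Re (of_real e + u x * cnj (u x)) = e + (norm (u x))\<^sup>2"
    "Re (1 + of_real e * (u x * cnj (u x))) = 1 + e * (norm (u x))\<^sup>2" for x
    unfolding complex_norm_square[symmetric] by simp_all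
  have "0 < e + (norm (u x))\<^sup>2" "0 < 1 + e * (norm (u x))\<^sup>2" for x
    using e by (auto intro!: add_pos_nonneg)
  then have "smooth ?w"
    by (intro smooth_mult smooth_powr smooth_add smooth_cnj smooth_const u) (simp_all only: Re)
  also have "?w = (\<lambda>x. F (u x))"
  proof
    fix x
    have "(e + (norm (u x))\<^sup>2) powr m * (1 + e * (norm (u x))\<^sup>2) powr (- m) = reg_power m e ((norm (u x))\<^sup>2)"
      using e by (simp add: reg_power_def powr_divide powr_minus_divide)
    then show "?w x = F (u x)"
      unfolding reg_map_def Re of_real_mult[symmetric] by simp
  qed
  finally show ?thesis .
qed

lemma F_test: "u \<in> test_functions \<Longrightarrow> (\<lambda>x. F (u x)) \<in> test_functions"
  by (rule test_functions_subset_support[of u]) (auto intro: F_smooth test_function_smooth)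

lemma F_L2:
  assumes "f \<in> Lp_space 2" shows "(\<lambda>x. F (f x)) \<in> Lp_space 2"
proof (rule Lp_space_dominated[OF assms, of _ K])
  show "(\<lambda>x. F (f x)) \<in> borel_measurable lebesgue" using measurable_Lp[OF assms] by measurable
qed (auto simp: F_bound)

lemma F_L2_lipschitz:
  assumes f: "f \<in> Lp_space 2" and g: "g \<in> Lp_space 2"
  shows "Lp_norm 2 (\<lambda>x. F (f x) - F (g x)) \<le> K * Lp_dist 2 f g"
proof -
  have "Lp_norm 2 (\<lambda>x. F (f x) - F (g x)) \<le> Lp_norm 2 (\<lambda>x. of_real K * (f x - g x))"
    by (rule Lp_norm_mono[OF Lp_space_cmult[OF Lp_space_diff[OF f g]] _ measurable_Lp[OF Lp_space_diff[OF F_L2[OF f] F_L2[OF g]]]])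
       (use F_lipschitz K_pos in \<open>auto simp: norm_mult\<close>)
  also have "\<dots> = K * Lp_dist 2 f g" using Lp_norm_cmult[of 2 "of_real K" "\<lambda>x. f x - g x"] K_pos by simp
  finally show ?thesis .
qed

end

locale elliptic_regularisation = elliptic_symmetric + power_regularisation +
  assumes angle: "\<bar>1 - 2 / p\<bar> \<le> cos \<theta>"
begin

lemma F_gradient_frame:
  assumes u: "u \<in> test_functions"
  obtains \<omega> a b where "norm \<omega> = 1" "grad u x = (\<lambda>k. \<omega> * Complex (a k) (b k))"
    "grad (\<lambda>x. F (u x)) x = (\<lambda>k. \<omega> * Complex (reg_slope m e ((norm (u x))\<^sup>2) * a k) (reg_power m e ((norm (u x))\<^sup>2) * b k))"
proof -
  obtain \<omega> where \<omega>: "norm \<omega> = 1" "u x = of_real (norm (u x)) * \<omega>" by (rule phase_exists)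
  note d = has_derivative_compose[OF has_derivative_frechet[OF smooth_differentiable[OF test_function_smooth[OF u]]]
      reg_map_has_derivative[OF e(1) \<omega>, of m]]
  show ?thesis
  proof (rule that[OF \<omega>(1), of "\<lambda>k. Re (cnj \<omega> * partial_deriv k u x)" "\<lambda>k. Im (cnj \<omega> * partial_deriv k u x)"])
    show "grad u x = (\<lambda>k. \<omega> * Complex (Re (cnj \<omega> * partial_deriv k u x)) (Im (cnj \<omega> * partial_deriv k u x)))"
      by (rule ext) (rule frame_components[OF \<omega>(1)])
    show "grad (\<lambda>x. F (u x)) x = (\<lambda>k. \<omega> * Complex (reg_slope m e ((norm (u x))\<^sup>2) * Re (cnj \<omega> * partial_deriv k u x))
       (reg_power m e ((norm (u x))\<^sup>2) * Im (cnj \<omega> * partial_deriv k u x)))"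
      by (rule ext, subst partial_deriv_eq[OF d]) (simp add: partial_deriv_def)
  qed
qed

lemma form_F_accretive:
  assumes u: "u \<in> test_functions"
  shows "0 \<le> Re (elliptic_form C u (\<lambda>x. F (u x)))"
proof -
  note Fu = F_test[OF u]
  have "0 \<le> Re (hform (C x) (grad u x) (grad (\<lambda>x. F (u x)) x))" for x
  proof -
    obtain \<omega> a b where \<omega>: "norm \<omega> = 1" and g: "grad u x = (\<lambda>k. \<omega> * Complex (a k) (b k))"
      "grad (\<lambda>x. F (u x)) x = (\<lambda>k. \<omega> * Complex (reg_slope m e ((norm (u x))\<^sup>2) * a k) (reg_power m e ((norm (u x))\<^sup>2) * b k))"
      by (rule F_gradient_frame[OF u])
    let ?s = "(norm (u x))\<^sup>2"
    let ?\<psi> = "reg_power m e ?s" and ?\<tau> = "reg_ratio e ?s"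
    have s: "0 \<le> ?s" by simp
    have "reg_slope m e ?s - ?\<psi> = ?\<psi> * ((p - 2) * ?\<tau>)"
      unfolding reg_slope_def two_m by (simp add: algebra_simps)
    then have "(reg_slope m e ?s - ?\<psi>)\<^sup>2 * (tan \<theta>)\<^sup>2 = ?\<psi>\<^sup>2 * (((p - 2) * ?\<tau>)\<^sup>2 * (tan \<theta>)\<^sup>2)"
      by (simp only: power_mult_distrib mult.assoc)
    also have "\<dots> \<le> ?\<psi>\<^sup>2 * (4 * (1 + (p - 2) * ?\<tau>))"
      by (intro mult_left_mono ratio_admissible p angle_condition[OF p \<theta>_nonneg \<theta>_less angle] reg_ratio_bounds[OF e s]) simp
    also have "\<dots> = 4 * reg_slope m e ?s * ?\<psi>"
      unfolding reg_slope_def two_m by (simp add: power2_eq_square)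
    finally have adm: "(reg_slope m e ?s - ?\<psi>)\<^sup>2 * (tan \<theta>)\<^sup>2 \<le> 4 * reg_slope m e ?s * ?\<psi>" .
    show ?thesis unfolding g Re_hform_frame[OF Im_symmetric \<omega>]
      by (rule frame_accretive[OF power_bounds(3)[OF s] power_bounds(1)[OF s] adm])
  qed
  then show ?thesis
    unfolding elliptic_form_eq(2)[OF u Fu] integral_Re[OF elliptic_form_eq(1)[OF u Fu], symmetric]
    by (intro Bochner_Integration.integral_nonneg) auto
qed

text \<open>
  On the diagonal \<open>\<alpha>\<close> and \<open>\<beta>\<close> enter only through \<open>\<alpha>\<^sup>2 R[a,a] + \<beta>\<^sup>2 R[b,b]\<close>, and both are at most \<open>K\<close>.
\<close>

lemma form_F_bounded:
  assumes u: "u \<in> test_functions"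
  shows "Re (elliptic_form C (\<lambda>x. F (u x)) (\<lambda>x. F (u x))) \<le> K\<^sup>2 * Re (elliptic_form C u u)"
proof -
  note Fu = F_test[OF u]
  have le: "Re (hform (C x) (grad (\<lambda>x. F (u x)) x) (grad (\<lambda>x. F (u x)) x)) \<le> K\<^sup>2 * Re (hform (C x) (grad u x) (grad u x))" for x
  proof -
    obtain \<omega> a b where \<omega>: "norm \<omega> = 1" and g: "grad u x = (\<lambda>k. \<omega> * Complex (a k) (b k))"
      "grad (\<lambda>x. F (u x)) x = (\<lambda>k. \<omega> * Complex (reg_slope m e ((norm (u x))\<^sup>2) * a k) (reg_power m e ((norm (u x))\<^sup>2) * b k))"
      by (rule F_gradient_frame[OF u])
    let ?s = "(norm (u x))\<^sup>2"
    have s: "0 \<le> ?s" by simp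
    have diag: "Re (hform (C x) (\<lambda>k. \<omega> * Complex (a k) (b k)) (\<lambda>k. \<omega> * Complex (a k) (b k))) = Rf x a a + Rf x b b" for a b
      using Re_hform_frame[OF Im_symmetric \<omega>, of x a b 1 1] by simp
    have "(reg_slope m e ?s)\<^sup>2 * Rf x a a + (reg_power m e ?s)\<^sup>2 * Rf x b b \<le> K\<^sup>2 * Rf x a a + K\<^sup>2 * Rf x b b"
      by (intro add_mono mult_right_mono power_mono power_bounds s real_sector)
    then show ?thesis unfolding g diag bil_scale by (simp add: power2_eq_square algebra_simps)
  qed
  note i = elliptic_form_eq(1)[OF u u] elliptic_form_eq(1)[OF Fu Fu]
  have "(LINT x|lebesgue. Re (hform (C x) (grad (\<lambda>x. F (u x)) x) (grad (\<lambda>x. F (u x)) x))) \<le> (LINT x|lebesgue. K\<^sup>2 * Re (hform (C x) (grad u x) (grad u x)))"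
    using i le by (intro integral_mono) auto
  then show ?thesis
    unfolding elliptic_form_eq(2)[OF u u] elliptic_form_eq(2)[OF Fu Fu] using i by simp
qed

text \<open>
  The images \<open>F (w n)\<close> of an approximating sequence converge in \<open>L\<^sub>2\<close> since \<open>F\<close> is Lipschitz, and are bounded in
  form norm; so the inequality for test functions survives the limit.
\<close>

lemma operator_F_accretive:
  assumes uf: "(u, f) \<in> elliptic_operator C"
  shows "0 \<le> Re (L2_inner f (\<lambda>x. F (u x)))"
proof -
  interpret form: sectorial_form test_functions "elliptic_form C" "1 / cos \<theta>" by (rule sectorial_form_elliptic)
  have "u \<in> closure_dom (elliptic_form C) test_functions" using uf by (auto simp: elliptic_operator_def form_operator_def)
  then obtain w where w: "form_converges (elliptic_form C) test_functions w u" by (auto simp: closure_dom_def)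
  note D = form.form_converges_D[OF w] and uL = form.form_converges_L2[OF w]
  obtain L where L: "\<And>n. Re (elliptic_form C (w n) (w n)) \<le> L" using form.form_converges_bounded[OF w] by blast
  have qL: "Re (elliptic_form C (\<lambda>x. F (w n x)) (\<lambda>x. F (w n x))) \<le> K\<^sup>2 * L" for n
    by (rule order_trans[OF form_F_bounded[OF D] mult_left_mono[OF L]]) simp
  have lim: "(\<lambda>n. Lp_norm 2 (\<lambda>x. F (w n x) - F (u x))) \<longlonglongrightarrow> 0"
    by (rule tendsto_norm_le[OF tendsto_mult_right_zero[OF form.form_converges_norm[OF w], of K]])
       (use F_L2_lipschitz[OF form.D_L2[OF D] uL] in simp)
  have "(\<lambda>n. elliptic_form C (w n) (\<lambda>x. F (w n x))) \<longlonglongrightarrow> L2_inner f (\<lambda>x. F (u x))"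
    using uf unfolding elliptic_operator_def
    by (rule form.form_operator_pairing[OF _ w F_test[OF D] qL F_L2[OF uL] lim])
  then have "(\<lambda>n. Re (elliptic_form C (w n) (\<lambda>x. F (w n x)))) \<longlonglongrightarrow> Re (L2_inner f (\<lambda>x. F (u x)))"
    by (rule tendsto_Re)
  then show ?thesis by (rule LIMSEQ_le_const) (use form_F_accretive[OF D] in blast)
qed

end

section \<open>The regularised energy\<close>

definition reg_potential :: "real \<Rightarrow> real \<Rightarrow> complex \<Rightarrow> real" where
  "reg_potential m e z = integral {0..(norm z)\<^sup>2} (reg_power m e) / 2"

lemma reg_power_continuous: "0 < e \<Longrightarrow> continuous_on {0..s} (reg_power m e)"
  by (rule DERIV_continuous_on, rule DERIV_subset[OF reg_power_has_derivative]) auto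

lemma reg_power_integrable: "0 < e \<Longrightarrow> reg_power m e integrable_on {0..s}"
  by (intro integrable_continuous_real reg_power_continuous)

lemma reg_potential_nonneg: "0 < e \<Longrightarrow> 0 \<le> reg_potential m e z"
  unfolding reg_potential_def
  by (intro divide_nonneg_pos Henstock_Kurzweil_Integration.integral_nonneg reg_power_integrable)
     (auto intro: less_imp_le[OF reg_power_pos])

text \<open>
  The integral is differentiable in its upper limit only from within the half line \<open>[0, \<infinity>)\<close>, which suffices
  because \<open>\<bar>z\<bar>\<^sup>2\<close> stays there.
\<close>

lemma reg_potential_has_derivative:
  assumes e: "0 < e"
  shows "(reg_potential m e has_derivative (\<lambda>h. reg_map m e z \<bullet> h)) (at z)"
proof -
  let ?Q = "\<lambda>s. integral {0..s} (reg_power m e)"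
  have Q: "(?Q has_derivative (\<lambda>h. h * reg_power m e s)) (at s within {0..})" if s: "s \<in> {0..}" for s
  proof -
    have "(?Q has_real_derivative reg_power m e s) (at s within {0..s + 1})"
      by (rule integral_has_real_derivative[OF reg_power_continuous[OF e]]) (use s in auto)
    moreover have "at s within {0..} = at s within {0..s + 1}"
      by (rule at_within_nhd[of _ "{..<s + 1}"]) auto
    ultimately have "(?Q has_real_derivative reg_power m e s) (at s within {0..})" by simp
    then show ?thesis by (simp add: has_field_derivative_def mult_commute_abs)
  qed
  have "((\<lambda>z::complex. z \<bullet> z) has_derivative (\<lambda>h. z \<bullet> h + h \<bullet> z)) (at z)"
    by (intro has_derivative_inner has_derivative_ident)
  then have n: "((\<lambda>z::complex. (norm z)\<^sup>2) has_derivative (\<lambda>h. 2 * (z \<bullet> h))) (at z)"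
    by (simp add: power2_norm_eq_inner inner_commute[of _ z])
  have "((\<lambda>z::complex. ?Q ((norm z)\<^sup>2)) has_derivative (\<lambda>h. 2 * (z \<bullet> h) * reg_power m e ((norm z)\<^sup>2))) (at z)"
    by (rule has_derivative_in_compose2[where g="?Q" and t="{0..}" and s=UNIV, OF Q]) (use n in auto)
  then have "((\<lambda>z::complex. ?Q ((norm z)\<^sup>2) * (1 / 2)) has_derivative (\<lambda>h. 2 * (z \<bullet> h) * reg_power m e ((norm z)\<^sup>2) * (1 / 2))) (at z)"
    by (rule has_derivative_mult_left)
  moreover have "2 * (z \<bullet> h) * reg_power m e ((norm z)\<^sup>2) * (1 / 2) = reg_map m e z \<bullet> h" for h
    by (simp add: reg_map_def inner_complex_def algebra_simps)
  ultimately show ?thesis by (simp add: reg_potential_def[abs_def])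
qed

lemma inner_eq_Re: "(z::complex) \<bullet> h = Re (h * cnj z)"
  by (simp add: inner_complex_def)

context power_regularisation
begin

abbreviation G where "G \<equiv> reg_potential m e"

lemma G_zero [simp]: "G 0 = 0" by (simp add: reg_potential_def)

text \<open>
  The gradient \<open>F\<close> of \<open>G\<close> is Lipschitz, so the mean value theorem bounds the first order remainder quadratically.
\<close>

lemma G_taylor: "\<bar>G y - G x - F x \<bullet> (y - x)\<bar> \<le> K * (norm (y - x))\<^sup>2"
proof -
  let ?H = "\<lambda>z. G z - F x \<bullet> z"
  have "norm (?H y - ?H x) \<le> (K * norm (y - x)) * norm (y - x)"
  proof (rule differentiable_bound[of "closed_segment x y" ?H "\<lambda>z h. F z \<bullet> h - F x \<bullet> h"])
    fix z assume z: "z \<in> closed_segment x y"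
    show "(?H has_derivative (\<lambda>h. F z \<bullet> h - F x \<bullet> h)) (at z within closed_segment x y)"
      by (intro has_derivative_diff has_derivative_at_withinI[OF reg_potential_has_derivative[OF e(1)]]
            bounded_linear_imp_has_derivative bounded_linear_inner_right)
    have "norm (F z - F x) \<le> K * norm (y - x)"
      by (rule order_trans[OF F_lipschitz]) (use K_pos segment_bound1[OF z] in \<open>simp add: mult_left_mono\<close>)
    then show "onorm (\<lambda>h. F z \<bullet> h - F x \<bullet> h) \<le> K * norm (y - x)"
      unfolding inner_diff_left[symmetric] using K_pos
      by (intro onorm_bound) (auto intro!: order_trans[OF Cauchy_Schwarz_ineq2] mult_right_mono)
  qed (auto simp: convex_closed_segment)
  then show ?thesis by (simp add: inner_diff_right power2_eq_square algebra_simps)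
qed

lemma G_nonneg: "0 \<le> G z" by (rule reg_potential_nonneg[OF e(1)])

lemma G_bound: "G z \<le> K * (norm z)\<^sup>2"
  using G_taylor[of z 0] by simp

lemma G_continuous: "continuous_on A G"
  by (rule continuous_at_imp_continuous_on) (use has_derivative_continuous[OF reg_potential_has_derivative[OF e(1)]] in blast)

lemma G_measurable [measurable]: "G \<in> borel_measurable borel"
  by (intro borel_measurable_continuous_onI G_continuous)

definition energy :: "(real^'n \<Rightarrow> complex) \<Rightarrow> real" where
  "energy f = (LINT x|lebesgue. G (f x))"

lemma G_integrable:
  assumes f: "f \<in> Lp_space 2" shows "integrable lebesgue (\<lambda>x. G (f x))"
proof (rule Bochner_Integration.integrable_bound)
  note [measurable] = measurable_Lp[OF f]
  show "integrable lebesgue (\<lambda>x. K * (norm (f x))\<^sup>2)" using integrable_L2[OF f] by simp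
  show "(\<lambda>x. G (f x)) \<in> borel_measurable lebesgue" by measurable
  show "AE x in lebesgue. norm (G (f x)) \<le> norm (K * (norm (f x))\<^sup>2)"
    using G_bound G_nonneg K_pos by (intro AE_I2) (simp add: abs_mult)
qed

text \<open>
  The quadratic remainder of \<open>G\<close> integrates to a squared \<open>L\<^sub>2\<close> norm; this is how the energy is
  differentiated without differentiating under an integral.
\<close>

lemma energy_taylor:
  assumes f: "f \<in> Lp_space 2" and g: "g \<in> Lp_space 2"
  shows "\<bar>energy g - energy f - Re (L2_inner (\<lambda>x. g x - f x) (\<lambda>x. F (f x)))\<bar> \<le> K * (Lp_dist 2 g f)\<^sup>2"
proof -
  note d = Lp_space_diff[OF g f, simplified]
  note i = G_integrable[OF f] G_integrable[OF g] L2_inner_integrable[OF d F_L2[OF f]] integrable_L2[OF d]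
  have "energy g - energy f - Re (L2_inner (\<lambda>x. g x - f x) (\<lambda>x. F (f x)))
      = (LINT x|lebesgue. G (g x) - G (f x) - Re ((g x - f x) * cnj (F (f x))))"
    unfolding energy_def L2_inner_def
    by (simp only: Bochner_Integration.integral_diff Bochner_Integration.integrable_diff i integrable_Re integral_Re)
  also have "\<bar>\<dots>\<bar> \<le> (LINT x|lebesgue. \<bar>G (g x) - G (f x) - Re ((g x - f x) * cnj (F (f x)))\<bar>)"
    by (rule integral_abs_bound)
  also have "\<dots> \<le> (LINT x|lebesgue. K * (norm (g x - f x))\<^sup>2)"
  proof (rule integral_mono)
    show "integrable lebesgue (\<lambda>x. \<bar>G (g x) - G (f x) - Re ((g x - f x) * cnj (F (f x)))\<bar>)"
      by (intro integrable_abs Bochner_Integration.integrable_diff i integrable_Re)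
    show "integrable lebesgue (\<lambda>x. K * (norm (g x - f x))\<^sup>2)" using i by simp
    show "\<bar>G (g x) - G (f x) - Re ((g x - f x) * cnj (F (f x)))\<bar> \<le> K * (norm (g x - f x))\<^sup>2" for x
      using G_taylor[of "g x" "f x"] unfolding inner_eq_Re .
  qed
  also have "\<dots> = K * (Lp_dist 2 g f)\<^sup>2" unfolding Lp2_power2 using i by simp
  finally show ?thesis .
qed

lemma energy_diff_bound:
  assumes f: "f \<in> Lp_space 2" and g: "g \<in> Lp_space 2"
  shows "\<bar>energy g - energy f\<bar> \<le> K * Lp_dist 2 g f * (Lp_norm 2 f + Lp_dist 2 g f)"
proof -
  have d: "(\<lambda>x. g x - f x) \<in> Lp_space 2" by (rule Lp_space_diff[OF g f]) simp
  have "Lp_norm 2 (\<lambda>x. F (f x)) \<le> Lp_norm 2 (\<lambda>x. of_real K * f x)"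
    by (rule Lp_norm_mono[OF Lp_space_cmult[OF f] _ measurable_Lp[OF F_L2[OF f]]])
       (use F_bound K_pos in \<open>auto simp: norm_mult\<close>)
  also have "\<dots> = K * Lp_norm 2 f" using Lp_norm_cmult[of 2 "of_real K" f] K_pos by simp
  finally have "Lp_dist 2 g f * Lp_norm 2 (\<lambda>x. F (f x)) \<le> Lp_dist 2 g f * (K * Lp_norm 2 f)"
    by (rule mult_left_mono) simp
  moreover have "\<bar>Re (L2_inner (\<lambda>x. g x - f x) (\<lambda>x. F (f x)))\<bar> \<le> Lp_dist 2 g f * Lp_norm 2 (\<lambda>x. F (f x))"
    using abs_Re_le_cmod L2_inner_bound[OF d F_L2[OF f]] by (rule order_trans)
  moreover note energy_taylor[OF f g]
  ultimately have "\<bar>energy g - energy f\<bar> \<le> Lp_dist 2 g f * (K * Lp_norm 2 f) + K * (Lp_dist 2 g f)\<^sup>2"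
    by linarith
  then show ?thesis by (simp add: power2_eq_square algebra_simps)
qed

lemma energy_tendsto:
  assumes f: "\<And>n. f n \<in> Lp_space 2" and g: "g \<in> Lp_space 2"
    and lim: "((\<lambda>n. Lp_dist 2 (f n) g) \<longlongrightarrow> 0) net"
  shows "((\<lambda>n. energy (f n)) \<longlongrightarrow> energy g) net"
proof (rule tendsto_norm_le)
  show "((\<lambda>n. K * Lp_dist 2 (f n) g * (Lp_norm 2 g + Lp_dist 2 (f n) g)) \<longlongrightarrow> 0) net"
    using tendsto_mult[OF tendsto_mult_right_zero[OF lim, of K] tendsto_add[OF tendsto_const[of "Lp_norm 2 g"] lim]] by simp
  show "norm (energy (f n) - energy g) \<le> K * Lp_dist 2 (f n) g * (Lp_norm 2 g + Lp_dist 2 (f n) g)" for n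
    using energy_diff_bound[OF g f, of n] by simp
qed

end

text \<open>
  The majorant does not depend on \<open>e\<close>; integrated over \<open>[0, \<bar>u\<bar>\<^sup>2]\<close> it gives a multiple of \<open>\<bar>u\<bar>\<^sup>2\<close> plus a
  multiple of \<open>\<bar>u\<bar>\<^sup>p\<close>, which is integrable for \<open>u\<close> in \<open>L\<^sub>2 \<inter> L\<^sub>p\<close>.
\<close>

lemma reg_power_dominated:
  assumes e: "0 < e" "e < 1" and s: "0 < s"
  shows "reg_power m e s \<le> 2 powr \<bar>m\<bar> * (1 + s powr m)"
proof -
  have d: "0 < 1 + e * s" using e s by (simp add: add_pos_pos)
  consider "m = 0" | "m > 0" | "m < 0" by linarith
  then show ?thesis
  proof cases
    case 1
    then show ?thesis using e s d by (simp add: reg_power_def)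
  next
    case 2
    have "e + s \<le> (1 + s) * (1 + e * s)" using e s by (simp add: algebra_simps add_increasing2)
    then have "(e + s) / (1 + e * s) \<le> 1 + s" using d by (simp add: divide_le_eq)
    then have "reg_power m e s \<le> (1 + s) powr m" unfolding reg_power_def using 2 e s d by (intro powr_mono2) auto
    also have "\<dots> \<le> 2 powr m * (1 powr m + s powr m)" using 2 s by (intro powr_add_le) auto
    finally show ?thesis using 2 by simp
  next
    case 3
    have le: "s / (1 + s) \<le> (e + s) / (1 + e * s)"
    proof -
      have "s * (1 + e * s) \<le> (e + s) * (1 + s)" 
      proof -
        have "e * s * s \<le> 1 * s * s" using e s by (intro mult_right_mono) auto
        moreover have "0 \<le> e * s" using e s by simp
        ultimately show ?thesis using e by (simp add: algebra_simps)
      qed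
      then show ?thesis using d s by (simp add: frac_le_eq divide_le_eq le_divide_eq field_simps)
    qed
    have "reg_power m e s \<le> (s / (1 + s)) powr m" unfolding reg_power_def using 3 s le by (intro powr_mono2') auto
    also have "\<dots> = ((1 + s) / s) powr (- m)" using s by (simp add: powr_divide powr_minus_divide)
    also have "\<dots> = (1 + 1 / s) powr (- m)" using s by (simp add: add_divide_distrib add.commute)
    also have "\<dots> \<le> 2 powr (- m) * (1 powr (- m) + (1 / s) powr (- m))" using 3 s by (intro powr_add_le) auto
    also have "(1 / s) powr (- m) = s powr m" using s by (simp add: powr_divide powr_minus_divide)
    finally show ?thesis using 3 by simp
  qed
qed

lemma reg_potential_dominated:
  assumes m: "-1 < m" and e: "0 < e" "e < 1"
  shows "reg_potential m e z \<le> 2 powr \<bar>m\<bar> * ((norm z)\<^sup>2 + (norm z) powr (2 * (m + 1)) / (m + 1)) / 2"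
    (is "_ \<le> ?B / 2")
proof -
  let ?S = "(norm z)\<^sup>2"
  have hi: "((\<lambda>s. s powr m) has_integral (?S powr (m + 1) / (m + 1))) {0..?S}"
    by (rule has_integral_powr_from_0[OF m]) simp
  have c: "((\<lambda>s::real. 1::real) has_integral ?S) {0..?S}"
    using has_integral_const_real[of "1::real" 0 ?S] by simp
  have B: "((\<lambda>s. 2 powr \<bar>m\<bar> * (1 + s powr m)) has_integral 2 powr \<bar>m\<bar> * (?S + ?S powr (m + 1) / (m + 1))) {0..?S}"
    by (intro has_integral_mult_right has_integral_add hi c)
  \<comment> \<open>For negative \<open>m\<close> the value \<open>0 powr m = 0\<close> spoils the majorant at the origin, so the origin is removed.\<close>
  have "integral {0..?S} (reg_power m e) = integral {0..?S} (\<lambda>s. if s = 0 then 0 else reg_power m e s)"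
    by (rule integral_spike[of "{0}"]) auto
  also have "\<dots> \<le> integral {0..?S} (\<lambda>s. 2 powr \<bar>m\<bar> * (1 + s powr m))"
  proof (rule integral_le)
    show "(\<lambda>s. if s = 0 then 0 else reg_power m e s) integrable_on {0..?S}"
      by (rule integrable_spike[OF reg_power_integrable[OF e(1)], of "{0}"]) auto
  qed (use B reg_power_dominated[OF e] in \<open>auto intro: has_integral_integrable\<close>)
  also have "\<dots> = 2 powr \<bar>m\<bar> * (?S + ?S powr (m + 1) / (m + 1))" using B by (rule integral_unique)
  also have "?S powr (m + 1) = (norm z) powr (2 * (m + 1))"
    by (cases "z = 0") (simp_all add: powr_powr powr_numeral[symmetric] del: powr_numeral)
  finally show ?thesis by (simp add: reg_potential_def)
qed

lemma reg_potential_tendsto: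
  assumes m: "-1 < m" and e: "\<And>n. 0 < e n" "\<And>n. e n < 1" and lim: "e \<longlonglongrightarrow> 0"
  shows "(\<lambda>n. reg_potential m (e n) z) \<longlonglongrightarrow> (norm z) powr (2 * (m + 1)) / (2 * (m + 1))"
proof -
  let ?S = "(norm z)\<^sup>2"
  let ?f = "\<lambda>n s. if s = 0 then 0 else reg_power m (e n) s"
  have hi: "((\<lambda>s. s powr m) has_integral (?S powr (m + 1) / (m + 1))) {0..?S}"
    by (rule has_integral_powr_from_0[OF m]) simp
  have c: "((\<lambda>s::real. 1::real) has_integral ?S) {0..?S}"
    using has_integral_const_real[of "1::real" 0 ?S] by simp
  have B: "((\<lambda>s. 2 powr \<bar>m\<bar> * (1 + s powr m)) has_integral 2 powr \<bar>m\<bar> * (?S + ?S powr (m + 1) / (m + 1))) {0..?S}"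
    by (intro has_integral_mult_right has_integral_add hi c)
  have "(\<lambda>n. integral {0..?S} (?f n)) \<longlonglongrightarrow> integral {0..?S} (\<lambda>s. s powr m)"
  proof (rule dominated_convergence(2))
    show "?f n integrable_on {0..?S}" for n
      by (rule integrable_spike[OF reg_power_integrable[OF e(1)], of "{0}"]) auto
    show "(\<lambda>s. 2 powr \<bar>m\<bar> * (1 + s powr m)) integrable_on {0..?S}" using B by (rule has_integral_integrable)
    show "norm (?f n s) \<le> 2 powr \<bar>m\<bar> * (1 + s powr m)" if "s \<in> {0..?S}" for n s
      using that reg_power_dominated[OF e(1) e(2), of s m n] reg_power_pos[OF e(1), of s m n] by auto
    show "(\<lambda>n. ?f n s) \<longlonglongrightarrow> s powr m" if "s \<in> {0..?S}" for s
    proof (cases "s = 0")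
      case False
      then have s: "s > 0" using that by auto
      have "(\<lambda>n. ((e n + s) / (1 + e n * s)) powr m) \<longlonglongrightarrow> ((0 + s) / (1 + 0 * s)) powr m"
        using s by (intro tendsto_intros lim) auto
      then show ?thesis using s by (simp add: reg_power_def)
    qed simp
  qed
  moreover have "integral {0..?S} (?f n) = integral {0..?S} (reg_power m (e n))" for n
    by (rule integral_spike[of "{0}"]) auto
  moreover have "integral {0..?S} (\<lambda>s. s powr m) = (norm z) powr (2 * (m + 1)) / (m + 1)"
    using integral_unique[OF hi]
    by (cases "z = 0") (simp_all add: powr_powr powr_numeral[symmetric] del: powr_numeral)
  ultimately have "(\<lambda>n. integral {0..?S} (reg_power m (e n))) \<longlonglongrightarrow> (norm z) powr (2 * (m + 1)) / (m + 1)" by simp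
  then have "(\<lambda>n. integral {0..?S} (reg_power m (e n)) / 2) \<longlonglongrightarrow> (norm z) powr (2 * (m + 1)) / (m + 1) / 2"
    by (intro tendsto_divide tendsto_const) auto
  then show ?thesis unfolding reg_potential_def by (simp add: mult.commute)
qed

section \<open>Uniform boundedness and orbits of semigroups\<close>

lemma bounded_linear_Lp_mem: "bounded_linear_Lp p T \<Longrightarrow> f \<in> Lp_space p \<Longrightarrow> T f \<in> Lp_space p"
  by (simp add: bounded_linear_Lp_def)

lemma bounded_linear_Lp_bound:
  assumes "bounded_linear_Lp p T"
  obtains K where "0 \<le> K" "\<And>f. f \<in> Lp_space p \<Longrightarrow> Lp_norm p (T f) \<le> K * Lp_norm p f"
proof -
  obtain K where K: "\<And>f. f \<in> Lp_space p \<Longrightarrow> Lp_norm p (T f) \<le> K * Lp_norm p f"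
    using assms unfolding bounded_linear_Lp_def by blast
  have "Lp_norm p (T f) \<le> max 0 K * Lp_norm p f" if "f \<in> Lp_space p" for f
    using K[OF that] mult_right_mono[of K "max 0 K" "Lp_norm p f"] by simp
  then show ?thesis using that[of "max 0 K"] by simp
qed

lemma bounded_linear_Lp_add:
  "bounded_linear_Lp p T \<Longrightarrow> f \<in> Lp_space p \<Longrightarrow> g \<in> Lp_space p \<Longrightarrow>
    AE x in lebesgue. T (\<lambda>y. f y + g y) x = T f x + T g x"
  by (simp add: bounded_linear_Lp_def)

lemma bounded_linear_Lp_cmult:
  "bounded_linear_Lp p T \<Longrightarrow> f \<in> Lp_space p \<Longrightarrow> AE x in lebesgue. T (\<lambda>y. c * f y) x = c * T f x"
  by (simp add: bounded_linear_Lp_def)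

lemma bounded_linear_Lp_diff:
  assumes T: "bounded_linear_Lp p T" and f: "f \<in> Lp_space p" and g: "g \<in> Lp_space p"
  shows "AE x in lebesgue. T (\<lambda>y. f y - g y) x = T f x - T g x"
proof -
  have "AE x in lebesgue. T (\<lambda>y. f y + (-1) * g y) x = T f x + T (\<lambda>y. (-1) * g y) x"
    by (rule bounded_linear_Lp_add[OF T f Lp_space_cmult[OF g]])
  moreover have "AE x in lebesgue. T (\<lambda>y. (-1) * g y) x = (-1) * T g x"
    by (rule bounded_linear_Lp_cmult[OF T g])
  ultimately show ?thesis by eventually_elim simp
qed

lemma bounded_linear_Lp_norm_diff:
  assumes T: "bounded_linear_Lp p T" and f: "f \<in> Lp_space p" and g: "g \<in> Lp_space p"
  shows "Lp_dist p (T f) (T g) = Lp_norm p (T (\<lambda>x. f x - g x))"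
  by (rule Lp_norm_cong_AE) (use bounded_linear_Lp_diff[OF T f g] in eventually_elim, simp)

definition Lp_opnorm :: "real \<Rightarrow> ((real^'n \<Rightarrow> complex) \<Rightarrow> (real^'n \<Rightarrow> complex)) \<Rightarrow> real" where
  "Lp_opnorm p T = (SUP f\<in>{f \<in> Lp_space p. Lp_norm p f \<le> 1}. Lp_norm p (T f))"

lemma Lp_opnorm:
  fixes T :: "(real^'n \<Rightarrow> complex) \<Rightarrow> (real^'n \<Rightarrow> complex)" and f :: "real^'n \<Rightarrow> complex"
  assumes T: "bounded_linear_Lp p T" and p: "0 < p"
  shows "f \<in> Lp_space p \<Longrightarrow> Lp_norm p (T f) \<le> Lp_opnorm p T * Lp_norm p f"
    and "c < Lp_opnorm p T \<Longrightarrow> \<exists>f\<in>Lp_space p. Lp_norm p f \<le> 1 \<and> c < Lp_norm p (T f)"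
    and "0 \<le> Lp_opnorm p T"
proof -
  obtain K where K: "0 \<le> K" "\<And>f. f \<in> Lp_space p \<Longrightarrow> Lp_norm p (T f) \<le> K * Lp_norm p f"
    by (rule bounded_linear_Lp_bound[OF T]) blast
  let ?B = "{f :: real^'n \<Rightarrow> complex. f \<in> Lp_space p \<and> Lp_norm p f \<le> 1}"
  have z: "(\<lambda>x. 0) \<in> ?B" by (simp add: Lp_norm_def)
  have bdd: "bdd_above ((\<lambda>f. Lp_norm p (T f)) ` ?B)"
  proof (rule bdd_aboveI2)
    fix f assume f: "f \<in> ?B"
    then have "K * Lp_norm p f \<le> K * 1" using K by (intro mult_left_mono) auto
    then show "Lp_norm p (T f) \<le> K" using K(2)[of f] f by simp
  qed
  show "0 \<le> Lp_opnorm p T" unfolding Lp_opnorm_def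
    by (rule cSUP_upper2[OF bdd z]) simp
  show "\<exists>f\<in>Lp_space p. Lp_norm p f \<le> 1 \<and> c < Lp_norm p (T f)" if "c < Lp_opnorm p T"
  proof -
    have "?B \<noteq> {}" using z by blast
    from less_cSUP_iff[OF this bdd, of c] that show ?thesis unfolding Lp_opnorm_def by auto
  qed
  assume f: "f \<in> Lp_space p"
  show "Lp_norm p (T f) \<le> Lp_opnorm p T * Lp_norm p f"
  proof (cases "Lp_norm p f = 0")
    case True
    then show ?thesis using K(2)[OF f] by simp
  next
    case False
    then have n: "0 < Lp_norm p f" using Lp_norm_nonneg[of p f] by linarith
    define g where "g x = of_real (1 / Lp_norm p f) * f x" for x
    have g: "g \<in> Lp_space p" unfolding g_def[abs_def] by (rule Lp_space_cmult[OF f])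
    have "Lp_norm p g = 1" unfolding g_def using n by (subst Lp_norm_cmult[OF p]) (simp add: norm_divide)
    then have "Lp_norm p (T g) \<le> Lp_opnorm p T"
      unfolding Lp_opnorm_def using g by (intro cSUP_upper[OF _ bdd]) simp
    moreover have "Lp_norm p (T g) = Lp_norm p (\<lambda>x. of_real (1 / Lp_norm p f) * T f x)"
      unfolding g_def by (rule Lp_norm_cong_AE[OF bounded_linear_Lp_cmult[OF T f]])
    moreover have "\<dots> = Lp_norm p (T f) / Lp_norm p f" using n by (subst Lp_norm_cmult[OF p]) (simp add: norm_divide)
    ultimately show ?thesis using n by (simp add: divide_le_eq)
  qed
qed

text \<open>
  An elementary gliding hump argument.  If the norms are unbounded, choose operators \<open>U j\<close> of norm above \<open>4\<^sup>j\<close> and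
  perturb successively by steps of size \<open>3\<^sup>-\<^sup>j\<close> that make \<open>U j\<close> large; all later steps together have size at
  most \<open>3\<^sup>-\<^sup>j / 2\<close> and cannot cancel this, so the limit of the perturbations contradicts
  pointwise boundedness.
\<close>

lemma uniform_boundedness_Lp:
  fixes T :: "nat \<Rightarrow> (real^'n \<Rightarrow> complex) \<Rightarrow> (real^'n \<Rightarrow> complex)"
  assumes T: "\<And>n. bounded_linear_Lp p (T n)" and p: "1 \<le> p"
    and pw: "\<And>f. f \<in> Lp_space p \<Longrightarrow> \<exists>B. \<forall>n. Lp_norm p (T n f) \<le> B"
  shows "\<exists>M. \<forall>n. \<forall>f\<in>Lp_space p. Lp_norm p (T n f) \<le> M * Lp_norm p f"
proof (rule ccontr)
  have p0: "0 < p" using p by simp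
  note op = Lp_opnorm[OF T p0]
  assume neg: "\<not> ?thesis"
  have "\<exists>n. 4 ^ j < Lp_opnorm p (T n)" for j
  proof (rule ccontr)
    assume "\<nexists>n. 4 ^ j < Lp_opnorm p (T n)"
    then have "Lp_opnorm p (T n) \<le> 4 ^ j" for n by (meson not_less)
    then have "Lp_norm p (T n f) \<le> 4 ^ j * Lp_norm p f" if "f \<in> Lp_space p" for n f
      by (intro order_trans[OF op(1)[OF that]] mult_right_mono) auto
    then show False using neg by blast
  qed
  then obtain \<nu> where \<nu>: "\<And>j. 4 ^ j < Lp_opnorm p (T (\<nu> j))" by metis
  define U c where "U j = T (\<nu> j)" and "c j = Lp_opnorm p (U j)" for j
  have c: "4 ^ j < c j" and c0: "0 < c j" for j
    using \<nu>[of j] by (auto simp: c_def U_def intro: less_trans[of 0 "4 ^ j"])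
  have "\<exists>f\<in>Lp_space p. Lp_norm p f \<le> 1 \<and> 2 / 3 * c j < Lp_norm p (U j f)" for j
    unfolding U_def by (rule op(2)) (use c0[of j] in \<open>simp add: c_def U_def\<close>)
  then obtain f where f: "\<And>j. f j \<in> Lp_space p" "\<And>j. Lp_norm p (f j) \<le> 1" "\<And>j. 2 / 3 * c j < Lp_norm p (U j (f j))"
    by metis
  \<comment> \<open>Of \<open>x + h\<close> and \<open>x - h\<close> one has image of norm at least that of the image of \<open>h\<close>; so each step of size
    \<open>3^-j\<close> can be chosen such that it makes \<open>U j\<close> large, whatever was chosen before.\<close>
  have step: "\<exists>y. y \<in> Lp_space p \<and> Lp_dist p y x \<le> (1/3)^j \<and> 2/3 * (1/3)^j * c j \<le> Lp_norm p (U j y)"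
    if x: "x \<in> Lp_space p" for x j
  proof -
    let ?h = "\<lambda>s t. of_real (s * (1/3)^j) * f j t" and ?y = "\<lambda>s t. x t + of_real (s * (1/3)^j) * f j t"
    have h: "?h s \<in> Lp_space p" for s by (rule Lp_space_cmult[OF f(1)])
    have y: "?y s \<in> Lp_space p" for s by (rule Lp_space_add[OF x h p0])
    have d: "Lp_dist p (?y s) x \<le> (1/3)^j" if "\<bar>s\<bar> = 1" for s
    proof -
      have "Lp_dist p (?y s) x = (1/3)^j * Lp_norm p (f j)"
        using that Lp_norm_cmult[OF p0, of "of_real (s * (1/3)^j)" "f j"] by (simp add: norm_mult norm_power abs_mult del: of_real_mult of_real_power)
      also have "\<dots> \<le> (1/3)^j * 1" by (intro mult_left_mono f) auto
      finally show ?thesis by simp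
    qed
    have Tj: "bounded_linear_Lp p (U j)" by (simp add: U_def T)
    have "2 * (1/3)^j * Lp_norm p (U j (f j)) = Lp_norm p (\<lambda>t. of_real (2 * (1/3)^j) * U j (f j) t)"
      by (subst Lp_norm_cmult[OF p0]) (simp add: norm_mult norm_power)
    also have "\<dots> = Lp_norm p (U j (\<lambda>t. of_real (2 * (1/3)^j) * f j t))"
      by (rule sym[OF Lp_norm_cong_AE[OF bounded_linear_Lp_cmult[OF Tj f(1)]]])
    also have "(\<lambda>t. of_real (2 * (1/3)^j) * f j t) = (\<lambda>t. ?y 1 t - ?y (-1) t)"
      by (simp add: algebra_simps)
    also have "Lp_norm p (U j \<dots>) = Lp_dist p (U j (?y 1)) (U j (?y (-1)))"
      by (rule bounded_linear_Lp_norm_diff[OF Tj y y, symmetric])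
    also have "\<dots> \<le> Lp_norm p (U j (?y 1)) + Lp_norm p (U j (?y (-1)))"
      by (rule Lp_norm_diff_le[OF bounded_linear_Lp_mem[OF Tj y] bounded_linear_Lp_mem[OF Tj y] p])
    finally have "2 * ((1/3)^j * Lp_norm p (U j (f j))) \<le> Lp_norm p (U j (?y 1)) + Lp_norm p (U j (?y (-1)))" by simp
    moreover have "2/3 * (1/3)^j * c j \<le> (1/3)^j * Lp_norm p (U j (f j))"
      using mult_left_mono[OF less_imp_le[OF f(3)[of j]], of "(1/3)^j"] by simp
    ultimately have "2/3 * (1/3)^j * c j \<le> Lp_norm p (U j (?y 1)) \<or> 2/3 * (1/3)^j * c j \<le> Lp_norm p (U j (?y (-1)))"
      by linarith
    then show ?thesis
    proof
      assume "2/3 * (1/3)^j * c j \<le> Lp_norm p (U j (?y 1))"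
      then show ?thesis using y[of 1] d[of 1] by (intro exI[of _ "?y 1"]) simp
    next
      assume "2/3 * (1/3)^j * c j \<le> Lp_norm p (U j (?y (-1)))"
      then show ?thesis using y[of "-1"] d[of "-1"] by (intro exI[of _ "?y (-1)"]) simp
    qed
  qed
  have "\<exists>x. \<forall>j. x j \<in> Lp_space p \<and> (x (Suc j) \<in> Lp_space p \<and> Lp_dist p (x (Suc j)) (x j) \<le> (1/3)^j \<and> 2/3 * (1/3)^j * c j \<le> Lp_norm p (U j (x (Suc j))))"
  proof -
    have "\<exists>x. \<forall>j. x j \<in> Lp_space p \<and> (Lp_dist p (x (Suc j)) (x j) \<le> (1/3)^j \<and> 2/3 * (1/3)^j * c j \<le> Lp_norm p (U j (x (Suc j))))"
    proof (rule dependent_nat_choice)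
      show "\<exists>x::real^'n \<Rightarrow> complex. x \<in> Lp_space p" using Lp_space_zero by blast
    qed (use step in blast)
    then show ?thesis by blast
  qed
  then obtain x where x: "\<And>j. x j \<in> Lp_space p" "\<And>j. Lp_dist p (x (Suc j)) (x j) \<le> (1/3)^j"
    "\<And>j. 2/3 * (1/3)^j * c j \<le> Lp_norm p (U j (x (Suc j)))" by blast
  have dist: "Lp_dist p (x (k + i)) (x k) \<le> 3/2 * (1/3)^k" for k i
  proof -
    have "Lp_dist p (x (k + i)) (x k) \<le> 3/2 * ((1/3)^k - (1/3)^(k + i))"
    proof (induction i)
      case 0
      then show ?case by (simp add: Lp_norm_def)
    next
      case (Suc i)
      have "Lp_dist p (x (k + Suc i)) (x k) \<le> Lp_dist p (x (Suc (k + i))) (x (k + i)) + Lp_dist p (x (k + i)) (x k)"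
        using Lp_norm_triangle_diff[OF x(1) x(1) x(1) p, of "Suc (k + i)" k "k + i"] by simp
      then show ?case using Suc x(2)[of "k + i"] by simp
    qed
    also have "\<dots> \<le> 3/2 * (1/3)^k" by simp
    finally show ?thesis .
  qed
  have small: "\<exists>N. 3 * (1/3)^N < e" if "e > 0" for e :: real
    using real_arch_pow_inv[of "e / 3" "1/3"] that by (auto simp: field_simps)
  obtain z where z: "z \<in> Lp_space p" "Lp_tendsto p x z"
  proof (rule Lp_complete[OF x(1) p])
    fix e :: real assume "e > 0"
    then obtain N where N: "3 * (1/3)^N < e" using small by blast
    have "Lp_dist p (x m) (x n) < e" if "m \<ge> N" "n \<ge> N" for m n
    proof -
      have "Lp_dist p (x m) (x n) \<le> Lp_dist p (x m) (x N) + Lp_dist p (x n) (x N)"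
        using Lp_norm_triangle_diff[OF x(1) x(1) x(1) p, of m n N] by (simp add: Lp_dist_commute[of p "x n"])
      then show ?thesis using dist[of N "m - N"] dist[of N "n - N"] that N by simp
    qed
    then show "\<exists>N. \<forall>m\<ge>N. \<forall>n\<ge>N. Lp_dist p (x m) (x n) < e" by blast
  qed
  have zd: "Lp_dist p z (x k) \<le> 3/2 * (1/3)^k" for k
  proof (rule field_le_epsilon)
    fix e :: real assume "e > 0"
    then obtain n where n: "n \<ge> k" "Lp_dist p (x n) z < e"
      using order_tendstoD(2)[OF z(2)] unfolding eventually_sequentially by (metis nat_le_linear)
    have "Lp_dist p z (x k) \<le> Lp_dist p z (x n) + Lp_dist p (x n) (x k)"
      by (rule Lp_norm_triangle_diff[OF z(1) x(1) x(1) p])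
    then show "Lp_dist p z (x k) \<le> 3/2 * (1/3)^k + e"
      using dist[of k "n - k"] n by (simp add: Lp_dist_commute[of p z])
  qed
  obtain B where B: "\<And>n. Lp_norm p (T n z) \<le> B" using pw[OF z(1)] by blast
  have ge: "(4/3)^j / 6 \<le> B" for j
  proof -
    have Tj: "bounded_linear_Lp p (U j)" by (simp add: U_def T)
    have "Lp_norm p (U j (x (Suc j))) \<le> Lp_norm p (U j z) + Lp_dist p (U j z) (U j (x (Suc j)))"
      using Lp_norm_le_add_diff[OF bounded_linear_Lp_mem[OF Tj x(1)] bounded_linear_Lp_mem[OF Tj z(1)] p, of "Suc j"]
      by (simp add: Lp_dist_commute[of p "U j z"])
    also have "Lp_dist p (U j z) (U j (x (Suc j))) \<le> c j * Lp_dist p z (x (Suc j))"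
      unfolding bounded_linear_Lp_norm_diff[OF Tj z(1) x(1)] c_def
      by (rule Lp_opnorm(1)[OF Tj p0 Lp_space_diff[OF z(1) x(1) p0]])
    also have "\<dots> \<le> c j * (3/2 * (1/3)^Suc j)" using c0[of j] by (intro mult_left_mono zd) simp
    finally have "2/3 * (1/3)^j * c j - c j * (3/2 * (1/3)^Suc j) \<le> Lp_norm p (U j z)"
      using x(3)[of j] by linarith
    then have "(1/3)^j * c j / 6 \<le> Lp_norm p (U j z)" by (simp add: algebra_simps)
    moreover have "(4/3)^j / 6 \<le> (1/3)^j * c j / 6"
      using mult_left_mono[OF less_imp_le[OF c[of j]], of "(1/3)^j"] by (simp add: power_divide)
    moreover have "Lp_norm p (U j z) \<le> B" by (simp add: U_def B)
    ultimately show ?thesis by linarith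
  qed
  obtain j where "6 * B + 1 < (4/3::real)^j" using real_arch_pow[of "4/3" "6 * B + 1"] by auto
  then show False using ge[of j] by linarith
qed

lemma C0_semigroupD:
  assumes "C0_semigroup p S"
  shows "0 \<le> t \<Longrightarrow> bounded_linear_Lp p (S t)"
    and "f \<in> Lp_space p \<Longrightarrow> AE x in lebesgue. S 0 f x = f x"
    and "0 \<le> s \<Longrightarrow> 0 \<le> t \<Longrightarrow> f \<in> Lp_space p \<Longrightarrow> AE x in lebesgue. S (s + t) f x = S s (S t f) x"
    and "f \<in> Lp_space p \<Longrightarrow> ((\<lambda>t. Lp_dist p (S t f) f) \<longlongrightarrow> 0) (at_right 0)"
  using assms by (auto simp: C0_semigroup_def)

lemma C0_semigroup_mem: "C0_semigroup p S \<Longrightarrow> 0 \<le> t \<Longrightarrow> f \<in> Lp_space p \<Longrightarrow> S t f \<in> Lp_space p"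
  by (rule bounded_linear_Lp_mem[OF C0_semigroupD(1)])

lemma C0_semigroup_norm_add:
  assumes S: "C0_semigroup p S" and t: "0 \<le> s" "0 \<le> t" and f: "f \<in> Lp_space p"
  shows "Lp_norm p (S (s + t) f) = Lp_norm p (S s (S t f))"
  by (rule Lp_norm_cong_AE[OF C0_semigroupD(3)[OF S t f]])

text \<open>
  Otherwise there would be times \<open>t n \<rightarrow> 0\<close> with norms above \<open>n\<close>; but orbits converge at 0, so they are bounded
  along \<open>t n\<close>, contrary to uniform boundedness.
\<close>

lemma C0_semigroup_bounded_near_0:
  fixes S :: "real \<Rightarrow> (real^'n \<Rightarrow> complex) \<Rightarrow> (real^'n \<Rightarrow> complex)"
  assumes S: "C0_semigroup p S" and p: "1 \<le> p"
  shows "\<exists>\<delta>>0. \<exists>M\<ge>1. \<forall>t\<in>{0..\<delta>}. \<forall>f\<in>Lp_space p. Lp_norm p (S t f) \<le> M * Lp_norm p f"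
proof (rule ccontr)
  assume neg: "\<not> ?thesis"
  have z: "Lp_norm p (S 0 f) = Lp_norm p f" if "f \<in> Lp_space p" for f
    by (rule Lp_norm_cong_AE[OF C0_semigroupD(2)[OF S that]])
  have "\<exists>t. 0 < t \<and> t \<le> inverse (real (Suc n)) \<and> (\<exists>f\<in>Lp_space p. real (Suc n) * Lp_norm p f < Lp_norm p (S t f))" for n
  proof -
    have d: "0 < inverse (real (Suc n))" "1 \<le> real (Suc n)" by auto
    have "\<not> (\<forall>t\<in>{0..inverse (real (Suc n))}. \<forall>f\<in>Lp_space p. Lp_norm p (S t f) \<le> real (Suc n) * Lp_norm p f)"
      using neg d by blast
    then obtain t f where t: "t \<in> {0..inverse (real (Suc n))}" and f: "f \<in> Lp_space p" "real (Suc n) * Lp_norm p f < Lp_norm p (S t f)"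
      unfolding not_le[symmetric] by blast
    have "t \<noteq> 0"
    proof
      assume "t = 0"
      then have "real (Suc n) * Lp_norm p f < Lp_norm p f" using f z by simp
      then show False using mult_right_mono[OF d(2), of "Lp_norm p f"] by simp
    qed
    then show ?thesis using t f by (intro exI[of _ t]) auto
  qed
  then obtain t where t: "\<And>n. 0 < t n" "\<And>n. t n \<le> inverse (real (Suc n))"
    and big: "\<And>n. \<exists>f\<in>Lp_space p. real (Suc n) * Lp_norm p f < Lp_norm p (S (t n) f)" by metis
  have t0: "t \<longlonglongrightarrow> 0"
    by (rule tendsto_norm_le[OF LIMSEQ_inverse_real_of_nat]) (use t in \<open>auto simp: abs_of_pos\<close>)
  have tr: "filterlim t (at_right 0) sequentially"
  proof -
    have "t n \<noteq> 0" for n using t(1)[of n] by simp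
    then show ?thesis using t0 t(1) by (simp add: filterlim_at)
  qed
  have "\<exists>M. \<forall>n. \<forall>f\<in>Lp_space p. Lp_norm p (S (t n) f) \<le> M * Lp_norm p f"
  proof (rule uniform_boundedness_Lp[OF _ p])
    show "bounded_linear_Lp p (S (t n))" for n by (rule C0_semigroupD(1)[OF S less_imp_le[OF t(1)]])
    fix f :: "real^'n \<Rightarrow> complex" assume f: "f \<in> Lp_space p"
    have "Lp_tendsto p (\<lambda>n. S (t n) f) f"
      by (rule filterlim_compose[OF C0_semigroupD(4)[OF S f] tr])
    then have "Bseq (\<lambda>n. Lp_dist p (S (t n) f) f)" by (intro convergent_imp_Bseq) (auto simp: convergent_def)
    then obtain B where B: "\<And>n. Lp_dist p (S (t n) f) f \<le> B" by (auto elim!: BseqE) (metis Lp_norm_nonneg abs_of_nonneg)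
    have "Lp_norm p (S (t n) f) \<le> Lp_norm p f + B" for n
      using Lp_norm_le_add_diff[OF C0_semigroup_mem[OF S less_imp_le[OF t(1)] f] f p, of n] B[of n] by simp
    then show "\<exists>B. \<forall>n. Lp_norm p (S (t n) f) \<le> B" by blast
  qed
  then obtain M where M: "\<And>n f. f \<in> Lp_space p \<Longrightarrow> Lp_norm p (S (t n) f) \<le> M * Lp_norm p f" by blast
  obtain n where n: "M \<le> real n" using real_arch_simple by blast
  obtain f where f: "f \<in> Lp_space p" "real (Suc n) * Lp_norm p f < Lp_norm p (S (t n) f)" using big by blast
  have "M * Lp_norm p f \<le> real (Suc n) * Lp_norm p f" using n by (intro mult_right_mono) auto
  then show False using f M[OF f(1), of n] by simp
qed

lemma C0_semigroup_locally_bounded: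
  fixes S :: "real \<Rightarrow> (real^'n \<Rightarrow> complex) \<Rightarrow> (real^'n \<Rightarrow> complex)"
  assumes S: "C0_semigroup p S" and p: "1 \<le> p"
  obtains M where "1 \<le> M" "\<And>t f. 0 \<le> t \<Longrightarrow> t \<le> T \<Longrightarrow> f \<in> Lp_space p \<Longrightarrow> Lp_norm p (S t f) \<le> M * Lp_norm p f"
proof -
  obtain \<delta> M where \<delta>: "0 < \<delta>" and M1: "1 \<le> M" and M2: "\<forall>t\<in>{0..\<delta>}. \<forall>f\<in>Lp_space p. Lp_norm p (S t f) \<le> M * Lp_norm p f"
    using C0_semigroup_bounded_near_0[OF S p] by blast
  have M: "1 \<le> M" "\<And>t f. 0 \<le> t \<Longrightarrow> t \<le> \<delta> \<Longrightarrow> f \<in> Lp_space p \<Longrightarrow> Lp_norm p (S t f) \<le> M * Lp_norm p f"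
    using M1 M2 by simp_all
  have *: "Lp_norm p (S t f) \<le> M ^ Suc n * Lp_norm p f" if "0 \<le> t" "t \<le> real (Suc n) * \<delta>" "f \<in> Lp_space p" for n t f
    using that
  proof (induction n arbitrary: t)
    case 0
    then show ?case using M(2)[of t f] by simp
  next
    case (Suc n)
    show ?case
    proof (cases "t \<le> real (Suc n) * \<delta>")
      case True
      have "M ^ Suc n * Lp_norm p f \<le> M ^ Suc (Suc n) * Lp_norm p f"
        using M(1) by (intro mult_right_mono power_increasing) auto
      then show ?thesis using Suc.IH[OF Suc.prems(1) True Suc.prems(3)] by linarith
    next
      case False
      have "0 \<le> real (Suc n) * \<delta>" using \<delta> by simp
      moreover have "\<delta> \<le> real (Suc n) * \<delta>" using \<delta> by simp
      moreover have "real (Suc (Suc n)) * \<delta> = real (Suc n) * \<delta> + \<delta>" by (simp add: algebra_simps)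
      ultimately have s: "0 \<le> t - \<delta>" "t - \<delta> \<le> real (Suc n) * \<delta>" using False Suc.prems by linarith+
      have "Lp_norm p (S t f) = Lp_norm p (S \<delta> (S (t - \<delta>) f))"
        using C0_semigroup_norm_add[OF S less_imp_le[OF \<delta>] s(1) Suc.prems(3)] by simp
      also have "\<dots> \<le> M * Lp_norm p (S (t - \<delta>) f)" using \<delta> by (intro M C0_semigroup_mem[OF S] s Suc.prems) auto
      also have "\<dots> \<le> M * (M ^ Suc n * Lp_norm p f)" using M(1) by (intro mult_left_mono Suc.IH s Suc.prems) auto
      finally show ?thesis by (simp add: mult.assoc)
    qed
  qed
  obtain n where "T / \<delta> \<le> real n" using real_arch_simple by blast
  then have "T \<le> real n * \<delta>" using \<delta> by (simp add: divide_le_eq)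
  also have "\<dots> \<le> real (Suc n) * \<delta>" using \<delta> by (intro mult_right_mono) auto
  finally have n: "T \<le> real (Suc n) * \<delta>" .
  show ?thesis
  proof (rule that[of "M ^ Suc n"])
    show "1 \<le> M ^ Suc n" using M(1) by (rule one_le_power)
    show "Lp_norm p (S t f) \<le> M ^ Suc n * Lp_norm p f" if "0 \<le> t" "t \<le> T" "f \<in> Lp_space p" for t f
      using * that n by (meson order_trans)
  qed
qed

lemma C0_semigroup_increment:
  assumes S: "C0_semigroup p S" and t: "0 \<le> t" "0 \<le> h" and f: "f \<in> Lp_space p"
  shows "Lp_dist p (S (t + h) f) (S t f) = Lp_norm p (S t (\<lambda>x. S h f x - f x))"
proof -
  note mem = C0_semigroup_mem[OF S]
  have "Lp_dist p (S (t + h) f) (S t f) = Lp_dist p (S t (S h f)) (S t f)"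
    by (rule Lp_dist_cong_AE[OF C0_semigroupD(3)[OF S t f]])
  also have "\<dots> = Lp_norm p (S t (\<lambda>x. S h f x - f x))"
    by (rule bounded_linear_Lp_norm_diff[OF C0_semigroupD(1)[OF S t(1)] mem[OF t(2) f] f])
  finally show ?thesis .
qed

text \<open>
  Increments of an orbit at any time are images of increments at time 0 under uniformly bounded operators.
\<close>

lemma C0_semigroup_uniformly_continuous:
  fixes S :: "real \<Rightarrow> (real^'n \<Rightarrow> complex) \<Rightarrow> (real^'n \<Rightarrow> complex)"
  assumes S: "C0_semigroup p S" and p: "1 \<le> p" and f: "f \<in> Lp_space p" and e: "0 < e"
  obtains \<delta> where "0 < \<delta>"
    "\<And>s t. 0 \<le> s \<Longrightarrow> s \<le> t \<Longrightarrow> t \<le> T \<Longrightarrow> t - s < \<delta> \<Longrightarrow> Lp_dist p (S t f) (S s f) < e"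
proof -
  obtain M where M: "1 \<le> M" "\<And>t f. 0 \<le> t \<Longrightarrow> t \<le> T \<Longrightarrow> f \<in> Lp_space p \<Longrightarrow> Lp_norm p (S t f) \<le> M * Lp_norm p f"
    by (rule C0_semigroup_locally_bounded[OF S p]) blast
  have "0 < e / M" using e M by simp
  then have "eventually (\<lambda>h. Lp_dist p (S h f) f < e / M) (at_right 0)"
    by (rule order_tendstoD(2)[OF C0_semigroupD(4)[OF S f]])
  then obtain \<delta> where \<delta>: "0 < \<delta>" "\<And>h. 0 < h \<Longrightarrow> h < \<delta> \<Longrightarrow> Lp_dist p (S h f) f < e / M"
    unfolding eventually_at_right_field by auto
  show ?thesis
  proof (rule that[OF \<delta>(1)])
    fix s t assume st: "0 \<le> s" "s \<le> t" "t \<le> T" "t - s < \<delta>"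
    show "Lp_dist p (S t f) (S s f) < e"
    proof (cases "s = t")
      case True
      then show ?thesis using e by (simp add: Lp_norm_def)
    next
      case False
      have d: "(\<lambda>x. S (t - s) f x - f x) \<in> Lp_space p"
        using st f p by (intro Lp_space_diff C0_semigroup_mem[OF S]) auto
      have "Lp_dist p (S t f) (S s f) = Lp_norm p (S s (\<lambda>x. S (t - s) f x - f x))"
        using C0_semigroup_increment[OF S st(1) _ f, of "t - s"] st by simp
      also have "\<dots> \<le> M * Lp_dist p (S (t - s) f) f" using st by (intro M d) auto
      also have "\<dots> < M * (e / M)" using \<delta>(2)[of "t - s"] st False M by (intro mult_strict_left_mono) auto
      finally show ?thesis using M by simp
    qed
  qed
qed

lemma generator_invariant:
  fixes S :: "real \<Rightarrow> (real^'n \<Rightarrow> complex) \<Rightarrow> (real^'n \<Rightarrow> complex)"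
  assumes S: "C0_semigroup p S" and p: "1 \<le> p" and t: "0 \<le> t" and uf: "(u, f) \<in> generator p S"
  shows "(S t u, S t f) \<in> generator p S"
proof -
  have p0: "0 < p" using p by simp
  have u: "u \<in> Lp_space p" and f: "f \<in> Lp_space p"
    and lim: "((\<lambda>h. Lp_norm p (\<lambda>x. (S h u x - u x) / of_real h - f x)) \<longlongrightarrow> 0) (at_right 0)"
    using uf by (auto simp: generator_def)
  note mem = C0_semigroup_mem[OF S] and lin = C0_semigroupD(1)[OF S t]
  obtain K where K: "0 \<le> K" "\<And>g. g \<in> Lp_space p \<Longrightarrow> Lp_norm p (S t g) \<le> K * Lp_norm p g"
    by (rule bounded_linear_Lp_bound[OF lin]) blast
  have le: "Lp_norm p (\<lambda>x. (S h (S t u) x - S t u x) / of_real h - S t f x) \<le> K * Lp_norm p (\<lambda>x. (S h u x - u x) / of_real h - f x)"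
    if h: "h > 0" for h
  proof -
    let ?d = "\<lambda>x. S h u x - u x" and ?c = "of_real (1 / h) :: complex"
    have Sh: "S h u \<in> Lp_space p" using h u by (intro mem) auto
    have d: "?d \<in> Lp_space p" by (intro Lp_space_diff Sh u p0)
    have cd: "(\<lambda>x. ?c * ?d x) \<in> Lp_space p" by (rule Lp_space_cmult[OF d])
    have df: "(\<lambda>x. ?c * ?d x - f x) \<in> Lp_space p" by (rule Lp_space_diff[OF cd f p0])
    have eq: "(\<lambda>x. ?c * ?d x - f x) = (\<lambda>x. (S h u x - u x) / of_real h - f x)" by simp
    have "Lp_norm p (\<lambda>x. (S h (S t u) x - S t u x) / of_real h - S t f x) = Lp_norm p (S t (\<lambda>x. ?c * ?d x - f x))"
    proof (rule Lp_norm_cong_AE)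
      \<comment> \<open>The operators commute, as \<open>h + t = t + h\<close>.\<close>
      have c1: "AE x in lebesgue. S h (S t u) x = S t (S h u) x"
        using C0_semigroupD(3)[OF S less_imp_le[OF h] t u] C0_semigroupD(3)[OF S t less_imp_le[OF h] u]
        by eventually_elim (simp add: add.commute)
      show "AE x in lebesgue. (S h (S t u) x - S t u x) / of_real h - S t f x = S t (\<lambda>x. ?c * ?d x - f x) x"
        using c1 bounded_linear_Lp_diff[OF lin cd f] bounded_linear_Lp_cmult[OF lin d, of ?c] bounded_linear_Lp_diff[OF lin Sh u]
        by eventually_elim simp
    qed
    also have "\<dots> \<le> K * Lp_norm p (\<lambda>x. ?c * ?d x - f x)" by (rule K(2)[OF df])
    finally show ?thesis unfolding eq .
  qed
  have "((\<lambda>h. Lp_norm p (\<lambda>x. (S h (S t u) x - S t u x) / of_real h - S t f x)) \<longlongrightarrow> 0) (at_right 0)"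
  proof (rule Lim_null_comparison)
    show "((\<lambda>h. K * Lp_norm p (\<lambda>x. (S h u x - u x) / of_real h - f x)) \<longlongrightarrow> 0) (at_right 0)"
      by (rule tendsto_mult_right_zero[OF lim])
    have "eventually (\<lambda>h::real. h > 0) (at_right 0)" by (simp add: eventually_at_right_less)
    then show "eventually (\<lambda>h. norm (Lp_norm p (\<lambda>x. (S h (S t u) x - S t u x) / of_real h - S t f x))
        \<le> K * Lp_norm p (\<lambda>x. (S h u x - u x) / of_real h - f x)) (at_right 0)"
      by eventually_elim (use le in simp)
  qed
  then show ?thesis using mem[OF t u] mem[OF t f] by (simp add: generator_def)
qed

text \<open>
  The set of \<open>t\<close> up to which \<open>\<phi> \<le> \<phi> 0 + e t\<close> contains its supremum by continuity, and the
  condition on right increments moves beyond any point less than \<open>T\<close>.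
\<close>

lemma nonincreasing_of_right_increments:
  fixes \<phi> :: "real \<Rightarrow> real"
  assumes T: "0 \<le> T" and cont: "continuous_on {0..T} \<phi>"
    and inc: "\<And>t e. 0 \<le> t \<Longrightarrow> t < T \<Longrightarrow> 0 < e \<Longrightarrow> \<exists>\<delta>>0. \<forall>h. 0 < h \<and> h < \<delta> \<longrightarrow> \<phi> (t + h) \<le> \<phi> t + e * h"
  shows "\<phi> T \<le> \<phi> 0"
proof (rule field_le_epsilon)
  fix e' :: real assume e': "0 < e'"
  \<comment> \<open>The total gain over \<open>[0, T]\<close> is at most \<open>e T < e\'\<close>.\<close>
  define e where "e = e' / (T + 1)"
  have e: "0 < e" "e * T \<le> e'" using e' T by (auto simp: e_def field_simps)
  define A where "A = {t \<in> {0..T}. \<forall>s\<in>{0..t}. \<phi> s \<le> \<phi> 0 + e * s}"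
  have A0: "0 \<in> A" using T by (auto simp: A_def)
  have bdd: "bdd_above A" by (auto simp: A_def)
  define c where "c = Sup A"
  have c0: "0 \<le> c" unfolding c_def by (rule cSup_upper[OF A0 bdd])
  have cT: "c \<le> T" unfolding c_def
  proof (rule cSup_least)
    show "A \<noteq> {}" using A0 by blast
  qed (simp add: A_def)
  note c = c0 cT
  have below: "\<phi> s \<le> \<phi> 0 + e * s" if s: "0 \<le> s" "s < c" for s
  proof -
    have "A \<noteq> {}" using A0 by blast
    then obtain t where "t \<in> A" "s < t" using less_cSup_iff[OF _ bdd, of s] s(2) unfolding c_def by blast
    then show ?thesis using s by (auto simp: A_def)
  qed
  have at_c: "\<phi> c \<le> \<phi> 0 + e * c"
  proof (cases "c = 0")
    case False
    then have c0: "0 < c" using c by simp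
    have "continuous_on {0..c} \<phi>" using cont by (rule continuous_on_subset) (use c in auto)
    then have "continuous_on {0..c} (\<lambda>s. \<phi> s - e * s)" by (intro continuous_intros)
    moreover have cl: "closure {0..<c} = {0..c}" using c0 by simp
    ultimately have "continuous_on (closure {0..<c}) (\<lambda>s. \<phi> s - e * s)" by simp
    moreover have "c \<in> closure {0..<c}" using c0 cl by simp
    moreover have "\<phi> s - e * s \<le> \<phi> 0" if "s \<in> {0..<c}" for s using below[of s] that by simp
    ultimately have "\<phi> c - e * c \<le> \<phi> 0" by (rule continuous_le_on_closure)
    then show ?thesis by simp
  qed simp
  have "c = T"
  proof (rule ccontr)
    assume "c \<noteq> T"
    then have "c < T" using c by simp
    then obtain \<delta> where \<delta>: "0 < \<delta>" "\<And>h. 0 < h \<Longrightarrow> h < \<delta> \<Longrightarrow> \<phi> (c + h) \<le> \<phi> c + e * h"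
      using inc[OF c(1) _ e(1)] by blast
    define h where "h = min (\<delta> / 2) (T - c)"
    have h: "0 < h" "h < \<delta>" "c + h \<le> T" using \<delta> \<open>c < T\<close> by (auto simp: h_def)
    have "c + h \<in> A"
      unfolding A_def
    proof (intro CollectI conjI ballI)
      show "c + h \<in> {0..T}" using h c by simp
      fix s assume s: "s \<in> {0..c + h}"
      consider "s < c" | "s = c" | "c < s" by linarith
      then show "\<phi> s \<le> \<phi> 0 + e * s"
      proof cases
        case 3
        then have "\<phi> (c + (s - c)) \<le> \<phi> c + e * (s - c)" using s h by (intro \<delta>) auto
        then show ?thesis using at_c by (simp add: algebra_simps)
      qed (use below at_c s in auto)
    qed
    then have "c + h \<le> c" unfolding c_def using bdd by (rule cSup_upper)
    then show False using h by simp
  qed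
  then show "\<phi> T \<le> \<phi> 0 + e'" using at_c e by simp
qed

section \<open>Contractivity in \<open>L\<^sub>p\<close> and extension by density\<close>

context power_regularisation
begin

lemma energy_cong_AE:
  assumes "AE x in lebesgue. f x = g x" shows "energy f = energy g"
  unfolding energy_def
  by (rule integral_lebesgue_cong_AE) (use assms in eventually_elim, simp)

text \<open>
  The first order term of the energy is \<open>h Re (g, F u) \<le> 0\<close>; everything else is \<open>o(h)\<close>.
\<close>

lemma energy_right_increment:
  fixes S :: "real \<Rightarrow> (real^'n \<Rightarrow> complex) \<Rightarrow> (real^'n \<Rightarrow> complex)"
  assumes S: "C0_semigroup 2 S" and ug: "(u, g) \<in> generator 2 S"
    and diss: "Re (L2_inner g (\<lambda>x. F (u x))) \<le> 0" and \<epsilon>: "0 < \<epsilon>"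
  shows "\<exists>\<delta>>0. \<forall>h. 0 < h \<and> h < \<delta> \<longrightarrow> energy (S h u) \<le> energy u + \<epsilon> * h"
proof -
  have u: "u \<in> Lp_space 2" and g: "g \<in> Lp_space 2"
    and lim: "((\<lambda>h. Lp_norm 2 (\<lambda>x. (S h u x - u x) / of_real h - g x)) \<longlongrightarrow> 0) (at_right 0)"
    using ug by (auto simp: generator_def)
  let ?r = "\<lambda>h x. (S h u x - u x) / of_real h - g x"
  let ?N = "\<lambda>h. Lp_norm 2 (?r h)" and ?F = "\<lambda>x. F (u x)"
  let ?b = "\<lambda>h. ?N h * Lp_norm 2 ?F + K * h * (Lp_norm 2 g + ?N h)\<^sup>2"
  have id: "((\<lambda>h::real. h) \<longlongrightarrow> 0) (at_right 0)" by (rule tendsto_ident_at)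
  have "(?b \<longlongrightarrow> 0 * Lp_norm 2 ?F + K * 0 * (Lp_norm 2 g + 0)\<^sup>2) (at_right 0)"
    by (intro tendsto_add tendsto_mult tendsto_power tendsto_const lim id)
  then have "eventually (\<lambda>h. ?b h < \<epsilon>) (at_right 0)" using \<epsilon> by (intro order_tendstoD(2)) auto
  then obtain \<delta> where \<delta>: "0 < \<delta>" "\<And>h. 0 < h \<Longrightarrow> h < \<delta> \<Longrightarrow> ?b h < \<epsilon>"
    unfolding eventually_at_right_field by auto
  have "energy (S h u) \<le> energy u + \<epsilon> * h" if h: "0 < h" "h < \<delta>" for h
  proof -
    have Sh: "S h u \<in> Lp_space 2" using h u by (intro C0_semigroup_mem[OF S]) auto
    have d: "(\<lambda>x. S h u x - u x) \<in> Lp_space 2" by (intro Lp_space_diff Sh u) simp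
    have "(\<lambda>x. of_real (1 / h) * (S h u x - u x) - g x) \<in> Lp_space 2" by (intro Lp_space_diff Lp_space_cmult d g) simp
    then have r: "?r h \<in> Lp_space 2" by simp
    \<comment> \<open>\<open>?r h\<close> is the error of the difference quotient, which tends to 0 in \<open>L\<^sub>2\<close>.\<close>
    have eq: "(\<lambda>x. S h u x - u x) = (\<lambda>x. of_real h * (g x + ?r h x))" using h by (simp add: fun_eq_iff)
    have gr: "(\<lambda>x. g x + ?r h x) \<in> Lp_space 2" by (rule Lp_space_add[OF g r]) simp
    have n: "Lp_dist 2 (S h u) u = h * Lp_norm 2 (\<lambda>x. g x + ?r h x)"
      unfolding eq using h by (subst Lp_norm_cmult) auto
    have n2: "Lp_norm 2 (\<lambda>x. g x + ?r h x) \<le> Lp_norm 2 g + ?N h" by (rule Minkowski_Lp_norm[OF g r]) simp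
    have "L2_inner (\<lambda>x. S h u x - u x) ?F = of_real h * L2_inner (\<lambda>x. g x + ?r h x) ?F"
      unfolding eq L2_inner_def by (simp add: mult.assoc)
    also have "L2_inner (\<lambda>x. g x + ?r h x) ?F = L2_inner g ?F + L2_inner (?r h) ?F"
      using L2_inner_integrable[OF g F_L2[OF u]] L2_inner_integrable[OF r F_L2[OF u]]
      unfolding L2_inner_def distrib_right by (rule Bochner_Integration.integral_add)
    finally have "Re (L2_inner (\<lambda>x. S h u x - u x) ?F) = h * (Re (L2_inner g ?F) + Re (L2_inner (?r h) ?F))" by simp
    also have "\<dots> \<le> h * (0 + ?N h * Lp_norm 2 ?F)"
      using h diss order_trans[OF complex_Re_le_cmod L2_inner_bound[OF r F_L2[OF u]]]
      by (intro mult_left_mono add_mono) auto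
    finally have 1: "Re (L2_inner (\<lambda>x. S h u x - u x) ?F) \<le> h * (?N h * Lp_norm 2 ?F)" by simp
    have "(Lp_dist 2 (S h u) u)\<^sup>2 \<le> (h * (Lp_norm 2 g + ?N h))\<^sup>2"
      unfolding n using h n2 by (intro power_mono mult_left_mono mult_nonneg_nonneg) auto
    then have 2: "K * (Lp_dist 2 (S h u) u)\<^sup>2 \<le> K * (h * (Lp_norm 2 g + ?N h))\<^sup>2"
      using K_pos by (intro mult_left_mono) auto
    have "energy (S h u) - energy u \<le> h * (?N h * Lp_norm 2 ?F) + K * (h * (Lp_norm 2 g + ?N h))\<^sup>2"
      using energy_taylor[OF u Sh] 1 2 by linarith
    also have "\<dots> = h * ?b h" by (simp add: power2_eq_square algebra_simps)
    also have "\<dots> \<le> h * \<epsilon>" using \<delta>(2)[OF h] h by (intro mult_left_mono) auto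
    finally show ?thesis by (simp add: mult.commute)
  qed
  then show ?thesis using \<delta>(1) by blast
qed

lemma energy_orbit_continuous:
  fixes S :: "real \<Rightarrow> (real^'n \<Rightarrow> complex) \<Rightarrow> (real^'n \<Rightarrow> complex)"
  assumes S: "C0_semigroup 2 S" and u: "u \<in> Lp_space 2"
  shows "continuous_on {0..T} (\<lambda>t. energy (S t u))"
  unfolding continuous_on_sequentially
proof (intro allI ballI impI, elim conjE)
  fix x a assume a: "a \<in> {0..T}" and x: "\<forall>n. x n \<in> {0..T}" and lim: "x \<longlonglongrightarrow> a"
  have "(\<lambda>n. energy (S (x n) u)) \<longlonglongrightarrow> energy (S a u)"
  proof (rule energy_tendsto)
    show "S (x n) u \<in> Lp_space 2" for n using x u by (intro C0_semigroup_mem[OF S]) auto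
    show "S a u \<in> Lp_space 2" using a u by (intro C0_semigroup_mem[OF S]) auto
    show "Lp_tendsto 2 (\<lambda>n. S (x n) u) (S a u)"
    proof (rule LIMSEQ_I)
      fix e :: real assume e: "0 < e"
      obtain \<delta> where \<delta>: "0 < \<delta>" "\<And>s t. 0 \<le> s \<Longrightarrow> s \<le> t \<Longrightarrow> t \<le> T \<Longrightarrow> t - s < \<delta> \<Longrightarrow> Lp_dist 2 (S t u) (S s u) < e"
        by (rule C0_semigroup_uniformly_continuous[OF S _ u e, of T]) auto
      obtain N where N: "\<And>n. n \<ge> N \<Longrightarrow> \<bar>x n - a\<bar> < \<delta>" using LIMSEQ_D[OF lim \<delta>(1)] by auto
      have "Lp_dist 2 (S (x n) u) (S a u) < e" if "n \<ge> N" for n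
      proof (cases "a \<le> x n")
        case True
        then show ?thesis using \<delta>(2)[of a "x n"] N[OF that] a x by auto
      next
        case False
        then have "Lp_dist 2 (S a u) (S (x n) u) < e" using \<delta>(2)[of "x n" a] N[OF that] a x by auto
        then show ?thesis by (simp add: Lp_dist_commute[of 2 "S a u"])
      qed
      then show "\<exists>N. \<forall>n\<ge>N. norm (Lp_dist 2 (S (x n) u) (S a u) - 0) < e" by auto
    qed
  qed
  then show "((\<lambda>t. energy (S t u)) \<circ> x) \<longlonglongrightarrow> energy (S a u)" by (simp add: o_def)
qed

end

lemma (in elliptic_regularisation) energy_decreasing_on_domain:
  assumes S: "C0_semigroup 2 S"
    and gen: "generator 2 S = {(u, \<lambda>x. - f x) | u f. (u, f) \<in> elliptic_operator C}"
    and ug: "(u, g) \<in> generator 2 S" and t: "0 \<le> t"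
  shows "energy (S t u) \<le> energy u"
proof -
  have diss: "Re (L2_inner g (\<lambda>x. F (u x))) \<le> 0" if ug: "(u, g) \<in> generator 2 S" for u g
  proof -
    obtain f where f: "(u, f) \<in> elliptic_operator C" "g = (\<lambda>x. - f x)" using ug unfolding gen by blast
    show ?thesis using operator_F_accretive[OF f(1)] by (simp add: f(2) L2_inner_def)
  qed
  have u: "u \<in> Lp_space 2" using ug by (simp add: generator_def)
  note mem = C0_semigroup_mem[OF S]
  have "energy (S t u) \<le> energy (S 0 u)"
  proof (rule nonincreasing_of_right_increments[OF t energy_orbit_continuous[OF S u]])
    fix s \<epsilon> :: real assume s: "0 \<le> s" "s < t" and \<epsilon>: "0 < \<epsilon>"
    have inv: "(S s u, S s g) \<in> generator 2 S" by (rule generator_invariant[OF S _ s(1) ug]) simp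
    have eq: "energy (S (s + h) u) = energy (S h (S s u))" if "0 < h" for h
      using energy_cong_AE[OF C0_semigroupD(3)[OF S less_imp_le[OF that] s(1) u]] by (simp add: add.commute)
    show "\<exists>\<delta>>0. \<forall>h. 0 < h \<and> h < \<delta> \<longrightarrow> energy (S (s + h) u) \<le> energy (S s u) + \<epsilon> * h"
      using energy_right_increment[OF S inv diss[OF inv] \<epsilon>] eq by auto
  qed
  also have "energy (S 0 u) = energy u"
    by (rule energy_cong_AE[OF C0_semigroupD(2)[OF S u]])
  finally show ?thesis .
qed

lemma (in elliptic_regularisation) energy_decreasing:
  assumes S: "C0_semigroup 2 S"
    and gen: "generator 2 S = {(u, \<lambda>x. - f x) | u f. (u, f) \<in> elliptic_operator C}"
    and u: "u \<in> Lp_space 2" and t: "0 \<le> t"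
  shows "energy (S t u) \<le> energy u"
proof -
  interpret form: sectorial_form test_functions "elliptic_form C" "1 / cos \<theta>" by (rule sectorial_form_elliptic)
  obtain \<phi> where \<phi>: "\<And>n. \<phi> n \<in> test_functions" "Lp_tendsto 2 \<phi> u"
    by (rule test_functions_dense_L2[OF u]) blast
  have \<phi>L: "\<phi> n \<in> Lp_space 2" for n by (rule test_function_Lp[OF \<phi>(1)]) simp
  have le: "energy (S t (\<phi> n)) \<le> energy (\<phi> n)" for n
  proof -
    obtain f where "(\<phi> n, f) \<in> elliptic_operator C"
      using form.form_operator_core[OF \<phi>(1)] unfolding elliptic_operator_def by blast
    then have "(\<phi> n, \<lambda>x. - f x) \<in> generator 2 S" unfolding gen by blast
    then show ?thesis by (rule energy_decreasing_on_domain[OF S gen _ t])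
  qed
  note lin = C0_semigroupD(1)[OF S t] and mem = C0_semigroup_mem[OF S t]
  obtain L where L: "\<And>f. f \<in> Lp_space 2 \<Longrightarrow> Lp_norm 2 (S t f) \<le> L * Lp_norm 2 f"
    by (rule bounded_linear_Lp_bound[OF lin]) blast
  have "Lp_tendsto 2 (\<lambda>n. S t (\<phi> n)) (S t u)"
  proof (rule tendsto_norm_le[OF tendsto_mult_right_zero[OF \<phi>(2), of L]])
    show "norm (Lp_dist 2 (S t (\<phi> n)) (S t u) - 0) \<le> L * Lp_dist 2 (\<phi> n) u" for n
      using L[OF Lp_space_diff[OF \<phi>L u]] by (simp add: bounded_linear_Lp_norm_diff[OF lin \<phi>L u])
  qed
  then have "(\<lambda>n. energy (S t (\<phi> n))) \<longlonglongrightarrow> energy (S t u)" by (rule energy_tendsto[OF mem[OF \<phi>L] mem[OF u]])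
  moreover have "(\<lambda>n. energy (\<phi> n)) \<longlonglongrightarrow> energy u" by (rule energy_tendsto[OF \<phi>L u \<phi>(2)])
  ultimately show ?thesis by (rule LIMSEQ_le) (use le in blast)
qed

text \<open>
  The energies of \<open>u\<close> converge to the integral of \<open>\<bar>u\<bar>\<^sup>p / p\<close> by dominated convergence.  Nothing dominates
  those of \<open>S t u\<close> a priori, but Fatou's lemma gives the inequality that is needed.
\<close>

lemma (in elliptic_symmetric) Lp_contractive:
  assumes S: "C0_semigroup 2 S"
    and gen: "generator 2 S = {(u, \<lambda>x. - f x) | u f. (u, f) \<in> elliptic_operator C}"
    and p: "1 < p" and angle: "\<bar>1 - 2 / p\<bar> \<le> cos \<theta>"
    and u: "u \<in> Lp_space 2" "u \<in> Lp_space p" and t: "0 \<le> t"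
  shows "S t u \<in> Lp_space p" and "Lp_norm p (S t u) \<le> Lp_norm p u"
proof -
  define m where "m = (p - 2) / 2"
  have "2 * m = p - 2" by (simp add: m_def)
  then have m: "-1 < m" "2 * (m + 1) = p" using p by (simp_all add: distrib_left)
  \<comment> \<open>Two successors, as the regularisation requires \<open>e n < 1\<close> also for \<open>n = 0\<close>.\<close>
  define e where "e n = inverse (real (Suc (Suc n)))" for n
  have e: "0 < e n" "e n < 1" for n by (auto simp: e_def inverse_eq_divide)
  have e0: "e \<longlonglongrightarrow> 0" unfolding e_def by (rule LIMSEQ_Suc[OF LIMSEQ_inverse_real_of_nat])
  have Su: "S t u \<in> Lp_space 2" by (rule C0_semigroup_mem[OF S t u(1)])
  let ?G = "\<lambda>n. reg_potential m (e n)"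
  have reg: "elliptic_regularisation \<theta> C p (e n)" for n
    by unfold_locales (use p e angle in auto)
  then have preg: "power_regularisation p (e n)" for n by (rule elliptic_regularisation.axioms)
  have m': "power_regularisation.m p = m" using power_regularisation.m_def[OF preg] by (simp add: m_def)
  have int: "integrable lebesgue (\<lambda>x. ?G n (v x))" if "v \<in> Lp_space 2" for v :: "real^'n \<Rightarrow> complex" and n
    using power_regularisation.G_integrable[OF preg that] by (simp add: m')
  have dec: "(LINT x|lebesgue. ?G n (S t u x)) \<le> (LINT x|lebesgue. ?G n (u x))" for n
    using elliptic_regularisation.energy_decreasing[OF reg S gen u(1) t]
    by (simp add: power_regularisation.energy_def[OF preg] m')
  have pt: "(\<lambda>n. ?G n z) \<longlonglongrightarrow> norm z powr p / p" for z
    using reg_potential_tendsto[OF m(1) e e0, of z] unfolding m(2) .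
  define c where "c = (LINT x|lebesgue. norm (u x) powr p / p)"
  have lim: "(\<lambda>n. LINT x|lebesgue. ?G n (u x)) \<longlonglongrightarrow> c"
    unfolding c_def
  proof (rule integral_dominated_convergence)
    show "(\<lambda>x. norm (u x) powr p / p) \<in> borel_measurable lebesgue" using integrable_Lp[OF u(2)] by simp
    show "(\<lambda>x. ?G n (u x)) \<in> borel_measurable lebesgue" for n using int[OF u(1)] by (rule borel_measurable_integrable)
    show "integrable lebesgue (\<lambda>x. 2 powr \<bar>m\<bar> * ((norm (u x))\<^sup>2 + norm (u x) powr p / (m + 1)) / 2)"
      using integrable_Lp[OF u(2)] integrable_L2[OF u(1)] by simp
    show "AE x in lebesgue. (\<lambda>n. ?G n (u x)) \<longlonglongrightarrow> norm (u x) powr p / p" using pt by simp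
    show "AE x in lebesgue. norm (?G n (u x)) \<le> 2 powr \<bar>m\<bar> * ((norm (u x))\<^sup>2 + norm (u x) powr p / (m + 1)) / 2" for n
      using reg_potential_dominated[OF m(1) e, unfolded m(2)] reg_potential_nonneg[OF e(1)] by (intro AE_I2) simp
  qed
  have fatou: "integrable lebesgue (\<lambda>x. norm (S t u x) powr p / p) \<and> (LINT x|lebesgue. norm (S t u x) powr p / p) \<le> c + \<epsilon>"
    if "0 < \<epsilon>" for \<epsilon>
  proof -
    have "eventually (\<lambda>n. (LINT x|lebesgue. ?G n (u x)) < c + \<epsilon>) sequentially"
      by (rule order_tendstoD(2)[OF lim]) (use that in simp)
    then obtain N where N: "\<And>n. n \<ge> N \<Longrightarrow> (LINT x|lebesgue. ?G n (u x)) < c + \<epsilon>" by (auto simp: eventually_sequentially)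
    note [measurable] = measurable_Lp[OF Su]
    have meas: "(\<lambda>x. norm (S t u x) powr p / p) \<in> borel_measurable lebesgue" by measurable
    have l: "AE x in lebesgue. (\<lambda>n. ?G (n + N) (S t u x)) \<longlonglongrightarrow> norm (S t u x) powr p / p"
      by (rule AE_I2) (rule LIMSEQ_ignore_initial_segment[OF pt])
    have b: "(LINT x|lebesgue. ?G (n + N) (S t u x)) \<le> c + \<epsilon>" for n
      using dec[of "n + N"] N[of "n + N"] by simp
    note * = integral_Fatou[OF int[OF Su] reg_potential_nonneg[OF e(1)] meas l b]
    show ?thesis using *(1,2) by blast
  qed
  then have "integrable lebesgue (\<lambda>x. norm (S t u x) powr p / p * p)"
    by (intro integrable_mult_left) (use fatou[of 1] in simp)
  then have i: "integrable lebesgue (\<lambda>x. norm (S t u x) powr p)" using p by simp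
  then show "S t u \<in> Lp_space p" by (rule Lp_spaceI[OF measurable_Lp[OF Su]])
  have "(LINT x|lebesgue. norm (S t u x) powr p / p) \<le> c"
    by (rule field_le_epsilon) (use fatou in blast)
  then have "(LINT x|lebesgue. norm (S t u x) powr p) \<le> (LINT x|lebesgue. norm (u x) powr p)"
    using p by (simp add: c_def divide_le_cancel)
  then show "Lp_norm p (S t u) \<le> Lp_norm p u"
    using p by (subst Lp_norm_le_iff) (auto simp: Lp_norm_powr)
qed

text \<open>
  Convergence in \<open>L\<^sub>2\<close> gives almost everywhere convergence along subsequences, and contractivity the bound on norms.
\<close>

lemma Lp_contractive_strongly_continuous:
  fixes S :: "real \<Rightarrow> (real^'n \<Rightarrow> complex) \<Rightarrow> (real^'n \<Rightarrow> complex)"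
  assumes S: "C0_semigroup 2 S" and p: "0 < p" and f: "f \<in> Lp_space 2" "f \<in> Lp_space p"
    and contr: "\<And>t. 0 \<le> t \<Longrightarrow> S t f \<in> Lp_space p" "\<And>t. 0 \<le> t \<Longrightarrow> Lp_norm p (S t f) \<le> Lp_norm p f"
  shows "((\<lambda>t. Lp_dist p (S t f) f) \<longlongrightarrow> 0) (at_right 0)"
proof (rule tendsto_at_right_sequentially[of 0 1])
  fix t :: "nat \<Rightarrow> real" assume t: "\<And>n. 0 < t n" "t \<longlonglongrightarrow> 0"
  show "Lp_tendsto p (\<lambda>n. S (t n) f) f"
  proof (rule tendsto_zero_subseqI)
    fix r :: "nat \<Rightarrow> nat" assume r: "strict_mono r"
    have "(\<lambda>n. t (r n)) \<longlonglongrightarrow> 0" using LIMSEQ_subseq_LIMSEQ[OF t(2) r] by (simp add: o_def)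
    moreover have "t (r n) \<noteq> 0" for n using t(1)[of "r n"] by simp
    ultimately have "filterlim (\<lambda>n. t (r n)) (at_right 0) sequentially"
      using t(1) by (simp add: filterlim_at)
    then have "Lp_tendsto 2 (\<lambda>n. S (t (r n)) f) f"
      by (rule filterlim_compose[OF C0_semigroupD(4)[OF S f(1)]])
    then obtain s :: "nat \<Rightarrow> nat" where s: "strict_mono s" "AE x in lebesgue. (\<lambda>n. S (t (r (s n))) f x) \<longlonglongrightarrow> f x"
      by (rule Lp_tendsto_AE_subseq[OF C0_semigroup_mem[OF S less_imp_le[OF t(1)] f(1)] f(1) zero_less_numeral])
    have "Lp_tendsto p (\<lambda>n. S (t (r (s n))) f) f"
      by (rule Lp_tendsto_of_AE[OF contr(1)[OF less_imp_le[OF t(1)]] f(2) p s(2) contr(2)[OF less_imp_le[OF t(1)]]])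
    then show "\<exists>s::nat \<Rightarrow> nat. strict_mono s \<and> Lp_tendsto p (\<lambda>n. S (t (r (s n))) f) f"
      using s(1) by blast
  qed
qed simp

locale Lp_contractive_semigroup =
  fixes S :: "real \<Rightarrow> (real^'n \<Rightarrow> complex) \<Rightarrow> (real^'n \<Rightarrow> complex)" and p :: real
  assumes S: "C0_semigroup 2 S" and p: "1 < p"
    and contr_mem: "0 \<le> t \<Longrightarrow> f \<in> Lp_space 2 \<Longrightarrow> f \<in> Lp_space p \<Longrightarrow> S t f \<in> Lp_space p"
    and contr: "0 \<le> t \<Longrightarrow> f \<in> Lp_space 2 \<Longrightarrow> f \<in> Lp_space p \<Longrightarrow> Lp_norm p (S t f) \<le> Lp_norm p f"
begin

definition X :: "(real^'n \<Rightarrow> complex) set" where "X = Lp_space 2 \<inter> Lp_space p"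

lemma p_pos: "0 < p" and p_ge: "1 \<le> p" using p by auto

lemma X_D: "f \<in> X \<Longrightarrow> f \<in> Lp_space 2" "f \<in> X \<Longrightarrow> f \<in> Lp_space p" by (auto simp: X_def)

lemma X_add: "f \<in> X \<Longrightarrow> g \<in> X \<Longrightarrow> (\<lambda>x. f x + g x) \<in> X"
  and X_diff: "f \<in> X \<Longrightarrow> g \<in> X \<Longrightarrow> (\<lambda>x. f x - g x) \<in> X"
  and X_cmult: "f \<in> X \<Longrightarrow> (\<lambda>x. c * f x) \<in> X"
  using p_pos by (auto simp: X_def intro: Lp_space_add Lp_space_diff Lp_space_cmult)

lemma S_X: "0 \<le> t \<Longrightarrow> f \<in> X \<Longrightarrow> S t f \<in> X"
  by (auto simp: X_def contr_mem intro: C0_semigroup_mem[OF S])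

lemma S_lin: "0 \<le> t \<Longrightarrow> bounded_linear_Lp 2 (S t)" by (rule C0_semigroupD(1)[OF S])

lemma S_contr_diff:
  assumes t: "0 \<le> t" and f: "f \<in> X" and g: "g \<in> X"
  shows "Lp_dist p (S t f) (S t g) \<le> Lp_dist p f g"
proof -
  have "Lp_dist p (S t f) (S t g) = Lp_norm p (S t (\<lambda>x. f x - g x))"
    by (rule Lp_norm_cong_AE)
       (use bounded_linear_Lp_diff[OF S_lin[OF t] X_D(1)[OF f] X_D(1)[OF g]] in eventually_elim, simp)
  also have "\<dots> \<le> Lp_dist p f g"
    by (rule contr[OF t X_D(1)[OF X_diff[OF f g]] X_D(2)[OF X_diff[OF f g]]])
  finally show ?thesis .
qed

lemma truncation_X: "f \<in> Lp_space p \<Longrightarrow> truncation n f \<in> X"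
  unfolding X_def using p_pos by (auto intro: truncation_in_Lp_space)

lemma truncation_N: "f \<in> Lp_space p \<Longrightarrow> Lp_tendsto p (\<lambda>n. truncation n f) f"
  by (rule truncation_tendsto[OF _ p_pos])

definition is_extension :: "real \<Rightarrow> (real^'n \<Rightarrow> complex) \<Rightarrow> (real^'n \<Rightarrow> complex) \<Rightarrow> bool" where
  "is_extension t f g \<longleftrightarrow> g \<in> Lp_space p \<and>
     (\<forall>h. (\<forall>n. h n \<in> X) \<longrightarrow> Lp_tendsto p h f \<longrightarrow> Lp_tendsto p (\<lambda>n. S t (h n)) g)"

definition Sp :: "real \<Rightarrow> (real^'n \<Rightarrow> complex) \<Rightarrow> (real^'n \<Rightarrow> complex)" where
  "Sp t f = (SOME g. is_extension t f g)"

lemma Lp_triangle: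
  assumes "f \<in> Lp_space p" "g \<in> Lp_space p" "h \<in> Lp_space p"
  shows "Lp_dist p f h \<le> Lp_dist p f g + Lp_dist p g h"
  by (rule Lp_norm_triangle_diff[OF assms p_ge])

lemma extension_exists:
  assumes t: "0 \<le> t" and f: "f \<in> Lp_space p"
  shows "\<exists>g. is_extension t f g"
proof -
  let ?f = "\<lambda>n. truncation n f"
  note fX = truncation_X[OF f] and fN = truncation_N[OF f]
  have cauchy: "\<exists>M. \<forall>m\<ge>M. \<forall>n\<ge>M. Lp_dist p (S t (?f m)) (S t (?f n)) < e" if e: "0 < e" for e
  proof -
    obtain M where M: "\<And>n. n \<ge> M \<Longrightarrow> Lp_dist p (?f n) f < e / 2"
      using order_tendstoD(2)[OF fN, of "e / 2"] e by (auto simp: eventually_sequentially)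
    have "Lp_dist p (S t (?f m)) (S t (?f n)) < e" if "m \<ge> M" "n \<ge> M" for m n
    proof -
      have "Lp_dist p (S t (?f m)) (S t (?f n)) \<le> Lp_dist p (?f m) (?f n)"
        by (rule S_contr_diff[OF t fX fX])
      also have "\<dots> \<le> Lp_dist p (?f m) f + Lp_dist p f (?f n)"
        by (rule Lp_triangle[OF X_D(2)[OF fX] f X_D(2)[OF fX]])
      finally show ?thesis using M[OF that(1)] M[OF that(2)] by (simp add: Lp_dist_commute[of p f])
    qed
    then show ?thesis by blast
  qed
  obtain g where g: "g \<in> Lp_space p" "Lp_tendsto p (\<lambda>n. S t (?f n)) g"
    by (rule Lp_complete[OF X_D(2)[OF S_X[OF t fX]] p_ge cauchy])
  have "is_extension t f g"
    unfolding is_extension_def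
  proof (intro conjI allI impI g(1))
    fix h assume hX: "\<forall>n. h n \<in> X" and hN: "Lp_tendsto p h f"
    have zero_sum: "(\<lambda>n. Lp_dist p (h n) f + Lp_dist p (?f n) f + Lp_dist p (S t (?f n)) g) \<longlonglongrightarrow> 0"
      by (intro tendsto_add_zero hN fN g(2))
    show "Lp_tendsto p (\<lambda>n. S t (h n)) g"
    proof (rule tendsto_norm_le[OF zero_sum])
      fix n
      have hn: "h n \<in> X" using hX by blast
      have "Lp_dist p (S t (h n)) g \<le> Lp_dist p (S t (h n)) (S t (?f n)) + Lp_dist p (S t (?f n)) g"
        by (rule Lp_triangle[OF X_D(2)[OF S_X[OF t hn]] X_D(2)[OF S_X[OF t fX]] g(1)])
      also have "Lp_dist p (S t (h n)) (S t (?f n)) \<le> Lp_dist p (h n) (?f n)" by (rule S_contr_diff[OF t hn fX])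
      also have "\<dots> \<le> Lp_dist p (h n) f + Lp_dist p f (?f n)"
        by (rule Lp_triangle[OF X_D(2)[OF hn] f X_D(2)[OF fX]])
      finally show "norm (Lp_dist p (S t (h n)) g - 0) \<le> Lp_dist p (h n) f + Lp_dist p (?f n) f + Lp_dist p (S t (?f n)) g"
        by (simp add: Lp_dist_commute[of p f])
    qed
  qed
  then show ?thesis by blast
qed

lemma Sp_extension: "0 \<le> t \<Longrightarrow> f \<in> Lp_space p \<Longrightarrow> is_extension t f (Sp t f)"
  unfolding Sp_def by (rule someI_ex[OF extension_exists])

lemma Sp_mem: "0 \<le> t \<Longrightarrow> f \<in> Lp_space p \<Longrightarrow> Sp t f \<in> Lp_space p"
  using Sp_extension by (simp add: is_extension_def)

lemma Sp_tendsto: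
  assumes "0 \<le> t" "f \<in> Lp_space p" "\<And>n. h n \<in> X" "Lp_tendsto p h f"
  shows "Lp_tendsto p (\<lambda>n. S t (h n)) (Sp t f)"
  using Sp_extension[OF assms(1,2)] assms(3,4) unfolding is_extension_def by blast

text \<open>
  All laws of the extension follow from this: compare limits along one sequence in \<open>L\<^sub>2 \<inter> L\<^sub>p\<close>, usually the truncations.
\<close>

lemma Sp_unique:
  assumes t: "0 \<le> t" and f: "f \<in> Lp_space p" and h: "\<And>n. h n \<in> X" "Lp_tendsto p h f"
    and g: "g \<in> Lp_space p" "Lp_tendsto p (\<lambda>n. S t (h n)) g"
  shows "AE x in lebesgue. Sp t f x = g x"
proof -
  note m = Sp_mem[OF t f]
  have "Lp_dist p (Sp t f) g \<le> Lp_dist p (S t (h n)) (Sp t f) + Lp_dist p (S t (h n)) g" for n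
    using Lp_triangle[OF m X_D(2)[OF S_X[OF t h(1)]] g(1), of n] by (simp add: Lp_dist_commute[of p "Sp t f"])
  moreover have "(\<lambda>n. Lp_dist p (S t (h n)) (Sp t f) + Lp_dist p (S t (h n)) g) \<longlonglongrightarrow> 0"
    using tendsto_add[OF Sp_tendsto[OF t f h] g(2)] by simp
  ultimately have "Lp_dist p (Sp t f) g \<le> 0" by (intro LIMSEQ_le_const) auto
  then have "Lp_dist p (Sp t f) g = 0" using Lp_norm_nonneg[of p "\<lambda>x. Sp t f x - g x"] by linarith
  then have "AE x in lebesgue. Sp t f x - g x = 0" using Lp_norm_eq_0[OF Lp_space_diff[OF m g(1) p_pos] p_pos] by blast
  then show ?thesis by eventually_elim simp
qed

lemma Sp_consistent:
  assumes t: "0 \<le> t" and f: "f \<in> X" shows "AE x in lebesgue. Sp t f x = S t f x"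
  by (rule Sp_unique[OF t X_D(2)[OF f], of "\<lambda>n. f"]) (use f t in \<open>auto simp: Lp_norm_def X_D S_X\<close>)

lemma Sp_add:
  assumes t: "0 \<le> t" and f: "f \<in> Lp_space p" and g: "g \<in> Lp_space p"
  shows "AE x in lebesgue. Sp t (\<lambda>y. f y + g y) x = Sp t f x + Sp t g x"
proof (rule Sp_unique[OF t])
  let ?f = "\<lambda>n. truncation n f" and ?g = "\<lambda>n. truncation n g"
  note fX = truncation_X[OF f] and gX = truncation_X[OF g]
  note mf = Sp_mem[OF t f] and mg = Sp_mem[OF t g]
  note Sf = S_X[OF t fX] and Sg = S_X[OF t gX]
  show "(\<lambda>x. f x + g x) \<in> Lp_space p" "(\<lambda>x. Sp t f x + Sp t g x) \<in> Lp_space p"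
    by (intro Lp_space_add f g mf mg p_pos)+
  show "(\<lambda>x. ?f n x + ?g n x) \<in> X" for n by (rule X_add[OF fX gX])
  have le: "Lp_norm p (\<lambda>x. (u x + v x) - (u' x + v' x)) \<le> Lp_dist p u u' + Lp_dist p v v'"
    if "u \<in> Lp_space p" "v \<in> Lp_space p" "u' \<in> Lp_space p" "v' \<in> Lp_space p" for u v u' v'
    using Minkowski_Lp_norm[OF Lp_space_diff[OF that(1,3) p_pos] Lp_space_diff[OF that(2,4) p_pos] p_ge]
    by (simp add: algebra_simps)
  show "(\<lambda>n. Lp_norm p (\<lambda>x. ?f n x + ?g n x - (f x + g x))) \<longlonglongrightarrow> 0"
    by (rule tendsto_norm_le[OF tendsto_add_zero[OF truncation_N[OF f] truncation_N[OF g]]])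
       (use le[OF X_D(2)[OF fX] X_D(2)[OF gX] f g] in simp)
  show "(\<lambda>n. Lp_norm p (\<lambda>x. S t (\<lambda>x. ?f n x + ?g n x) x - (Sp t f x + Sp t g x))) \<longlonglongrightarrow> 0"
  proof (rule tendsto_norm_le[OF tendsto_add_zero[OF Sp_tendsto[OF t f fX truncation_N[OF f]] Sp_tendsto[OF t g gX truncation_N[OF g]]]])
    fix n
    have "Lp_dist p (S t (\<lambda>x. ?f n x + ?g n x)) (\<lambda>x. Sp t f x + Sp t g x)
        = Lp_norm p (\<lambda>x. (S t (?f n) x + S t (?g n) x) - (Sp t f x + Sp t g x))"
      by (rule Lp_dist_cong_AE[OF bounded_linear_Lp_add[OF S_lin[OF t] X_D(1)[OF fX] X_D(1)[OF gX]]])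
    then show "norm (Lp_norm p (\<lambda>x. S t (\<lambda>x. ?f n x + ?g n x) x - (Sp t f x + Sp t g x)) - 0)
        \<le> Lp_dist p (S t (?f n)) (Sp t f) + Lp_dist p (S t (?g n)) (Sp t g)"
      using le[OF X_D(2)[OF Sf] X_D(2)[OF Sg] mf mg, of n n] by simp
  qed
qed

lemma Sp_cmult:
  assumes t: "0 \<le> t" and f: "f \<in> Lp_space p"
  shows "AE x in lebesgue. Sp t (\<lambda>y. c * f y) x = c * Sp t f x"
proof (rule Sp_unique[OF t])
  let ?f = "\<lambda>n. truncation n f"
  note fX = truncation_X[OF f] and mf = Sp_mem[OF t f]
  show "(\<lambda>x. c * f x) \<in> Lp_space p" "(\<lambda>x. c * Sp t f x) \<in> Lp_space p" by (intro Lp_space_cmult f mf)+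
  show "(\<lambda>x. c * ?f n x) \<in> X" for n by (rule X_cmult[OF fX])
  have sc: "Lp_norm p (\<lambda>x. c * u x - c * v x) = norm c * Lp_dist p u v" for u v :: "real^'n \<Rightarrow> complex"
    using Lp_norm_cmult[OF p_pos, of c "\<lambda>x. u x - v x"] by (simp add: right_diff_distrib)
  show "(\<lambda>n. Lp_norm p (\<lambda>x. c * ?f n x - c * f x)) \<longlonglongrightarrow> 0"
    unfolding sc by (rule tendsto_mult_right_zero[OF truncation_N[OF f]])
  show "(\<lambda>n. Lp_norm p (\<lambda>x. S t (\<lambda>x. c * ?f n x) x - c * Sp t f x)) \<longlonglongrightarrow> 0"
  proof (rule tendsto_norm_le[OF tendsto_mult_right_zero[OF Sp_tendsto[OF t f fX truncation_N[OF f]], of "norm c"]])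
    fix n
    have "Lp_dist p (S t (\<lambda>x. c * ?f n x)) (\<lambda>x. c * Sp t f x) = Lp_norm p (\<lambda>x. c * S t (?f n) x - c * Sp t f x)"
      by (rule Lp_dist_cong_AE[OF bounded_linear_Lp_cmult[OF S_lin[OF t] X_D(1)[OF fX]]])
    then show "norm (Lp_norm p (\<lambda>x. S t (\<lambda>x. c * ?f n x) x - c * Sp t f x) - 0) \<le> norm c * Lp_dist p (S t (?f n)) (Sp t f)"
      by (simp add: sc)
  qed
qed

lemma Sp_contr:
  assumes t: "0 \<le> t" and f: "f \<in> Lp_space p"
  shows "Lp_norm p (Sp t f) \<le> Lp_norm p f"
proof -
  let ?f = "\<lambda>n. truncation n f"
  note fX = truncation_X[OF f] and mf = Sp_mem[OF t f]
  have "Lp_norm p (Sp t f) \<le> Lp_norm p f + Lp_dist p (?f n) f + Lp_dist p (S t (?f n)) (Sp t f)" for n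
    using Lp_norm_le_add_diff[OF mf X_D(2)[OF S_X[OF t fX]] p_ge, of n]
      contr[OF t X_D(1)[OF fX] X_D(2)[OF fX], of n] Lp_norm_le_add_diff[OF X_D(2)[OF fX] f p_ge, of n]
    by (simp add: Lp_dist_commute[of p "Sp t f"])
  moreover have "(\<lambda>n. Lp_norm p f + Lp_dist p (?f n) f + Lp_dist p (S t (?f n)) (Sp t f)) \<longlonglongrightarrow> Lp_norm p f + 0 + 0"
    by (intro tendsto_add tendsto_const truncation_N[OF f] Sp_tendsto[OF t f fX])
  ultimately show ?thesis using LIMSEQ_le_const by fastforce
qed

lemma Sp_bounded_linear: "0 \<le> t \<Longrightarrow> bounded_linear_Lp p (Sp t)"
  unfolding bounded_linear_Lp_def
  by (intro conjI ballI allI Sp_mem Sp_add Sp_cmult exI[of _ 1]) (auto simp: Sp_contr)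

lemma Sp_0:
  assumes f: "f \<in> Lp_space p" shows "AE x in lebesgue. Sp 0 f x = f x"
proof (rule Sp_unique[OF order_refl f truncation_X[OF f] truncation_N[OF f] f])
  have "Lp_dist p (S 0 (truncation n f)) f = Lp_dist p (truncation n f) f" for n
    by (rule Lp_dist_cong_AE[OF C0_semigroupD(2)[OF S X_D(1)[OF truncation_X[OF f]]]])
  then show "Lp_tendsto p (\<lambda>n. S 0 (truncation n f)) f" using truncation_N[OF f] by simp
qed

lemma Sp_semigroup:
  assumes s: "0 \<le> s" and t: "0 \<le> t" and f: "f \<in> Lp_space p"
  shows "AE x in lebesgue. Sp (s + t) f x = Sp s (Sp t f) x"
proof -
  let ?f = "\<lambda>n. truncation n f"
  note fX = truncation_X[OF f] and fN = truncation_N[OF f]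
  note m = Sp_mem[OF s Sp_mem[OF t f]]
  have eq: "Lp_dist p (S (s + t) (?f n)) (Sp s (Sp t f)) = Lp_dist p (S s (S t (?f n))) (Sp s (Sp t f))" for n
    by (rule Lp_dist_cong_AE[OF C0_semigroupD(3)[OF S s t X_D(1)[OF fX]]])
  have "Lp_tendsto p (\<lambda>n. S s (S t (?f n))) (Sp s (Sp t f))"
    by (rule Sp_tendsto[OF s Sp_mem[OF t f] S_X[OF t fX] Sp_tendsto[OF t f fX fN]])
  then show ?thesis by (intro Sp_unique[OF add_nonneg_nonneg[OF s t] f fX fN m]) (simp add: eq)
qed

lemma Sp_strongly_continuous:
  assumes f: "f \<in> Lp_space p"
  shows "((\<lambda>t. Lp_dist p (Sp t f) f) \<longlongrightarrow> 0) (at_right 0)"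
proof (rule tendstoI)
  fix e :: real assume e: "0 < e"
  obtain n where n: "Lp_dist p (truncation n f) f < e / 3"
    using order_tendstoD(2)[OF truncation_N[OF f], of "e / 3"] e by (auto simp: eventually_sequentially)
  define g where "g = truncation n f"
  have gX: "g \<in> X" unfolding g_def by (rule truncation_X[OF f])
  note g = X_D[OF gX]
  have gf: "Lp_dist p f g < e / 3" using n by (simp add: g_def Lp_dist_commute[of p f])
  have "((\<lambda>t. Lp_dist p (S t g) g) \<longlongrightarrow> 0) (at_right 0)"
    by (rule Lp_contractive_strongly_continuous[OF S p_pos g]) (auto intro: contr contr_mem g)
  then have "eventually (\<lambda>t. Lp_dist p (S t g) g < e / 3) (at_right 0)"
    using e by (intro order_tendstoD(2)) auto
  moreover have "eventually (\<lambda>t::real. t > 0) (at_right 0)" by (simp add: eventually_at_right_less)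
  ultimately show "eventually (\<lambda>t. dist (Lp_dist p (Sp t f) f) 0 < e) (at_right 0)"
  proof eventually_elim
    case (elim t)
    then have t: "0 \<le> t" by simp
    note mf = Sp_mem[OF t f] and mg = Sp_mem[OF t g(2)]
    have "Lp_dist p (Sp t f) (Sp t g) = Lp_norm p (Sp t (\<lambda>x. f x - g x))"
      by (rule bounded_linear_Lp_norm_diff[OF Sp_bounded_linear[OF t] f g(2)])
    also have "\<dots> \<le> Lp_dist p f g" by (rule Sp_contr[OF t Lp_space_diff[OF f g(2) p_pos]])
    finally have 1: "Lp_dist p (Sp t f) (Sp t g) < e / 3" using gf by simp
    have 2: "Lp_dist p (Sp t g) g = Lp_dist p (S t g) g"
      by (rule Lp_dist_cong_AE[OF Sp_consistent[OF t gX]])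
    have "Lp_dist p (Sp t f) f \<le> Lp_dist p (Sp t f) (Sp t g) + Lp_dist p (Sp t g) f"
      by (rule Lp_triangle[OF mf mg f])
    also have "Lp_dist p (Sp t g) f \<le> Lp_dist p (Sp t g) g + Lp_dist p g f"
      by (rule Lp_triangle[OF mg g(2) f])
    finally have "Lp_dist p (Sp t f) f < e"
      using 1 2 elim gf by (simp add: Lp_dist_commute[of p g])
    then show ?case by simp
  qed
qed

theorem contraction_extension:
  "contraction_semigroup p Sp \<and> extends_consistently p S Sp"
  unfolding contraction_semigroup_def C0_semigroup_def extends_consistently_def
  using Sp_bounded_linear Sp_0 Sp_semigroup Sp_strongly_continuous Sp_contr Sp_consistent
  by (auto simp: X_def)

end

theorem proposition1p1:
  fixes \<theta> p :: real
    and C :: "real^'n \<Rightarrow> complex^'n^'n"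
    and R B :: "real^'n \<Rightarrow> real^'n^'n"
    and S :: "real \<Rightarrow> (real^'n \<Rightarrow> complex) \<Rightarrow> (real^'n \<Rightarrow> complex)"
  assumes "0 \<le> \<theta>" and "\<theta> < pi / 2"
    and "\<And>k l. (\<lambda>x. C x $ k $ l) \<in> sobolev_inf 2"
    and "\<And>x \<xi>. cvec_inner (C x *v \<xi>) \<xi> \<in> sector \<theta>"
    and "\<And>x k l. C x $ k $ l = of_real (R x $ k $ l) + \<i> * of_real (B x $ k $ l)"
    and "C0_semigroup 2 S"
    and "generator 2 S = {(u, \<lambda>x. - f x) | u f. (u, f) \<in> elliptic_operator C}"
    and "1 < p"
    and "\<bar>1 - 2 / p\<bar> \<le> cos \<theta>"
    and "\<And>x. antisym_part (B x) = 0"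
  shows "\<exists>Sp. contraction_semigroup p Sp \<and> extends_consistently p S Sp"
proof -
  have B: "B x $ k $ l = B x $ l $ k" for x k l
  proof -
    have "antisym_part (B x) $ k $ l = 0" using assms(10)[of x] by simp
    then show ?thesis by (simp add: antisym_part_def transpose_def)
  qed
  interpret elliptic_symmetric \<theta> C
  proof
    show "(\<lambda>x. C x $ k $ l) \<in> sobolev_inf 1" for k l
      using assms(3)[of k l] by (auto simp: sobolev_inf_def)
    show "Im (C x $ k $ l) = Im (C x $ l $ k)" for x k l
      using B[of x k l] by (simp add: assms(5))
  qed (use assms(1,2,4) in auto)
  interpret Lp_contractive_semigroup S p
    by unfold_locales (use assms Lp_contractive[OF assms(6,7,8,9)] in auto)
  show ?thesis using contraction_extension by blast
qed

end
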